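(* Let $G$ be a quadrangulation of the projective plane. Then the local chromatic number satisfies $\psi(G)\in\{2,4\}$.
   Context: A surface is a compact connected 2-manifold without boundary. A quadrangulation of a surface is a (finite) loopless graph embedded on the surface such that all faces are quadrilaterals; parallel edges are allowed, and quadrilateral faces may have some of their vertices or even edges coinciding. For a vertex $v$ of a graph $G$, $N(v)$ denotes the set of vertices adjacent to $v$. For an integer $k\ge 1$, a proper vertex-coloring $c$ of $G$ is a local $k$-coloring if $|c(N(v))|\le k-1$ for every vertex $v$ of $G$ (the total number of colors used is not restricted). The local chromatic number $\psi(G)$ is the smallest $k$ such that $G$ has a local $k$-coloring. *)

theory Defs
  imports "HOL-Analysis.Analysis"
begin

section \<open>The projective plane\<close>

text \<open>Points are antipodal pairs of unit vectors; the topology is the quotient topology.\<close>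

definition antipodal_pair :: "real ^ 3 \<Rightarrow> (real ^ 3) set" where
  "antipodal_pair x = {x, - x}"

definition projective_plane :: "(real ^ 3) set topology" where
  "projective_plane = topology (\<lambda>U. U \<subseteq> antipodal_pair ` sphere 0 1 \<and>
     openin (top_of_set (sphere 0 1)) {x \<in> sphere 0 1. antipodal_pair x \<in> U})"

lemma openin_projective_plane:
  "openin projective_plane U \<longleftrightarrow> U \<subseteq> antipodal_pair ` sphere 0 1 \<and>
     openin (top_of_set (sphere 0 1)) {x \<in> sphere 0 1. antipodal_pair x \<in> U}"
proof -
  let ?S = "sphere (0 :: real ^ 3) 1"
  let ?pre = "\<lambda>U. {x \<in> ?S. antipodal_pair x \<in> U}"
  have "istopology (\<lambda>U. U \<subseteq> antipodal_pair ` ?S \<and> openin (top_of_set ?S) (?pre U))"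
    unfolding istopology_def
  proof (intro conjI allI impI)
    fix U V
    assume "U \<subseteq> antipodal_pair ` ?S \<and> openin (top_of_set ?S) (?pre U)"
      and "V \<subseteq> antipodal_pair ` ?S \<and> openin (top_of_set ?S) (?pre V)"
    moreover have "?pre (U \<inter> V) = ?pre U \<inter> ?pre V"
      by auto
    ultimately show "U \<inter> V \<subseteq> antipodal_pair ` ?S" "openin (top_of_set ?S) (?pre (U \<inter> V))"
      by (auto simp: openin_Int)
  next
    fix \<K>
    assume K: "\<forall>K\<in>\<K>. K \<subseteq> antipodal_pair ` ?S \<and> openin (top_of_set ?S) (?pre K)"
    then show "\<Union>\<K> \<subseteq> antipodal_pair ` ?S"
      by blast
    have "?pre (\<Union>\<K>) = \<Union>(?pre ` \<K>)"
      by auto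
    with K show "openin (top_of_set ?S) (?pre (\<Union>\<K>))"
      by auto
  qed
  then show ?thesis
    unfolding projective_plane_def by simp
qed

lemma topspace_projective_plane: "topspace projective_plane = antipodal_pair ` sphere 0 1"
proof
  show "topspace projective_plane \<subseteq> antipodal_pair ` sphere 0 1"
    using openin_projective_plane[of "topspace projective_plane"] by simp
  have "{x \<in> sphere 0 1. antipodal_pair x \<in> antipodal_pair ` sphere 0 1} = sphere 0 1"
    by auto
  then have "openin projective_plane (antipodal_pair ` sphere 0 1)"
    by (simp add: openin_projective_plane)
  then show "antipodal_pair ` sphere 0 1 \<subseteq> topspace projective_plane"
    by (rule openin_subset)
qed

lemma quotient_map_antipodal_pair:
  "quotient_map (top_of_set (sphere 0 1)) projective_plane antipodal_pair"
  unfolding quotient_map_def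
  by (auto simp: topspace_projective_plane openin_projective_plane)

section \<open>Quadrangulations\<close>

text \<open>Edges are elements of a separate type, so that distinct edges may have the same ends.\<close>

record ('v, 'e) multigraph =
  verts :: "'v set"
  edges :: "'e set"
  ends :: "'e \<Rightarrow> 'v set"

definition finite_loopless_multigraph :: "('v, 'e) multigraph \<Rightarrow> bool" where
  "finite_loopless_multigraph G \<longleftrightarrow> finite (verts G) \<and> finite (edges G) \<and>
     (\<forall>e \<in> edges G. ends G e \<subseteq> verts G \<and> card (ends G e) = 2)"

text \<open>
  In an embedding, \<open>pos v\<close> is the point representing the vertex \<open>v\<close>, and the edge \<open>e\<close> is
  represented by the simple arc parametrized by \<open>crv e\<close> on the unit interval.
\<close>

definition embedded_in ::
  "'p topology \<Rightarrow> ('v, 'e) multigraph \<Rightarrow> ('v \<Rightarrow> 'p) \<Rightarrow> ('e \<Rightarrow> real \<Rightarrow> 'p) \<Rightarrow> bool" where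
  "embedded_in X G pos crv \<longleftrightarrow>
     pos ` verts G \<subseteq> topspace X \<and> inj_on pos (verts G) \<and>
     (\<forall>e \<in> edges G. embedding_map (top_of_set {0..1}) X (crv e) \<and>
        {crv e 0, crv e 1} = pos ` ends G e \<and>
        crv e ` {0<..<1} \<inter> pos ` verts G = {}) \<and>
     (\<forall>e \<in> edges G. \<forall>f \<in> edges G. e \<noteq> f \<longrightarrow> crv e ` {0<..<1} \<inter> crv f ` {0<..<1} = {})"

definition drawing ::
  "('v, 'e) multigraph \<Rightarrow> ('v \<Rightarrow> 'p) \<Rightarrow> ('e \<Rightarrow> real \<Rightarrow> 'p) \<Rightarrow> 'p set" where
  "drawing G pos crv = pos ` verts G \<union> (\<Union>e \<in> edges G. crv e ` {0..1})"

definition faces ::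
  "'p topology \<Rightarrow> ('v, 'e) multigraph \<Rightarrow> ('v \<Rightarrow> 'p) \<Rightarrow> ('e \<Rightarrow> real \<Rightarrow> 'p) \<Rightarrow> 'p set set" where
  "faces X G pos crv =
     connected_components_of (subtopology X (topspace X - drawing G pos crv))"

definition unit_square :: "(real \<times> real) set" where
  "unit_square = {0..1} \<times> {0..1}"

definition open_square :: "(real \<times> real) set" where
  "open_square = {0<..<1} \<times> {0<..<1}"

definition square_sides :: "(real \<times> real) set set" where
  "square_sides = {{0..1} \<times> {0}, {1} \<times> {0..1}, {0..1} \<times> {1}, {0} \<times> {0..1}}"

text \<open>
  A face is a quadrilateral if it is an open square glued to the graph along the boundary of the
  square, each of the four sides being mapped homeomorphically onto an edge.  The map need not be
  injective on the boundary: different corners may go to the same vertex, and different sides may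
  go to the same edge.
\<close>

definition quadrilateral_face ::
  "'p topology \<Rightarrow> ('v, 'e) multigraph \<Rightarrow> ('e \<Rightarrow> real \<Rightarrow> 'p) \<Rightarrow> 'p set \<Rightarrow> bool" where
  "quadrilateral_face X G crv F \<longleftrightarrow>
     (\<exists>\<phi>. continuous_map (top_of_set unit_square) X \<phi> \<and>
        homeomorphic_map (top_of_set open_square) (subtopology X F) \<phi> \<and>
        (\<forall>s \<in> square_sides. embedding_map (top_of_set s) X \<phi> \<and>
           (\<exists>e \<in> edges G. \<phi> ` s = crv e ` {0..1})))"

definition quadrangulation :: "'p topology \<Rightarrow> ('v, 'e) multigraph \<Rightarrow> bool" where
  "quadrangulation X G \<longleftrightarrow> finite_loopless_multigraph G \<and>
     (\<exists>pos crv. embedded_in X G pos crv \<and>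
        (\<forall>F \<in> faces X G pos crv. quadrilateral_face X G crv F))"

section \<open>The local chromatic number\<close>

definition adjacent :: "('v, 'e) multigraph \<Rightarrow> 'v \<Rightarrow> 'v \<Rightarrow> bool" where
  "adjacent G u v \<longleftrightarrow> (\<exists>e \<in> edges G. ends G e = {u, v})"

definition neighbors :: "('v, 'e) multigraph \<Rightarrow> 'v \<Rightarrow> 'v set" where
  "neighbors G v = {u \<in> verts G. adjacent G v u}"

definition proper_coloring :: "('v, 'e) multigraph \<Rightarrow> ('v \<Rightarrow> 'c) \<Rightarrow> bool" where
  "proper_coloring G c \<longleftrightarrow> (\<forall>u \<in> verts G. \<forall>v \<in> verts G. adjacent G u v \<longrightarrow> c u \<noteq> c v)"

definition local_coloring :: "nat \<Rightarrow> ('v, 'e) multigraph \<Rightarrow> ('v \<Rightarrow> 'c) \<Rightarrow> bool" where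
  "local_coloring k G c \<longleftrightarrow> k \<ge> 1 \<and> proper_coloring G c \<and>
     (\<forall>v \<in> verts G. card (c ` neighbors G v) \<le> k - 1)"

text \<open>
  Natural numbers serve as colors; this does not restrict the number of colors, as the graphs
  considered are finite.
\<close>

definition local_chromatic_number :: "('v, 'e) multigraph \<Rightarrow> nat" where
  "local_chromatic_number G = (LEAST k. \<exists>c :: 'v \<Rightarrow> nat. local_coloring k G c)"

lemma ex_local_coloring:
  assumes "finite_loopless_multigraph G"
  shows "\<exists>k. \<exists>c :: 'v \<Rightarrow> nat. local_coloring k (G :: ('v, 'e) multigraph) c"
proof -
  have fin: "finite (verts G)"
    using assms by (simp add: finite_loopless_multigraph_def)
  then obtain c :: "'v \<Rightarrow> nat" where c: "inj_on c (verts G)"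
    using finite_imp_inj_to_nat_seg by metis
  have "proper_coloring G c"
    unfolding proper_coloring_def
  proof (intro ballI impI)
    fix u v
    assume uv: "u \<in> verts G" "v \<in> verts G" "adjacent G u v"
    then have "u \<noteq> v"
      using assms by (auto simp: adjacent_def finite_loopless_multigraph_def)
    with c uv show "c u \<noteq> c v"
      by (auto dest: inj_onD)
  qed
  moreover have "card (c ` neighbors G v) \<le> card (verts G)" for v
  proof -
    have sub: "neighbors G v \<subseteq> verts G"
      by (auto simp: neighbors_def)
    then have "card (c ` neighbors G v) \<le> card (neighbors G v)"
      using fin finite_subset card_image_le by blast
    also have "\<dots> \<le> card (verts G)"
      using sub fin by (rule card_mono[rotated])
    finally show ?thesis .
  qed
  ultimately have "local_coloring (card (verts G) + 1) G c"
    by (simp add: local_coloring_def)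
  then show ?thesis
    by blast
qed

end

theory Submission
  imports Defs
begin

text \<open>
  A quadrangulation of the projective plane yields a finite complex of quadrangles in which each
  edge lies on at most two sides of faces (invariance of domain), any two faces are joined through
  edges (removing finitely many points does not disconnect the projective plane), and each integral
  edge weighting with vanishing sums around the faces is the difference of a vertex potential
  (the weighting defines a map to the punctured plane, which has a continuous logarithm as the
  sphere does).  The rest is combinatorial.

  Upper bound.  Rationally, the last property forces a subgraph without parallel edges on \<open>n\<close>
  vertices to have at most \<open>2n - 2\<close> edges, as each independent relation on it uses at least four
  incidences with edges; so the graph is 3-degenerate.

  Lower bound.  Suppose that the graph is not bipartite but has a coloring with at most two colors
  in each neighbourhood, and choose one with as many colors as possible.  Walking from neighbour to
  neighbour moves the color of every second vertex along pairs of colors that occur in a common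
  neighbourhood.  On the bipartite double cover, counting the signed moves along one such pair has a
  potential, and this potential could be used to split a color unless the pair is a bridge.  So the
  pairs form a forest, and the colors can be ordered so that no two pairs cross.  Then the signs of
  the color differences along the edges add up to zero around each face; they are the differences
  of a potential, whose parity is a proper 2-coloring.
\<close>

section \<open>Linear systems\<close>

text \<open>Potentials are available over the integers and rationals only. Modulo 2 the constant
  weighting 1 sums to zero around every quadrangle, and it is the difference of a potential exactly
  for bipartite graphs; so parity has to be read off from integral weightings. No Euler formula is
  established. Its substitute is orthogonality: over the rationals a weighting that is both a
  circulation and the difference of a potential is orthogonal to itself, hence zero. Comparing
  numbers of unknowns and equations then bounds the number of edges, both in the upper and in the
  lower bound. The double cover is not constructed. A weighting of its edges is a function of
  ordered pairs of adjacent vertices. The antisymmetric part has an ordinary potential; the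
  symmetric part has a twisted one, with sums over the ends of edges in place of differences.
  Nonbipartiteness enters there: the signs of a 2-coloring would be a nonzero function whose sums
  over the ends of all edges vanish.\<close>

lemma homogeneous_system_nontrivial:
  fixes A :: "'j \<Rightarrow> 'i \<Rightarrow> 'a::field"
  assumes "finite J" "finite I" "card J < card I"
  shows "\<exists>x. (\<exists>i\<in>I. x i \<noteq> 0) \<and> (\<forall>j\<in>J. (\<Sum>i\<in>I. A j i * x i) = 0)"
  using assms
proof (induction J arbitrary: I A rule: finite_induct)
  case empty
  then obtain i where "i \<in> I" by fastforce
  then show ?case by (intro exI[of _ "\<lambda>_. 1"]) auto
next
  case (insert j0 J)
  show ?case
  proof (cases "\<forall>i\<in>I. A j0 i = 0")
    case True
    have "card J < card I" using insert by simp
    from insert.IH[OF \<open>finite I\<close> this, of A] True show ?thesis by auto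
  next
    case False
    then obtain i0 where i0: "i0 \<in> I" "A j0 i0 \<noteq> 0" by blast
    let ?I = "I - {i0}" and ?r = "\<lambda>j. A j i0 / A j0 i0"
    have "card J < card ?I" "finite ?I" using insert i0 by auto
    from insert.IH[OF this(2,1), of "\<lambda>j i. A j i - ?r j * A j0 i"] obtain x where
      x: "\<exists>i\<in>?I. x i \<noteq> 0" "\<And>j. j \<in> J \<Longrightarrow> (\<Sum>i\<in>?I. (A j i - ?r j * A j0 i) * x i) = 0" by auto
    let ?S = "\<Sum>i\<in>?I. A j0 i * x i"
    let ?x = "x(i0 := - ?S / A j0 i0)"
    have split: "(\<Sum>i\<in>I. A j i * ?x i) = A j i0 * (- ?S / A j0 i0) + (\<Sum>i\<in>?I. A j i * x i)" for j
      using i0 insert.prems by (subst sum.remove[of _ i0]) (auto intro!: sum.cong)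
    have "(\<Sum>i\<in>I. A j i * ?x i) = 0" if "j \<in> J" for j
    proof -
      have "(\<Sum>i\<in>?I. A j i * x i) - ?r j * ?S = 0"
        using x(2)[OF that] by (simp add: sum_subtractf sum_distrib_left algebra_simps)
      then show ?thesis unfolding split by (simp add: field_simps)
    qed
    moreover have "(\<Sum>i\<in>I. A j0 i * ?x i) = 0" unfolding split using i0 by simp
    ultimately show ?thesis using x(1) by (intro exI[of _ ?x]) auto
  qed
qed

lemma homogeneous_systems_nontrivial:
  fixes A :: "'j \<Rightarrow> 'i \<Rightarrow> 'a::field" and B :: "'k \<Rightarrow> 'i \<Rightarrow> 'a"
  assumes "finite J" "finite K" "finite I" "card J + card K < card I"
  obtains x where "\<exists>i\<in>I. x i \<noteq> 0" "\<And>j. j \<in> J \<Longrightarrow> (\<Sum>i\<in>I. A j i * x i) = 0"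
    "\<And>k. k \<in> K \<Longrightarrow> (\<Sum>i\<in>I. B k i * x i) = 0"
proof -
  have "card (J <+> K) < card I" "finite (J <+> K)" using assms by (simp_all add: card_Plus)
  from homogeneous_system_nontrivial[OF this(2) assms(3) this(1), of "case_sum A B"]
  obtain x where x: "\<exists>i\<in>I. x i \<noteq> 0"
    "\<And>j. j \<in> J <+> K \<Longrightarrow> (\<Sum>i\<in>I. case_sum A B j i * x i) = 0" by blast
  show ?thesis
  proof (rule that[OF x(1)])
    show "(\<Sum>i\<in>I. A j i * x i) = 0" if "j \<in> J" for j using x(2)[OF InlI[OF that]] by simp
    show "(\<Sum>i\<in>I. B k i * x i) = 0" if "k \<in> K" for k using x(2)[OF InrI[OF that]] by simp
  qed
qed

text \<open>The Fredholm alternative, by elimination of one unknown at a time. It serves to extend a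
  weighting of a subgraph to all edges with prescribed face sums.\<close>

lemma linear_system_solvable:
  fixes A :: "'j \<Rightarrow> 'i \<Rightarrow> 'a::field"
  assumes "finite I" "finite J"
    and "\<And>y. (\<And>i. i \<in> I \<Longrightarrow> (\<Sum>j\<in>J. y j * A j i) = 0) \<Longrightarrow> (\<Sum>j\<in>J. y j * b j) = 0"
  shows "\<exists>x. \<forall>j\<in>J. (\<Sum>i\<in>I. A j i * x i) = b j"
  using assms
proof (induction I arbitrary: J A b rule: finite_induct)
  case empty
  have "b j = 0" if "j \<in> J" for j
    using empty(2)[of "\<lambda>k. if k = j then 1 else 0"] that \<open>finite J\<close> by (simp add: if_distrib[of "\<lambda>z. z * _"] cong: if_cong)
  then show ?case by simp
next
  case (insert i0 I)
  show ?case
  proof (cases "\<forall>j\<in>J. A j i0 = 0")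
    case True
    have "\<exists>x. \<forall>j\<in>J. (\<Sum>i\<in>I. A j i * x i) = b j"
    proof (rule insert.IH)
      fix y assume "\<And>i. i \<in> I \<Longrightarrow> (\<Sum>j\<in>J. y j * A j i) = 0"
      then show "(\<Sum>j\<in>J. y j * b j) = 0"
        using True by (intro insert.prems(2)) auto
    qed (use insert.prems in auto)
    then show ?thesis using True insert.hyps by auto
  next
    case False
    then obtain j0 where j0: "j0 \<in> J" "A j0 i0 \<noteq> 0" by blast
    let ?J = "J - {j0}" and ?r = "\<lambda>j. A j i0 / A j0 i0"
    have "\<exists>x. \<forall>j\<in>?J. (\<Sum>i\<in>I. (A j i - ?r j * A j0 i) * x i) = b j - ?r j * b j0"
    proof (rule insert.IH)
      fix y assume y: "\<And>i. i \<in> I \<Longrightarrow> (\<Sum>j\<in>?J. y j * (A j i - ?r j * A j0 i)) = 0"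
      let ?S = "\<Sum>j\<in>?J. y j * ?r j"
      \<comment> \<open>A relation among the reduced rows lifts to the original rows once the
        coefficient of the pivot row makes up for the subtracted multiples.\<close>
      let ?y = "y(j0 := - ?S)"
      have split: "(\<Sum>j\<in>J. ?y j * d j) = (\<Sum>j\<in>?J. y j * (d j - ?r j * d j0))" for d
      proof -
        have "(\<Sum>j\<in>J. ?y j * d j) = - ?S * d j0 + (\<Sum>j\<in>?J. y j * d j)"
          using j0 insert.prems by (subst sum.remove[of _ j0]) (auto intro!: sum.cong)
        then show ?thesis by (simp add: algebra_simps sum_subtractf sum_distrib_left)
      qed
      have "(\<Sum>j\<in>J. ?y j * A j i) = 0" if "i \<in> insert i0 I" for i
        unfolding split using that y j0 by auto
      from insert.prems(2)[OF this] show "(\<Sum>j\<in>?J. y j * (b j - ?r j * b j0)) = 0"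
        unfolding split by simp
    qed (use insert.prems in auto)
    then obtain x where x: "\<And>j. j \<in> ?J \<Longrightarrow> (\<Sum>i\<in>I. (A j i - ?r j * A j0 i) * x i) = b j - ?r j * b j0" by blast
    let ?S = "\<Sum>i\<in>I. A j0 i * x i"
    let ?x = "x(i0 := (b j0 - ?S) / A j0 i0)"
    have split: "(\<Sum>i\<in>insert i0 I. A j i * ?x i) = ?r j * (b j0 - ?S) + (\<Sum>i\<in>I. A j i * x i)" for j
    proof -
      have "(\<Sum>i\<in>I. A j i * ?x i) = (\<Sum>i\<in>I. A j i * x i)"
        using insert.hyps by (intro sum.cong) auto
      then show ?thesis using insert.hyps j0 by simp
    qed
    have "(\<Sum>i\<in>insert i0 I. A j i * ?x i) = b j" if "j \<in> J" for j
    proof (cases "j = j0")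
      case True then show ?thesis unfolding split using j0 by simp
    next
      case False
      then have "(\<Sum>i\<in>I. A j i * x i) - ?r j * ?S = b j - ?r j * b j0"
        using x[of j] that by (simp add: sum_subtractf sum_distrib_left algebra_simps)
      then show ?thesis unfolding split by (simp add: algebra_simps)
    qed
    then show ?thesis by blast
  qed
qed

section \<open>Complexes of quadrangles\<close>

lemma sum_lessThan_4: "(\<Sum>i<4::nat. g i) = g 0 + g 1 + g 2 + g 3"
  by (simp add: lessThan_Suc eval_nat_numeral add_ac)

lemma Suc_mod_4: "Suc 0 mod 4 = 1" "Suc 1 mod 4 = 2" "Suc 2 mod 4 = 3" "Suc 3 mod 4 = 0"
  by simp_all

text \<open>The assumptions collect what the upper bound needs of the surface.
  \<open>int_potential\<close> is the vanishing of the first integral cohomology. Sides are counted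
  as pairs of a face and an index, since one face may lie on both sides of an edge.\<close>

locale quadrangular_complex =
  fixes E :: "'e set" and src trg :: "'e \<Rightarrow> 'v"
    and F :: "'f set" and side :: "'f \<Rightarrow> nat \<Rightarrow> 'e" and corner :: "'f \<Rightarrow> nat \<Rightarrow> 'v"
  assumes finite_E: "finite E" and finite_F: "finite F"
    and loopless: "e \<in> E \<Longrightarrow> src e \<noteq> trg e"
    and side_in: "f \<in> F \<Longrightarrow> i < 4 \<Longrightarrow> side f i \<in> E"
    and side_ends: "f \<in> F \<Longrightarrow> i < 4 \<Longrightarrow>
      {src (side f i), trg (side f i)} = {corner f i, corner f (Suc i mod 4)}"
    and two_sided: "e \<in> E \<Longrightarrow> card {(f, i). f \<in> F \<and> i < 4 \<and> side f i = e} \<le> 2"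
    and int_potential: "(\<And>f. f \<in> F \<Longrightarrow>
        (\<Sum>i<4. if src (side f i) = corner f i then w (side f i) else - w (side f i)) = (0::int)) \<Longrightarrow>
      \<exists>p. \<forall>e\<in>E. w e = p (trg e) - p (src e)"
begin

text \<open>The sign of side \<open>i\<close> in the oriented boundary of the face. It is
  unambiguous because edges are not loops.\<close>

definition dir :: "'f \<Rightarrow> nat \<Rightarrow> 'a::comm_ring_1" where
  "dir f i = (if src (side f i) = corner f i then 1 else - 1)"

text \<open>The cellular boundary of the 2-chain \<open>c\<close>, with the signs as a parameter:
  \<open>dir\<close> yields the usual boundary, \<open>alt\<close> later a twisted one.\<close>

definition bd :: "('f \<Rightarrow> nat \<Rightarrow> 'a::comm_ring_1) \<Rightarrow> ('f \<Rightarrow> 'a) \<Rightarrow> 'e \<Rightarrow> 'a" where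
  "bd s c e = (\<Sum>f\<in>F. \<Sum>i<4. if side f i = e then s f i * c f else 0)"

text \<open>The vertex-edge incidence matrix, that is, the boundary of 1-chains.\<close>

definition inc :: "'v \<Rightarrow> 'e \<Rightarrow> 'a::comm_ring_1" where
  "inc v e = (if trg e = v then 1 else 0) - (if src e = v then 1 else 0)"

text \<open>Adjointness of boundary and coboundary, by exchanging the sums over edges and
  faces.\<close>

lemma sum_mult_bd:
  "(\<Sum>e\<in>E. x e * bd s c e) = (\<Sum>f\<in>F. c f * (\<Sum>i<4. s f i * x (side f i)))"
proof -
  have "(\<Sum>e\<in>E. x e * bd s c e) =
      (\<Sum>e\<in>E. \<Sum>f\<in>F. \<Sum>i<4. if side f i = e then x e * (s f i * c f) else 0)"
    unfolding bd_def sum_distrib_left by (intro sum.cong refl) auto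
  also have "\<dots> = (\<Sum>f\<in>F. \<Sum>e\<in>E. \<Sum>i<4. if side f i = e then x e * (s f i * c f) else 0)"
    by (rule sum.swap)
  also have "\<dots> = (\<Sum>f\<in>F. \<Sum>i<4. \<Sum>e\<in>E. if side f i = e then x e * (s f i * c f) else 0)"
    by (intro sum.cong refl sum.swap)
  also have "\<dots> = (\<Sum>f\<in>F. \<Sum>i<4. x (side f i) * (s f i * c f))"
    using side_in finite_E by (intro sum.cong refl) simp
  finally show ?thesis by (simp add: sum_distrib_left mult_ac)
qed

lemma dir_diff:
  fixes p :: "'v \<Rightarrow> 'a::comm_ring_1"
  assumes "f \<in> F" "i < 4"
  shows "dir f i * (p (trg (side f i)) - p (src (side f i))) = p (corner f (Suc i mod 4)) - p (corner f i)"
proof -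
  consider "src (side f i) = corner f i" "trg (side f i) = corner f (Suc i mod 4)"
    | "src (side f i) = corner f (Suc i mod 4)" "trg (side f i) = corner f i"
    using side_ends[OF assms] by (meson doubleton_eq_iff)
  then show ?thesis
  proof cases
    case 1 then show ?thesis by (simp add: dir_def)
  next
    case 2
    then have "src (side f i) \<noteq> corner f i" using loopless[OF side_in[OF assms]] by metis
    then have "dir f i = (- 1 :: 'a)" by (simp add: dir_def)
    then show ?thesis using 2 by simp
  qed
qed

lemma sum_dir_diff:
  assumes "f \<in> F"
  shows "(\<Sum>i<4. dir f i * (p (trg (side f i)) - p (src (side f i)))) = 0"
proof -
  have "(\<Sum>i<4. dir f i * (p (trg (side f i)) - p (src (side f i))))
      = (\<Sum>i<4. p (corner f (Suc i mod 4)) - p (corner f i))"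
    using assms by (intro sum.cong refl dir_diff) auto
  also have "\<dots> = 0"
  proof -
    have "Suc 0 mod 4 = 1" "Suc 1 mod 4 = 2" "Suc 2 mod 4 = 3" "Suc 3 mod 4 = 0" by simp_all
    then show ?thesis unfolding sum_lessThan_4 by (simp only:) (simp add: algebra_simps)
  qed
  finally show ?thesis .
qed

lemma sum_mult_diff:
  assumes "finite H" "finite W" "src ` H \<union> trg ` H \<subseteq> W"
  shows "(\<Sum>e\<in>H. x e * (p (trg e) - p (src e))) = (\<Sum>v\<in>W. p v * (\<Sum>e\<in>H. inc v e * x e))"
proof -
  have "(\<Sum>v\<in>W. p v * (\<Sum>e\<in>H. inc v e * x e)) = (\<Sum>e\<in>H. \<Sum>v\<in>W. p v * (inc v e * x e))"
    unfolding sum_distrib_left by (rule sum.swap)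
  also have "\<dots> = (\<Sum>e\<in>H. x e * (p (trg e) - p (src e)))"
  proof (rule sum.cong[OF refl])
    fix e assume "e \<in> H"
    then have "trg e \<in> W" "src e \<in> W" using assms by auto
    have "(\<Sum>v\<in>W. p v * (inc v e * x e)) =
       (\<Sum>v\<in>W. if trg e = v then p v * x e else 0) - (\<Sum>v\<in>W. if src e = v then p v * x e else 0)"
      unfolding sum_subtractf[symmetric] by (intro sum.cong refl) (auto simp: inc_def)
    then show "(\<Sum>v\<in>W. p v * (inc v e * x e)) = x e * (p (trg e) - p (src e))"
      using \<open>trg e \<in> W\<close> \<open>src e \<in> W\<close> assms by (simp add: algebra_simps)
  qed
  finally show ?thesis by simp
qed

text \<open>Circulations are orthogonal to differences of potentials. Shifting \<open>p\<close> to
  vanish at \<open>u\<close> is what allows one vertex to be left out; this saves one equation in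
  each dimension count below.\<close>

lemma circulation_orthogonal_diff:
  assumes "finite H" "finite W" "src ` H \<union> trg ` H \<subseteq> W"
    and "\<And>v. v \<in> W - {u} \<Longrightarrow> (\<Sum>e\<in>H. inc v e * x e) = 0"
  shows "(\<Sum>e\<in>H. x e * (p (trg e) - p (src e))) = 0"
proof -
  have "(\<Sum>e\<in>H. x e * (p (trg e) - p (src e))) = (\<Sum>e\<in>H. x e * ((p (trg e) - p u) - (p (src e) - p u)))"
    by simp
  also have "\<dots> = (\<Sum>v\<in>W. (p v - p u) * (\<Sum>e\<in>H. inc v e * x e))"
    using sum_mult_diff[OF assms(1-3), of x "\<lambda>v. p v - p u"] by simp
  also have "\<dots> = 0"
  proof (intro sum.neutral ballI)
    fix v assume "v \<in> W"
    then show "(p v - p u) * (\<Sum>e\<in>H. inc v e * x e) = 0"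
      using assms(4)[of v] by (cases "v = u") auto
  qed
  finally show ?thesis .
qed

lemma rat_potential:
  fixes w :: "'e \<Rightarrow> rat"
  assumes "\<And>f. f \<in> F \<Longrightarrow> (\<Sum>i<4. dir f i * w (side f i)) = 0"
  shows "\<exists>p. \<forall>e\<in>E. w e = p (trg e) - p (src e)"
proof -
  \<comment> \<open>Clearing all denominators at once reduces the claim to integral weights.\<close>
  define N where "N = (\<Prod>e\<in>E. snd (quotient_of (w e)))"
  have N: "N > 0" unfolding N_def by (intro prod_pos) (simp add: quotient_of_denom_pos')
  have "\<exists>z. of_int N * w e = of_int z" if "e \<in> E" for e
  proof -
    obtain a b where ab: "quotient_of (w e) = (a, b)" by fastforce
    then have "w e = of_int a / of_int b" "b > 0"
      by (auto simp: quotient_of_div quotient_of_denom_pos)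
    moreover have "b dvd N" unfolding N_def using ab
      using dvd_prodI[OF finite_E that, of "\<lambda>e. snd (quotient_of (w e))"] by simp
    then obtain k where "N = b * k" ..
    ultimately have "of_int N * w e = of_int (k * a)" by simp
    then show ?thesis by blast
  qed
  then have "\<forall>e\<in>E. \<exists>z. of_int N * w e = of_int z" by blast
  from bchoice[OF this] obtain z where z: "\<And>e. e \<in> E \<Longrightarrow> of_int N * w e = of_int (z e)" by blast
  have "\<exists>p. \<forall>e\<in>E. z e = p (trg e) - p (src e)"
  proof (rule int_potential)
    fix f assume f: "f \<in> F"
    have "of_int (\<Sum>i<4. if src (side f i) = corner f i then z (side f i) else - z (side f i))
       = of_int N * (\<Sum>i<4. dir f i * w (side f i))"
      unfolding of_int_sum sum_distrib_left
    proof (rule sum.cong[OF refl])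
      fix i :: nat assume "i \<in> {..<4}"
      then show "of_int (if src (side f i) = corner f i then z (side f i) else - z (side f i)) =
         of_int N * (dir f i * w (side f i))"
        using z[OF side_in[OF f, of i]] by (auto simp: dir_def)
    qed
    then show "(\<Sum>i<4. if src (side f i) = corner f i then z (side f i) else - z (side f i)) = 0"
      unfolding assms[OF f] mult_zero_right of_int_eq_0_iff .
  qed
  then obtain p where p: "\<And>e. e \<in> E \<Longrightarrow> z e = p (trg e) - p (src e)" by blast
  show ?thesis
  proof (intro exI[of _ "\<lambda>v. of_int (p v) / of_int N"] ballI)
    fix e assume "e \<in> E"
    then have "of_int N * w e = of_int (p (trg e) - p (src e))" using z[of e] p[of e] by simp
    then have "w e = of_int (p (trg e) - p (src e)) / of_int N"
      using N nonzero_mult_div_cancel_left[of "of_int N" "w e"] by simp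
    then show "w e = of_int (p (trg e)) / of_int N - of_int (p (src e)) / of_int N"
      by (simp add: diff_divide_distrib)
  qed
qed

lemma bd_eq_sum_sides: "bd s c e = (\<Sum>(f, i)\<in>{(f, i). f \<in> F \<and> i < 4 \<and> side f i = e}. s f i * c f)"
proof -
  have fin: "finite (F \<times> {..<4::nat})" using finite_F by simp
  have "bd s c e = (\<Sum>(f, i)\<in>F \<times> {..<4}. if side f i = e then s f i * c f else 0)"
    unfolding bd_def by (simp add: sum.cartesian_product)
  also have "\<dots> = (\<Sum>(f, i)\<in>{(f, i). f \<in> F \<and> i < 4 \<and> side f i = e}. s f i * c f)"
    using fin by (intro sum.mono_neutral_cong_right) (auto split: if_splits)
  finally show ?thesis .
qed

lemma finite_sides: "finite {(f, i). f \<in> F \<and> i < (4::nat) \<and> side f i = e}"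
  by (rule finite_subset[of _ "F \<times> {..<4}"]) (use finite_F in auto)

text \<open>At most two sides meet the edge, so a vanishing boundary forces their coefficients to
  cancel up to sign. The signs cannot be controlled on a nonorientable surface, hence the absolute
  values.\<close>

lemma abs_eq_if_bd_0:
  fixes c :: "'f \<Rightarrow> 'a::linordered_idom"
  assumes "e \<in> E" "bd s c e = 0" "\<And>f i. \<bar>s f i\<bar> = 1"
    and f: "f \<in> F" "i < 4" "side f i = e" and g: "g \<in> F" "j < 4" "side g j = e"
  shows "\<bar>c f\<bar> = \<bar>c g\<bar>"
proof (cases "(f, i) = (g, j)")
  case False
  define S where "S = {(f, i). f \<in> F \<and> i < (4::nat) \<and> side f i = e}"
  have "(f, i) \<in> S" "(g, j) \<in> S" unfolding S_def using f g by blast+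
  moreover have "card {(f, i), (g, j)} = 2" using False by (metis card_2_iff)
  moreover have "card S \<le> 2" "finite S"
    unfolding S_def using two_sided[OF assms(1)] finite_sides by blast+
  ultimately have "S = {(f, i), (g, j)}"
    using card_seteq[of S "{(f, i), (g, j)}"] by simp
  then have "bd s c e = (\<Sum>(f, i)\<in>{(f, i), (g, j)}. s f i * c f)"
    unfolding bd_eq_sum_sides S_def by (rule arg_cong)
  also have "\<dots> = s f i * c f + s g j * c g" using False by auto
  finally have "s f i * c f + s g j * c g = 0" unfolding assms(2) by (rule sym)
  then have "s f i * c f = - (s g j * c g)" unfolding eq_neg_iff_add_eq_0 .
  then have "\<bar>s f i * c f\<bar> = \<bar>s g j * c g\<bar>" by (simp only: abs_minus_cancel)
  then show ?thesis by (simp only: abs_mult assms(3) mult_1)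
next
  case True
  then show ?thesis by (simp only: prod.inject)
qed

lemma abs_bd_le:
  fixes c :: "'f \<Rightarrow> 'a::linordered_idom"
  assumes "\<And>f i. \<bar>s f i\<bar> = 1"
  shows "\<bar>bd s c e\<bar> \<le> (\<Sum>(f, i)\<in>{(f, i). f \<in> F \<and> i < 4 \<and> side f i = e}. \<bar>c f\<bar>)"
  unfolding bd_eq_sum_sides
  by (rule order.trans[OF sum_abs]) (auto intro!: sum_mono simp: abs_mult assms)

lemma abs_dir: "\<bar>dir f i :: 'a::linordered_idom\<bar> = 1"
  by (simp add: dir_def)

lemma sum_inc_bd:
  fixes c :: "'f \<Rightarrow> 'a::comm_ring_1"
  shows "(\<Sum>e\<in>E. inc v e * bd dir c e) = 0"
proof -
  have "(\<Sum>i<4. dir f i * inc v (side f i)) = (0 :: 'a)" if "f \<in> F" for f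
    using sum_dir_diff[OF that, of "\<lambda>u. if u = v then 1 else 0"] by (simp add: inc_def)
  then show ?thesis unfolding sum_mult_bd by simp
qed

end

section \<open>Four colors suffice\<close>

context quadrangular_complex begin

text \<open>Gluing faces across the edges outside \<open>H\<close> merges them into the faces of the subgraph \<open>H\<close>.\<close>

definition glued :: "'e set \<Rightarrow> ('f \<times> 'f) set" where
  "glued H = {(f, g). f \<in> F \<and> g \<in> F \<and> (\<exists>i<4. \<exists>j<4. side f i = side g j \<and> side f i \<notin> H)}"

lemma abs_eq_if_glued:
  fixes c :: "'f \<Rightarrow> 'a::linordered_idom"
  assumes "\<And>e. e \<in> E - H \<Longrightarrow> bd s c e = 0" "\<And>f i. \<bar>s f i\<bar> = 1"
    and "(f, g) \<in> (glued H)\<^sup>*"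
  shows "\<bar>c f\<bar> = \<bar>c g\<bar>"
  using assms(3)
proof induction
  case (step g h)
  then obtain i j where ij: "g \<in> F" "h \<in> F" "i < 4" "j < 4" "side g i = side h j" "side g i \<notin> H"
    unfolding glued_def by blast
  have "\<bar>c g\<bar> = \<bar>c h\<bar>"
    by (rule abs_eq_if_bd_0[where e = "side g i" and s = s])
      (use ij side_in[of g i] assms(1,2) in auto)
  with step.IH show ?case by simp
qed simp

text \<open>A boundary is a circulation, so at both ends of \<open>e1\<close> it must continue along
  another edge, and not along the same one since \<open>H\<close> has no parallel edges. This gives
  3, and parity gives 4.\<close>

lemma sum_abs_bd_ge_4:
  assumes simple: "inj_on (\<lambda>e. {src e, trg e}) H" and "H \<subseteq> E"
    and supp: "\<And>e. e \<in> E - H \<Longrightarrow> bd dir c e = (0::int)"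
    and "e1 \<in> E" "bd dir c e1 \<noteq> 0"
  shows "(\<Sum>e\<in>H. \<bar>bd dir c e\<bar>) \<ge> 4"
proof -
  let ?b = "bd dir c :: 'e \<Rightarrow> int"
  have finH: "finite H" using \<open>H \<subseteq> E\<close> finite_E finite_subset by blast
  have e1: "e1 \<in> H" using assms(4,5) supp by blast
  have ex: "\<exists>e\<in>H. e \<noteq> e1 \<and> ?b e \<noteq> 0 \<and> v \<in> {src e, trg e}"
    if "v \<in> {src e1, trg e1}" for v
  proof (rule ccontr)
    assume none: "\<not> ?thesis"
    have "inc v e * ?b e = 0" if "e \<in> E - {e1}" for e
      using none supp[of e] that by (cases "e \<in> H") (auto simp: inc_def)
    then have "(\<Sum>e\<in>E - {e1}. inc v e * ?b e) = 0" by (intro sum.neutral ballI)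
    then have "(\<Sum>e\<in>E. inc v e * ?b e) = inc v e1 * ?b e1"
      unfolding sum.remove[OF finite_E \<open>e1 \<in> E\<close>] by simp
    moreover have "inc v e1 \<noteq> (0::int)" using that loopless[OF \<open>e1 \<in> E\<close>] by (auto simp: inc_def)
    ultimately show False using sum_inc_bd[of v c] \<open>?b e1 \<noteq> 0\<close> by simp
  qed
  obtain e2 where e2: "e2 \<in> H" "e2 \<noteq> e1" "?b e2 \<noteq> 0" "src e1 \<in> {src e2, trg e2}"
    using ex[of "src e1"] by auto
  obtain e3 where e3: "e3 \<in> H" "e3 \<noteq> e1" "?b e3 \<noteq> 0" "trg e1 \<in> {src e3, trg e3}"
    using ex[of "trg e1"] by auto
  have "e2 \<noteq> e3"
  proof
    assume "e2 = e3"
    then have "{src e1, trg e1} = {src e2, trg e2}"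
      using e2(4) e3(4) loopless[OF \<open>e1 \<in> E\<close>] by auto
    then show False using inj_onD[OF simple] e1 e2 by metis
  qed
  then have "(\<Sum>e\<in>{e1, e2, e3}. \<bar>?b e\<bar>) \<ge> 3"
    using e2 e3 \<open>?b e1 \<noteq> 0\<close> by simp
  moreover have "(\<Sum>e\<in>{e1, e2, e3}. \<bar>?b e\<bar>) \<le> (\<Sum>e\<in>H. \<bar>?b e\<bar>)"
    using e1 e2 e3 finH by (intro sum_mono2) auto
  \<comment> \<open>Each face contributes four signs, an even sum; passing to absolute values
    preserves parity.\<close>
  moreover have "even (\<Sum>e\<in>H. \<bar>?b e\<bar>)"
  proof -
    have "even (\<Sum>i<4. dir f i :: int)" for f unfolding sum_lessThan_4 by (simp add: dir_def)
    then have "even (\<Sum>e\<in>E. 1 * ?b e)" unfolding sum_mult_bd by (intro dvd_sum) simp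
    moreover have "(\<Sum>e\<in>E. 1 * ?b e) = (\<Sum>e\<in>H. ?b e)"
      using finite_E \<open>H \<subseteq> E\<close> supp by (simp add: sum.mono_neutral_right)
    moreover have "even ((\<Sum>e\<in>H. \<bar>?b e\<bar>) - (\<Sum>e\<in>H. ?b e))"
      unfolding sum_subtractf[symmetric] by (intro dvd_sum) simp
    ultimately show ?thesis by simp
  qed
  ultimately have "(\<Sum>e\<in>H. \<bar>?b e\<bar>) \<ge> 3" "(\<Sum>e\<in>H. \<bar>?b e\<bar>) \<noteq> 3" by auto
  then show ?thesis by linarith
qed

text \<open>If \<open>H\<close> had more edges, some nonzero \<open>x\<close> on \<open>H\<close>
  would be a circulation and orthogonal to every boundary supported on \<open>H\<close>. The second
  property extends \<open>x\<close> to a weighting with vanishing face sums, hence to the difference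
  of a potential, so \<open>x\<close> would be orthogonal to itself. The point is that these
  boundaries impose at most \<open>card H\<close> / 2 conditions.\<close>

lemma card_simple_subgraph_le:
  assumes H: "H \<subseteq> E" and simple: "inj_on (\<lambda>e. {src e, trg e}) H"
    and W: "finite W" "W \<noteq> {}" "src ` H \<union> trg ` H \<subseteq> W"
  shows "card H + 2 \<le> 2 * card W"
proof (rule ccontr)
  assume less: "\<not> ?thesis"
  have finH: "finite H" using H finite_E finite_subset by blast
  define R where "R = (glued H)\<^sup>*"
  have symR: "sym R" unfolding R_def
    by (intro sym_rtrancl) (rule symI, unfold glued_def mem_Collect_eq case_prod_conv, metis)
  have transR: "trans R" unfolding R_def by (rule trans_rtrancl)
  define rp where "rp f = (SOME g. (f, g) \<in> R)" for f
  have rp: "(f, rp f) \<in> R" for f unfolding rp_def by (rule someI[of _ f]) (simp add: R_def)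
  have rp_eq: "rp f = rp g \<longleftrightarrow> (f, g) \<in> R" for f g
  proof
    assume "(f, g) \<in> R"
    then have "(f, h) \<in> R \<longleftrightarrow> (g, h) \<in> R" for h using symR transR by (meson symD transD)
    then show "rp f = rp g" unfolding rp_def by simp
  next
    assume "rp f = rp g"
    then show "(f, g) \<in> R" using rp[of f] rp[of g] symR transR by (metis symD transD)
  qed
  \<comment> \<open>The chains with boundary supported on \<open>H\<close>; on each merged face, a
    class of \<open>rp\<close>, their absolute value is constant.\<close>
  define B where "B = {c :: 'f \<Rightarrow> rat. \<forall>e\<in>E-H. bd dir c e = 0}"
  have Babs: "\<bar>c f\<bar> = \<bar>c g\<bar>" if "c \<in> B" "rp f = rp g" for c f g
    using abs_eq_if_glued[of H dir c f g] that unfolding B_def rp_eq R_def by (simp add: abs_dir)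
  define cut :: "'f \<Rightarrow> ('f \<Rightarrow> rat) \<Rightarrow> 'f \<Rightarrow> rat" where "cut k c = (\<lambda>f. if rp f = k then c f else 0)" for k c
  \<comment> \<open>All sides at an edge outside \<open>H\<close> belong to one merged face, so
    restricting to a merged face keeps or drops them together.\<close>
  have cutB: "cut k c \<in> B" if "c \<in> B" for k c
    unfolding B_def
  proof (intro CollectI ballI)
    fix e assume e: "e \<in> E - H"
    define S where "S = {(f, i). f \<in> F \<and> i < (4::nat) \<and> side f i = e}"
    have same: "rp f = rp g" if "(f, i) \<in> S" "(g, j) \<in> S" for f g i j
    proof -
      have "f \<in> F" "g \<in> F" "i < 4" "j < 4" "side f i = side g j" "side f i \<notin> H"
        using that e unfolding S_def by auto
      then have "(f, g) \<in> glued H" unfolding glued_def by blast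
      then show ?thesis unfolding rp_eq R_def by (rule r_into_rtrancl)
    qed
    show "bd dir (cut k c) e = 0"
    proof (cases "\<exists>x\<in>S. rp (fst x) = k")
      case True
      then have "rp (fst x) = k" if "x \<in> S" for x
        using that same[of "fst x" "snd x"] by (metis prod.collapse)
      then have "bd dir (cut k c) e = bd dir c e"
        unfolding bd_eq_sum_sides S_def[symmetric] cut_def by (intro sum.cong refl) auto
      then show ?thesis using that e by (simp add: B_def)
    next
      case False
      then show ?thesis
        unfolding bd_eq_sum_sides S_def[symmetric] cut_def by (intro sum.neutral) auto
    qed
  qed
  \<comment> \<open>A normalized chain on one merged face. Merged faces without such a chain impose
    no condition on \<open>x\<close>; for the others the boundary is nonzero, as the lower bound 4
    requires.\<close>
  define good where "good k c \<longleftrightarrow> c \<in> B \<and> (\<forall>f. \<bar>c f\<bar> = (if rp f = k then 1 else 0)) \<and> (\<exists>e\<in>E. bd dir c e \<noteq> 0)" for k c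
  define K where "K = {k \<in> rp ` F. \<exists>c. good k c}"
  define C where "C k = (SOME c. good k c)" for k
  have C: "good k (C k)" if "k \<in> K" for k
  proof -
    have "\<exists>c. good k c" using that unfolding K_def by blast
    then show ?thesis unfolding C_def by (rule someI_ex)
  qed
  have finK: "finite K" unfolding K_def using finite_F by simp
  have bd_zero_off_H: "bd dir c e = 0" if "c \<in> B" "e \<in> E - H" for c e using that by (auto simp: B_def)
  have four: "(\<Sum>e\<in>H. \<bar>bd dir (C k) e\<bar>) \<ge> 4" if k: "k \<in> K" for k
  proof -
    have "\<exists>z::int. C k f = of_int z" for f
    proof -
      have "\<bar>C k f\<bar> = (if rp f = k then 1 else 0)" using C[OF k] by (simp add: good_def)
      then have "C k f = of_int 0 \<or> C k f = of_int 1 \<or> C k f = of_int (-1)"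
        by (auto simp: abs_if split: if_splits)
      then show ?thesis by blast
    qed
    then obtain z where z: "\<And>f. C k f = of_int (z f :: int)" by metis
    have bz: "bd dir (C k) e = of_int (bd dir z e)" for e
      unfolding bd_def of_int_sum by (intro sum.cong refl) (simp add: z dir_def)
    have "(\<Sum>e\<in>H. \<bar>bd dir z e\<bar>) \<ge> 4"
    proof -
      obtain e1 where "e1 \<in> E" "bd dir (C k) e1 \<noteq> 0" using C[OF k] by (auto simp: good_def)
      moreover have "bd dir z e = 0" if "e \<in> E - H" for e
        using bd_zero_off_H[of "C k" e] C[OF k] that bz[of e] by (simp add: good_def)
      ultimately show ?thesis using bz[of e1] by (intro sum_abs_bd_ge_4[OF simple H, of z e1]) auto
    qed
    then have "of_int (\<Sum>e\<in>H. \<bar>bd dir z e\<bar>) \<ge> (4 :: rat)" by linarith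
    then show ?thesis by (simp add: bz)
  qed
  have two: "(\<Sum>k\<in>K. \<bar>bd dir (C k) e\<bar>) \<le> 2" if "e \<in> E" for e
  proof -
    define S where "S = {(f, i). f \<in> F \<and> i < (4::nat) \<and> side f i = e}"
    have "(\<Sum>k\<in>K. \<bar>bd dir (C k) e\<bar>) \<le> (\<Sum>k\<in>K. \<Sum>(f, i)\<in>S. \<bar>C k f\<bar>)"
      unfolding S_def by (intro sum_mono abs_bd_le abs_dir)
    also have "\<dots> = (\<Sum>x\<in>S. \<Sum>k\<in>K. \<bar>C k (fst x)\<bar>)"
      unfolding case_prod_unfold by (rule sum.swap)
    also have "\<dots> = (\<Sum>x\<in>S. \<Sum>k\<in>K. if rp (fst x) = k then 1 else 0)"
    proof (intro sum.cong refl)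
      fix x k assume "k \<in> K"
      then show "\<bar>C k (fst x)\<bar> = (if rp (fst x) = k then 1 else 0)"
        using C[of k] unfolding good_def by blast
    qed
    also have "\<dots> \<le> (\<Sum>x\<in>S. 1)"
      using finK by (intro sum_mono) simp
    also have "\<dots> \<le> 2" using two_sided[OF that] unfolding S_def by simp
    finally show ?thesis .
  qed
  have "(\<Sum>k\<in>K. (4::rat)) \<le> (\<Sum>k\<in>K. \<Sum>e\<in>H. \<bar>bd dir (C k) e\<bar>)"
    by (intro sum_mono four)
  also have "\<dots> = (\<Sum>e\<in>H. \<Sum>k\<in>K. \<bar>bd dir (C k) e\<bar>)" by (rule sum.swap)
  also have "\<dots> \<le> (\<Sum>e\<in>H. 2)" using H by (intro sum_mono two) auto
  finally have "of_nat (4 * card K) \<le> (of_nat (2 * card H) :: rat)" by simp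
  then have "4 * card K \<le> 2 * card H" unfolding of_nat_le_iff .
  then have cardK: "2 * card K \<le> card H" by simp
  obtain u where u: "u \<in> W" using W by blast
  have "card (W - {u}) = card W - 1" "card W > 0" using u W by (auto simp: card_gt_0_iff)
  \<comment> \<open>At most \<open>card H\<close> / 2 conditions from merged faces and
    \<open>card W - 1\<close> from vertices: fewer than the unknowns by the assumed
    inequality.\<close>
  then have "card K + card (W - {u}) < card H" using cardK less by linarith
  moreover have "finite (W - {u})" using W by simp
  ultimately obtain x where x: "\<exists>e\<in>H. x e \<noteq> 0"
    and xK: "\<And>k. k \<in> K \<Longrightarrow> (\<Sum>e\<in>H. bd dir (C k) e * x e) = 0"
    and xW: "\<And>v. v \<in> W - {u} \<Longrightarrow> (\<Sum>e\<in>H. inc v e * x e) = 0"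
    using homogeneous_systems_nontrivial[OF finK _ finH, of "W - {u}" "\<lambda>k. bd dir (C k)" inc]
    by blast
  have orth_cut: "(\<Sum>e\<in>H. bd dir (cut k c) e * x e) = 0" if "c \<in> B" "k \<in> rp ` F" for c k
  proof (cases "\<exists>e\<in>E. bd dir (cut k c) e \<noteq> 0")
    case False
    then show ?thesis using H by (intro sum.neutral) auto
  next
    case True
    have "\<exists>f0. cut k c f0 \<noteq> 0"
    proof (rule ccontr)
      assume "\<not> ?thesis"
      then have "bd dir (cut k c) e = 0" for e unfolding bd_def by (intro sum.neutral ballI) simp
      with True show False by blast
    qed
    then obtain f0 where f0: "cut k c f0 \<noteq> 0" ..
    then have rpf0: "rp f0 = k" and cf0: "c f0 \<noteq> 0" by (auto simp: cut_def split: if_splits)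
    let ?c = "\<lambda>f. cut k c f / \<bar>c f0\<bar>"
    have bdc: "bd dir ?c e = bd dir (cut k c) e / \<bar>c f0\<bar>" for e
      unfolding bd_def sum_divide_distrib by (intro sum.cong refl) simp
    have "good k ?c" unfolding good_def
    proof (intro conjI allI)
      show "?c \<in> B" using cutB[OF that(1)] bdc by (simp add: B_def)
      show "\<bar>?c f\<bar> = (if rp f = k then 1 else 0)" for f
        using Babs[OF that(1), of f f0] rpf0 cf0 by (simp add: cut_def)
      show "\<exists>e\<in>E. bd dir ?c e \<noteq> 0" using True bdc cf0 by simp
    qed
    then have k: "k \<in> K" using that by (auto simp: K_def)
    have CB: "C k \<in> B" and Cabs: "\<And>f. \<bar>C k f\<bar> = (if rp f = k then 1 else 0)"
      using C[OF k] unfolding good_def by blast+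
    have Cf0: "C k f0 \<noteq> 0" using Cabs[of f0] rpf0 by auto
    have Coff: "C k f = 0" if "rp f \<noteq> k" for f using Cabs[of f] that by simp
    \<comment> \<open>Up to a factor a merged face carries a single chain: subtracting the multiple
      of \<open>C k\<close> that cancels the value at \<open>f0\<close> leaves a chain of constant
      absolute value 0.\<close>
    define l where "l = cut k c f0 / C k f0"
    define d where "d f = cut k c f - l * C k f" for f
    have bdd: "bd dir d e = bd dir (cut k c) e - l * bd dir (C k) e" for e
      unfolding bd_def sum_distrib_left sum_subtractf[symmetric]
      by (intro sum.cong refl) (simp add: d_def algebra_simps)
    have dB: "d \<in> B" using cutB[OF that(1), of k] CB bdd by (simp add: B_def)
    have "d f0 = 0" unfolding d_def l_def using Cf0 by simp
    have "d f = 0" for f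
    proof (cases "rp f = k")
      case True
      then have "\<bar>d f\<bar> = \<bar>d f0\<bar>" by (intro Babs[OF dB]) (simp only: rpf0)
      then show ?thesis unfolding \<open>d f0 = 0\<close> by simp
    next
      case False
      then show ?thesis unfolding d_def cut_def by (simp add: Coff)
    qed
    then have "bd dir d e = 0" for e unfolding bd_def by (intro sum.neutral ballI) simp
    then have bdl: "bd dir (cut k c) e = l * bd dir (C k) e" for e using bdd[of e] by simp
    have "(\<Sum>e\<in>H. bd dir (cut k c) e * x e) = l * (\<Sum>e\<in>H. bd dir (C k) e * x e)"
      unfolding bdl sum_distrib_left by (simp only: mult.assoc)
    then show ?thesis unfolding xK[OF k] by simp
  qed
  have orth: "(\<Sum>e\<in>H. bd dir c e * x e) = 0" if "c \<in> B" for c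
  proof -
    have "bd dir c e = (\<Sum>k\<in>rp ` F. bd dir (cut k c) e)" for e
    proof -
      have "(\<Sum>k\<in>rp ` F. bd dir (cut k c) e)
          = (\<Sum>f\<in>F. \<Sum>k\<in>rp ` F. \<Sum>i<4. if side f i = e then dir f i * cut k c f else 0)"
        unfolding bd_def by (rule sum.swap)
      also have "\<dots> = (\<Sum>f\<in>F. \<Sum>i<4. \<Sum>k\<in>rp ` F. if side f i = e then dir f i * cut k c f else 0)"
        by (intro sum.cong refl sum.swap)
      also have "\<dots> = bd dir c e" unfolding bd_def
      proof (intro sum.cong refl)
        fix f i assume "f \<in> F"
        have "(\<Sum>k\<in>rp ` F. dir f i * cut k c f) = (\<Sum>k\<in>rp ` F. if rp f = k then dir f i * c f else 0)"
          by (intro sum.cong) (auto simp: cut_def)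
        also have "\<dots> = dir f i * c f" using \<open>f \<in> F\<close> finite_F by simp
        finally show "(\<Sum>k\<in>rp ` F. if side f i = e then dir f i * cut k c f else 0) =
           (if side f i = e then dir f i * c f else 0)" by simp
      qed
      finally show ?thesis by simp
    qed
    then have "(\<Sum>e\<in>H. bd dir c e * x e) = (\<Sum>k\<in>rp ` F. \<Sum>e\<in>H. bd dir (cut k c) e * x e)"
      by (subst sum.swap) (simp add: sum_distrib_right)
    then show ?thesis using orth_cut[OF that] by simp
  qed
  define A :: "'f \<Rightarrow> 'e \<Rightarrow> rat" where "A f e = (\<Sum>i<4. if side f i = e then dir f i else 0)" for f e
  have bdA: "bd dir y e = (\<Sum>f\<in>F. y f * A f e)" for y e
    unfolding bd_def A_def sum_distrib_left by (intro sum.cong refl) auto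
  \<comment> \<open>The relations among these equations are the chains in \<open>B\<close>, and
    \<open>x\<close> is orthogonal to their boundaries.\<close>
  have "\<exists>w. \<forall>f\<in>F. (\<Sum>e\<in>E - H. A f e * w e) = - (\<Sum>e\<in>H. A f e * x e)"
  proof (rule linear_system_solvable)
    fix y assume "\<And>e. e \<in> E - H \<Longrightarrow> (\<Sum>f\<in>F. y f * A f e) = 0"
    then have "y \<in> B" by (simp add: B_def bdA)
    have "(\<Sum>f\<in>F. y f * - (\<Sum>e\<in>H. A f e * x e)) = - (\<Sum>f\<in>F. \<Sum>e\<in>H. y f * A f e * x e)"
      by (simp add: sum_distrib_left sum_negf mult.assoc)
    also have "\<dots> = - (\<Sum>e\<in>H. bd dir y e * x e)"
      unfolding bdA sum_distrib_right by (subst sum.swap) (rule refl)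
    finally show "(\<Sum>f\<in>F. y f * - (\<Sum>e\<in>H. A f e * x e)) = 0" using orth[OF \<open>y \<in> B\<close>] by simp
  qed (use finite_E finite_F in auto)
  then obtain w where w: "\<And>f. f \<in> F \<Longrightarrow> (\<Sum>e\<in>E - H. A f e * w e) = - (\<Sum>e\<in>H. A f e * x e)" by blast
  let ?w = "\<lambda>e. if e \<in> H then x e else w e"
  have "(\<Sum>i<4. dir f i * ?w (side f i)) = 0" if f: "f \<in> F" for f
  proof -
    have "(\<Sum>i<4. dir f i * ?w (side f i)) = (\<Sum>i<4. \<Sum>e\<in>E. (if side f i = e then dir f i else 0) * ?w e)"
    proof (rule sum.cong[OF refl])
      fix i :: nat assume "i \<in> {..<4}"
      then have "side f i \<in> E" using side_in[OF f] by simp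
      have "(\<Sum>e\<in>E. (if side f i = e then dir f i else 0) * ?w e) = (\<Sum>e\<in>E. if side f i = e then dir f i * ?w e else 0)"
        by (intro sum.cong) auto
      then show "dir f i * ?w (side f i) = (\<Sum>e\<in>E. (if side f i = e then dir f i else 0) * ?w e)"
        using \<open>side f i \<in> E\<close> finite_E by simp
    qed
    also have "\<dots> = (\<Sum>e\<in>E. A f e * ?w e)"
      unfolding A_def sum_distrib_right by (rule sum.swap)
    also have "\<dots> = (\<Sum>e\<in>E - H. A f e * ?w e) + (\<Sum>e\<in>H. A f e * ?w e)"
      using finite_E H by (intro sum.subset_diff)
    also have "\<dots> = (\<Sum>e\<in>E - H. A f e * w e) + (\<Sum>e\<in>H. A f e * x e)"
      by (intro arg_cong2[where f = "(+)"] sum.cong) auto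
    finally show ?thesis using w[OF f] by simp
  qed
  from rat_potential[OF this] obtain p where p: "\<And>e. e \<in> E \<Longrightarrow> ?w e = p (trg e) - p (src e)" by blast
  have "(\<Sum>e\<in>H. x e * x e) = (\<Sum>e\<in>H. x e * (p (trg e) - p (src e)))"
  proof (rule sum.cong[OF refl])
    fix e assume "e \<in> H"
    then show "x e * x e = x e * (p (trg e) - p (src e))" using p[of e] H by auto
  qed
  also have "\<dots> = 0"
    by (rule circulation_orthogonal_diff[OF finH W(1,3) xW])
  finally have "\<forall>e\<in>H. x e = 0" using finH by (simp add: sum_nonneg_eq_0_iff)
  then show False using x by blast
qed


section \<open>Degeneracy and greedy coloring\<close>

definition nbr :: "'v \<Rightarrow> 'v set" where
  "nbr v = {u. \<exists>e\<in>E. {src e, trg e} = {v, u}}"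

lemma nbr_sym: "u \<in> nbr v \<longleftrightarrow> v \<in> nbr u"
  by (simp add: nbr_def insert_commute)

lemma nbr_subset: "nbr v \<subseteq> src ` E \<union> trg ` E"
  by (auto simp: nbr_def doubleton_eq_iff)

lemma nbr_irrefl: "v \<notin> nbr v"
  using loopless by (fastforce simp: nbr_def)

lemma finite_nbr: "finite (nbr v)"
  using nbr_subset finite_E by (metis finite_UnI finite_imageI finite_subset)

text \<open>Minimum degree 4 would require at least \<open>2 * card W\<close> edges without
  parallels, two more than the bound on simple subgraphs admits.\<close>

lemma ex_low_degree:
  assumes W: "finite W" "W \<noteq> {}"
  shows "\<exists>v\<in>W. card (nbr v \<inter> W) \<le> 3"
proof (rule ccontr)
  assume "\<not> ?thesis"
  then have ge: "card (nbr v \<inter> W) \<ge> 4" if "v \<in> W" for v using that by force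
  let ?en = "\<lambda>e. {src e, trg e}"
  let ?E = "{e \<in> E. src e \<in> W \<and> trg e \<in> W}"
  \<comment> \<open>One edge is kept from each class of parallel edges.\<close>
  obtain H where H: "H \<subseteq> ?E" "inj_on ?en H" "?en ` ?E = ?en ` H"
    using iffD1[OF subset_image_inj[of "?en ` ?E" ?en ?E] order_refl] by (elim exE conjE)
  have finH: "finite H" using H(1) finite_E by (auto intro: finite_subset)
  have "card (nbr v \<inter> W) \<le> card {e \<in> H. v \<in> ?en e}" if v: "v \<in> W" for v
  proof -
    have "nbr v \<inter> W \<subseteq> (\<lambda>e. if src e = v then trg e else src e) ` {e \<in> H. v \<in> ?en e}"
    proof
      fix u assume u: "u \<in> nbr v \<inter> W"
      then obtain e0 where e0: "e0 \<in> E" "?en e0 = {v, u}" by (auto simp: nbr_def)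
      then have "e0 \<in> ?E" using u v by auto
      then obtain e where e: "e \<in> H" "?en e = {v, u}" using H(3) e0(2) by (metis (lifting) image_eqI imageE)
      have "v \<noteq> u" using u nbr_irrefl by auto
      then have "u = (if src e = v then trg e else src e)" using e(2) by (auto simp: doubleton_eq_iff)
      then show "u \<in> (\<lambda>e. if src e = v then trg e else src e) ` {e \<in> H. v \<in> ?en e}"
        using e by blast
    qed
    moreover have "finite {e \<in> H. v \<in> ?en e}" using finH by simp
    ultimately show ?thesis by (rule surj_card_le[rotated])
  qed
  then have "(\<Sum>v\<in>W. 4) \<le> (\<Sum>v\<in>W. card {e \<in> H. v \<in> ?en e})"
    using ge by (intro sum_mono) (meson order.trans)
  also have "\<dots> = (\<Sum>v\<in>W. \<Sum>e\<in>H. if v \<in> ?en e then 1 else 0)"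
    using finH by (intro sum.cong refl) (simp add: sum.If_cases Int_def)
  also have "\<dots> = (\<Sum>e\<in>H. \<Sum>v\<in>W. if v \<in> ?en e then 1 else 0)" by (rule sum.swap)
  also have "\<dots> \<le> (\<Sum>e\<in>H. 2)"
  proof (rule sum_mono)
    fix e
    have "(\<Sum>v\<in>W. if v \<in> ?en e then 1 else 0) = card (W \<inter> ?en e)"
      using sum.inter_restrict[OF W(1), of "\<lambda>_. 1 :: nat" "?en e"] by (simp only: card_eq_sum)
    also have "\<dots> \<le> card (?en e)" by (intro card_mono) auto
    also have "\<dots> \<le> 2" by (simp add: card_insert_if)
    finally show "(\<Sum>v\<in>W. if v \<in> ?en e then 1 else 0) \<le> (2::nat)" .
  qed
  finally have "4 * card W \<le> 2 * card H" by simp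
  moreover have "card H + 2 \<le> 2 * card W"
    using H by (intro card_simple_subgraph_le W) auto
  ultimately show False by simp
qed

text \<open>Greedy: a vertex with at most three neighbours in \<open>W\<close> is removed and
  colored last.\<close>

lemma four_coloring:
  assumes "finite W"
  shows "\<exists>c :: 'v \<Rightarrow> nat. (\<forall>v. c v < 4) \<and> (\<forall>v\<in>W. \<forall>u\<in>nbr v \<inter> W. c u \<noteq> c v)"
  using assms
proof (induction "card W" arbitrary: W)
  case 0
  then show ?case by (intro exI[of _ "\<lambda>_. 0"]) auto
next
  case (Suc n)
  then have "W \<noteq> {}" by auto
  then obtain v where v: "v \<in> W" "card (nbr v \<inter> W) \<le> 3" using ex_low_degree Suc.prems by blast
  have "n = card (W - {v})" using Suc.hyps(2) v(1) Suc.prems by simp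
  moreover have "finite (W - {v})" using Suc.prems by simp
  ultimately obtain c :: "'v \<Rightarrow> nat" where c: "\<forall>u. c u < 4"
    "\<forall>u\<in>W - {v}. \<forall>t\<in>nbr u \<inter> (W - {v}). c t \<noteq> c u"
    using Suc.hyps(1)[of "W - {v}"] by blast
  have "card (c ` (nbr v \<inter> W)) < card {..<4::nat}"
    using card_image_le[of "nbr v \<inter> W" c] v(2) Suc.prems by simp
  then have "\<not> {..<4} \<subseteq> c ` (nbr v \<inter> W)"
    using card_mono[of "c ` (nbr v \<inter> W)" "{..<4}"] Suc.prems by (meson finite_Int finite_imageI leD)
  then obtain k where k: "k < 4" "k \<notin> c ` (nbr v \<inter> W)" by blast
  show ?case
  proof (intro exI[of _ "c(v := k)"] conjI allI ballI)
    show "(c(v := k)) u < 4" for u using c k by simp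
    fix u t assume u: "u \<in> W" "t \<in> nbr u \<inter> W"
    then have "t \<noteq> u" using nbr_irrefl by auto
    consider "u = v" | "t = v" "u \<noteq> v" | "u \<noteq> v" "t \<noteq> v" by blast
    then show "(c(v := k)) t \<noteq> (c(v := k)) u"
    proof cases
      case 1 then show ?thesis using k u \<open>t \<noteq> u\<close> by auto
    next
      case 2
      then have "u \<in> nbr v \<inter> W" using u iffD1[OF nbr_sym] by blast
      then show ?thesis using 2 k by auto
    next
      case 3 then show ?thesis using c(2) u by auto
    qed
  qed
qed

end

section \<open>Noncrossing orders of forests\<close>

text \<open>That \<open>\<Gamma>\<close> is a forest is expressed by making every edge a bridge:
  some function is constant on each other edge but separates its ends. Deleting a bridge leaves two
  parts, which are ordered by induction and nested into each other. The minimal root is the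
  strengthening that makes the nesting work.\<close>

lemma noncrossing_order_of_forest:
  fixes S :: "'a set" and \<Gamma> :: "'a set set"
  assumes "finite S" "finite \<Gamma>" "\<And>e. e \<in> \<Gamma> \<Longrightarrow> e \<subseteq> S \<and> card e = 2"
    and "\<And>e. e \<in> \<Gamma> \<Longrightarrow> \<exists>l :: 'a \<Rightarrow> rat. (\<forall>e'\<in>\<Gamma> - {e}. \<forall>x\<in>e'. \<forall>y\<in>e'. l x = l y) \<and> \<not> (\<forall>x\<in>e. \<forall>y\<in>e. l x = l y)"
    and "r \<in> S"
  shows "\<exists>C :: 'a \<Rightarrow> nat. inj_on C S \<and> (\<forall>s\<in>S. C r \<le> C s) \<and>
    (\<forall>p q u v. {p, q} \<in> \<Gamma> \<longrightarrow> {u, v} \<in> \<Gamma> \<longrightarrow> \<not> (C p < C u \<and> C u < C q \<and> C q < C v))"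
  using assms
proof (induction "card \<Gamma>" arbitrary: \<Gamma> S r rule: less_induct)
  case less
  note fin = less.prems(1,2) and sub = less.prems(3) and bridge = less.prems(4) and r = less.prems(5)
  show ?case
  proof (cases "\<Gamma> = {}")
    case True
    obtain f :: "'a \<Rightarrow> nat" where "inj_on f S" using finite_imp_inj_to_nat_seg[OF fin(1)] by metis
    then have "inj_on (\<lambda>s. if s = r then 0 else Suc (f s)) S" by (auto simp: inj_on_def)
    then show ?thesis using True by (intro exI[of _ "\<lambda>s. if s = r then 0 else Suc (f s)"]) auto
  next
    case False
    then obtain e where e: "e \<in> \<Gamma>" by blast
    obtain l :: "'a \<Rightarrow> rat" where l: "\<forall>e'\<in>\<Gamma> - {e}. \<forall>x\<in>e'. \<forall>y\<in>e'. l x = l y"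
      and "\<not> (\<forall>x\<in>e. \<forall>y\<in>e. l x = l y)" using bridge[OF e] by blast
    then obtain x0 y0 where xy: "x0 \<in> e" "y0 \<in> e" "l x0 \<noteq> l y0" by blast
    then have "x0 \<noteq> y0" by auto
    have "card e = 2" using sub[OF e] by blast
    have exy: "e = {x0, y0}"
    proof (rule sym, rule card_subset_eq)
      show "finite e" using \<open>card e = 2\<close> card_ge_0_finite[of e] by simp
      show "{x0, y0} \<subseteq> e" using xy by blast
      show "card {x0, y0} = card e" using \<open>card e = 2\<close> \<open>x0 \<noteq> y0\<close> by simp
    qed
    \<comment> \<open>A level set of \<open>l\<close> or its complement, whichever contains the
      root, is joined to the rest by \<open>e\<close> alone; \<open>y\<close> is the end of
      \<open>e\<close> on the side of the root.\<close>
    have "\<exists>A y z. r \<in> A \<and> A \<subseteq> S \<and> y \<in> A \<and> z \<in> S - A \<and> e = {y, z} \<and>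
       (\<forall>e'\<in>\<Gamma> - {e}. e' \<subseteq> A \<or> e' \<subseteq> S - A)"
    proof (cases "l r = l x0")
      case True
      show ?thesis
      proof (rule exI[of _ "{s \<in> S. l s = l x0}"], rule exI[of _ x0], rule exI[of _ y0], intro conjI ballI)
        fix e' assume "e' \<in> \<Gamma> - {e}"
        then have "e' \<subseteq> S" and const: "\<And>s t. s \<in> e' \<Longrightarrow> t \<in> e' \<Longrightarrow> l s = l t"
          using l sub[of e'] by (blast, blast)
        show "e' \<subseteq> {s \<in> S. l s = l x0} \<or> e' \<subseteq> S - {s \<in> S. l s = l x0}"
        proof (cases "\<exists>t\<in>e'. l t = l x0")
          case True
          then have "\<forall>s\<in>e'. l s = l x0" using const by metis
          then show ?thesis using \<open>e' \<subseteq> S\<close> by auto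
        next
          case False
          then show ?thesis using \<open>e' \<subseteq> S\<close> by auto
        qed
      qed (use xy exy sub[OF e] r True in auto)
    next
      case False
      show ?thesis
      proof (rule exI[of _ "{s \<in> S. l s \<noteq> l x0}"], rule exI[of _ y0], rule exI[of _ x0], intro conjI ballI)
        fix e' assume "e' \<in> \<Gamma> - {e}"
        then have "e' \<subseteq> S" and const: "\<And>s t. s \<in> e' \<Longrightarrow> t \<in> e' \<Longrightarrow> l s = l t"
          using l sub[of e'] by (blast, blast)
        show "e' \<subseteq> {s \<in> S. l s \<noteq> l x0} \<or> e' \<subseteq> S - {s \<in> S. l s \<noteq> l x0}"
        proof (cases "\<exists>t\<in>e'. l t = l x0")
          case True
          then have "\<forall>s\<in>e'. l s = l x0" using const by metis
          then show ?thesis using \<open>e' \<subseteq> S\<close> by auto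
        next
          case False
          then show ?thesis using \<open>e' \<subseteq> S\<close> by auto
        qed
      qed (use xy exy sub[OF e] r False in auto)
    qed
    then obtain A y z where A: "r \<in> A" "A \<subseteq> S" "y \<in> A" "z \<in> S - A" "e = {y, z}"
      and split': "\<forall>e'\<in>\<Gamma> - {e}. e' \<subseteq> A \<or> e' \<subseteq> S - A" by (elim exE conjE) (rule that)
    have split: "e' \<subseteq> A \<or> e' \<subseteq> S - A" if "e' \<in> \<Gamma>" "e' \<noteq> e" for e'
      using split' that by blast
    let ?B = "S - A"
    have sub_IH: "\<exists>C :: 'a \<Rightarrow> nat. inj_on C T \<and> (\<forall>s\<in>T. C t \<le> C s) \<and>
      (\<forall>p q u v. {p, q} \<in> {e'\<in>\<Gamma>. e' \<subseteq> T} \<longrightarrow> {u, v} \<in> {e'\<in>\<Gamma>. e' \<subseteq> T} \<longrightarrow> \<not> (C p < C u \<and> C u < C q \<and> C q < C v))"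
      if T: "T \<subseteq> S" "\<not> e \<subseteq> T" "t \<in> T" for T t
    proof (rule less.hyps)
      show "card {e'\<in>\<Gamma>. e' \<subseteq> T} < card \<Gamma>"
        using T e fin by (intro psubset_card_mono) auto
      show "finite T" using T fin finite_subset by blast
      fix e' assume e': "e' \<in> {e'\<in>\<Gamma>. e' \<subseteq> T}"
      then have "e' \<in> \<Gamma>" by simp
      from bridge[OF this] obtain l' :: "'a \<Rightarrow> rat" where l': "\<forall>e''\<in>\<Gamma> - {e'}. \<forall>x\<in>e''. \<forall>y\<in>e''. l' x = l' y"
        and nl': "\<not> (\<forall>x\<in>e'. \<forall>y\<in>e'. l' x = l' y)"
        by (elim exE conjE) (rule that)
      show "\<exists>l :: 'a \<Rightarrow> rat. (\<forall>e''\<in>{e'\<in>\<Gamma>. e' \<subseteq> T} - {e'}. \<forall>x\<in>e''. \<forall>y\<in>e''. l x = l y) \<and> \<not> (\<forall>x\<in>e'. \<forall>y\<in>e'. l x = l y)"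
        by (rule exI[of _ l'], rule conjI[OF ballI nl'], rule bspec[OF l'], simp)
      show "e' \<subseteq> T \<and> card e' = 2" using e' sub[OF \<open>e' \<in> \<Gamma>\<close>] by simp
    qed (use fin(2) T(3) in simp_all)
    have "\<not> e \<subseteq> A" "\<not> e \<subseteq> ?B" "?B \<subseteq> S" using A by simp_all
    from sub_IH[OF A(2) this(1) A(1)] obtain CA :: "'a \<Rightarrow> nat" where "inj_on CA A" "\<forall>s\<in>A. CA r \<le> CA s"
      and nA: "\<forall>p q u v. {p, q} \<in> {e'\<in>\<Gamma>. e' \<subseteq> A} \<longrightarrow> {u, v} \<in> {e'\<in>\<Gamma>. e' \<subseteq> A} \<longrightarrow> \<not> (CA p < CA u \<and> CA u < CA q \<and> CA q < CA v)"
      by (elim exE conjE) (rule that)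
    note CA = this(1,2)
    from sub_IH[OF \<open>?B \<subseteq> S\<close> \<open>\<not> e \<subseteq> ?B\<close> A(4)] obtain CB :: "'a \<Rightarrow> nat" where "inj_on CB ?B" "\<forall>s\<in>?B. CB z \<le> CB s"
      and nB: "\<forall>p q u v. {p, q} \<in> {e'\<in>\<Gamma>. e' \<subseteq> ?B} \<longrightarrow> {u, v} \<in> {e'\<in>\<Gamma>. e' \<subseteq> ?B} \<longrightarrow> \<not> (CB p < CB u \<and> CB u < CB q \<and> CB q < CB v)"
      by (elim exE conjE) (rule that)
    note CB = this(1,2)
    obtain M where M: "\<And>s. s \<in> ?B \<Longrightarrow> CB s < M"
      using fin finite_nat_set_iff_bounded[of "CB ` ?B"] by auto
    \<comment> \<open>The far part is inserted as one block immediately after \<open>y\<close>; the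
      factor \<open>Suc M\<close> makes room for it.\<close>
    define C where "C s = (if s \<in> A then CA s * Suc M else CA y * Suc M + Suc (CB s))" for s
    have AA: "C s < C t \<longleftrightarrow> CA s < CA t" if "s \<in> A" "t \<in> A" for s t
      using that unfolding C_def by (simp del: mult_Suc_right)
    have BB: "C s < C t \<longleftrightarrow> CB s < CB t" if "s \<in> ?B" "t \<in> ?B" for s t using that unfolding C_def by simp
    have CsA: "C s = CA s * Suc M" if "s \<in> A" for s using that by (simp add: C_def)
    have CtB: "C t = CA y * Suc M + Suc (CB t)" if "t \<in> ?B" for t using that by (simp add: C_def)
    have AB: "C s < C t \<longleftrightarrow> CA s \<le> CA y" if "s \<in> A" "t \<in> ?B" for s t
    proof (cases "CA s \<le> CA y")
      case True
      then have "CA s * Suc M \<le> CA y * Suc M" by (rule mult_le_mono1)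
      then show ?thesis using True CsA[OF that(1)] CtB[OF that(2)] by linarith
    next
      case False
      then have "Suc (CA y) * Suc M \<le> CA s * Suc M" by (intro mult_le_mono1) simp
      moreover have "Suc (CA y) * Suc M = CA y * Suc M + Suc M" by simp
      ultimately show ?thesis using False M[OF that(2)] CsA[OF that(1)] CtB[OF that(2)] by linarith
    qed
    have ne: "C s \<noteq> C t" if "s \<in> A" "t \<in> ?B" for s t
    proof
      assume eq: "C s = C t"
      have "CA s * Suc M = CA y * Suc M + Suc (CB t)"
        using eq CsA[OF that(1)] CtB[OF that(2)] by (simp only:)
      moreover have "Suc (CB t) < Suc M" using M[of t] that by simp
      ultimately have "Suc (CB t) = (CA s * Suc M) mod Suc M" by (metis mod_less mod_mult_self3 mult.commute)
      then show False by (simp only: mod_mult_self2_is_0)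
    qed
    have BA: "C t < C s \<longleftrightarrow> CA y < CA s" if "s \<in> A" "t \<in> ?B" for s t
      using AB[OF that] ne[OF that] by linarith
    show ?thesis
    proof (intro exI[of _ C] conjI ballI allI impI)
      show "inj_on C S"
      proof (rule inj_onI, rule ccontr)
        fix s t assume st: "s \<in> S" "t \<in> S" "C s = C t" "s \<noteq> t"
        show False
        proof (cases "s \<in> A"; cases "t \<in> A")
          assume "s \<in> A" "t \<in> A"
          then show False using AA[of s t] AA[of t s] st CA(1) by (metis inj_onD linorder_neqE_nat less_irrefl)
        next
          assume "s \<notin> A" "t \<notin> A"
          then show False using BB[of s t] BB[of t s] st CB(1) by (metis DiffI inj_onD linorder_neqE_nat less_irrefl)
        qed (use ne[of s t] ne[of t s] st in auto)
      qed
      show "C r \<le> C s" if "s \<in> S" for s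
      proof (cases "s \<in> A")
        case True
        then show ?thesis using AA[of s r] bspec[OF CA(2), of s] A by (metis leD leI)
      next
        case False
        then have "C r < C s" using AB[of r s] bspec[OF CA(2), of y] A that by simp
        then show ?thesis by simp
      qed
      fix p q u v assume pq: "{p, q} \<in> \<Gamma>" and uv: "{u, v} \<in> \<Gamma>"
      have pq': "{p, q} \<subseteq> A \<or> {p, q} \<subseteq> ?B \<or> p = y \<and> q = z \<or> p = z \<and> q = y"
        using split[OF pq] A(5) by (metis doubleton_eq_iff)
      have uv': "{u, v} \<subseteq> A \<or> {u, v} \<subseteq> ?B \<or> u = y \<and> v = z \<or> u = z \<and> v = y"
        using split[OF uv] A(5) by (metis doubleton_eq_iff)
      show "\<not> (C p < C u \<and> C u < C q \<and> C q < C v)"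
      proof
        assume lt: "C p < C u \<and> C u < C q \<and> C q < C v"
        have zB: "z \<in> ?B" and yA: "y \<in> A" using A by auto
        have yz: "C y < C z" using AB[OF yA zB] by simp
        have "{p, q} \<subseteq> A \<and> {u, v} \<subseteq> A \<or> {p, q} \<subseteq> ?B \<and> {u, v} \<subseteq> ?B
          \<or> {p, q} \<subseteq> A \<and> {u, v} \<subseteq> ?B \<or> {p, q} \<subseteq> ?B \<and> {u, v} \<subseteq> A
          \<or> (p = y \<and> q = z) \<and> {u, v} \<subseteq> A \<or> (p = y \<and> q = z) \<and> {u, v} \<subseteq> ?B
          \<or> (u = y \<and> v = z) \<and> {p, q} \<subseteq> A \<or> (u = y \<and> v = z) \<and> {p, q} \<subseteq> ?B
          \<or> (p = z \<and> q = y) \<or> (u = z \<and> v = y) \<or> (p = y \<and> q = z) \<and> (u = y \<and> v = z)"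
          using pq' uv' by argo
        then show False
        proof (elim disjE, goal_cases)
          case 1 then show False using nA[rule_format, of p q u v] pq uv lt AA by auto
        next
          case 2 then show False using nB[rule_format, of p q u v] pq uv lt BB by auto
        next
          case 3 then show False using lt AB[of q v] BA[of q u] by auto
        next
          case 4 then show False using lt AB[of u q] BA[of u p] by auto
        next
          case 5 then show False using lt AA[of y u] AB[of u z] zB yA by auto
        next
          \<comment> \<open>The block begins with its root \<open>z\<close>, so nothing of it lies
            between \<open>y\<close> and \<open>z\<close>.\<close>
          case 6 then show False using lt BB[of u z] bspec[OF CB(2), of u] zB by auto
        next
          case 7 then show False using lt AA[of y q] AB[of q z] zB yA by auto
        next
          case 8 then show False using lt BA[of y p] yA by auto
        qed (use lt yz in auto)
      qed
    qed
  qed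
qed

section \<open>Local 3-colorings\<close>

locale connected_quadrangular_complex = quadrangular_complex E src trg F side corner
  for E :: "'e set" and src trg :: "'e \<Rightarrow> 'v" and F :: "'f set"
    and side :: "'f \<Rightarrow> nat \<Rightarrow> 'e" and corner :: "'f \<Rightarrow> nat \<Rightarrow> 'v" +
  assumes face_connected: "K \<subseteq> F \<Longrightarrow> K \<noteq> {} \<Longrightarrow>
      (\<And>f g i j. f \<in> K \<Longrightarrow> g \<in> F \<Longrightarrow> i < 4 \<Longrightarrow> j < 4 \<Longrightarrow> side f i = side g j \<Longrightarrow> g \<in> K) \<Longrightarrow> K = F"
    and covered: "e \<in> E \<Longrightarrow> \<exists>f\<in>F. \<exists>i<4. side f i = e"
    and faces_nonempty: "F \<noteq> {}"
begin

section \<open>An Euler inequality and twisted potentials\<close>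

definition V :: "'v set" where "V = src ` E \<union> trg ` E"

lemma finite_V: "finite V"
  using finite_E by (simp add: V_def)

lemma corner_in_V: "f \<in> F \<Longrightarrow> i < 4 \<Longrightarrow> corner f i \<in> V"
  using side_ends[of f i] side_in[of f i] unfolding V_def by (metis UnI1 UnI2 doubleton_eq_iff image_eqI)

text \<open>One half of Euler's formula. With at least \<open>card F + card V\<close> edges, a
  nonzero weighting would have vanishing face sums and be a circulation, hence be orthogonal to
  itself.\<close>

lemma card_E_less: "card E < card F + card V"
proof (rule ccontr)
  assume ge: "\<not> ?thesis"
  obtain f where "f \<in> F" using faces_nonempty by blast
  then obtain u where u: "u \<in> V" using corner_in_V[of f 0] by auto
  have "card (V - {u}) = card V - 1" "card V > 0" using u finite_V by (auto simp: card_gt_0_iff)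
  then have lt: "card F + card (V - {u}) < card E" using ge by linarith
  have finVu: "finite (V - {u})" using finite_V by simp
  obtain x :: "'e \<Rightarrow> rat" where x: "\<exists>e\<in>E. x e \<noteq> 0"
    and xF: "\<And>f. f \<in> F \<Longrightarrow> (\<Sum>e\<in>E. (\<Sum>i<4. if side f i = e then dir f i else 0) * x e) = 0"
    and xV: "\<And>v. v \<in> V - {u} \<Longrightarrow> (\<Sum>e\<in>E. inc v e * x e) = 0"
    using homogeneous_systems_nontrivial[OF finite_F finVu finite_E lt,
        of "\<lambda>f e. \<Sum>i<4. if side f i = e then dir f i else 0" inc] by blast
  have "(\<Sum>i<4. dir f i * x (side f i)) = 0" if f: "f \<in> F" for f
  proof -
    have "(\<Sum>e\<in>E. (\<Sum>i<4. if side f i = e then dir f i else 0) * x e)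
        = (\<Sum>i<4. \<Sum>e\<in>E. (if side f i = e then dir f i else 0) * x e)"
      unfolding sum_distrib_right by (rule sum.swap)
    also have "\<dots> = (\<Sum>i<4. dir f i * x (side f i))"
    proof (rule sum.cong[OF refl])
      fix i :: nat assume "i \<in> {..<4}"
      then have "side f i \<in> E" using side_in[OF f] by simp
      have "(\<Sum>e\<in>E. (if side f i = e then dir f i else 0) * x e) = (\<Sum>e\<in>E. if side f i = e then dir f i * x e else 0)"
        by (intro sum.cong) auto
      then show "(\<Sum>e\<in>E. (if side f i = e then dir f i else 0) * x e) = dir f i * x (side f i)"
        using \<open>side f i \<in> E\<close> finite_E by simp
    qed
    finally show ?thesis using xF[OF f] by simp
  qed
  from rat_potential[OF this] obtain p where p: "\<forall>e\<in>E. x e = p (trg e) - p (src e)" by blast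
  have "(\<Sum>e\<in>E. x e * x e) = (\<Sum>e\<in>E. x e * (p (trg e) - p (src e)))"
    using p by (intro sum.cong refl) simp
  also have "\<dots> = 0"
    by (rule circulation_orthogonal_diff[OF finite_E finite_V _ xV]) (simp add: V_def)
  finally have "\<forall>e\<in>E. x e = 0" using finite_E by (simp add: sum_nonneg_eq_0_iff)
  then show False using x by blast
qed

text \<open>Alternating signs do for sums over the ends of edges what \<open>dir\<close> does for
  differences; they close up because faces have even length.\<close>

definition alt :: "'f \<Rightarrow> nat \<Rightarrow> rat" where "alt f i = (- 1) ^ i"

lemma abs_alt: "\<bar>alt f i\<bar> = 1"
  by (simp add: alt_def power_abs)

lemma sum_alt: "(\<Sum>i<4. alt f i * g i) = g 0 - g 1 + g 2 - g 3"
  unfolding sum_lessThan_4 by (simp add: alt_def)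

lemma side_sum:
  fixes P :: "'v \<Rightarrow> rat"
  assumes "f \<in> F" "i < 4"
  shows "P (src (side f i)) + P (trg (side f i)) = P (corner f i) + P (corner f (Suc i mod 4))"
proof -
  consider "src (side f i) = corner f i" "trg (side f i) = corner f (Suc i mod 4)"
    | "src (side f i) = corner f (Suc i mod 4)" "trg (side f i) = corner f i"
    using side_ends[OF assms] by (meson doubleton_eq_iff)
  then show ?thesis by cases simp_all
qed

lemma sum_alt_side_sum:
  fixes P :: "'v \<Rightarrow> rat"
  assumes "f \<in> F"
  shows "(\<Sum>i<4. alt f i * (P (src (side f i)) + P (trg (side f i)))) = 0"
  unfolding sum_alt
  using side_sum[OF assms, of 0 P] side_sum[OF assms, of 1 P] side_sum[OF assms, of 2 P] side_sum[OF assms, of 3 P]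
  unfolding Suc_mod_4 by simp

text \<open>Twisted analogue of \<open>rat_potential\<close>: the Euler characteristic leaves room for at most
  one relation among the alternating face sums beyond those forced by potentials, and connectedness
  of the faces excludes it.\<close>

lemma twisted_potential:
  fixes s :: "'e \<Rightarrow> rat"
  assumes alt0: "\<And>f. f \<in> F \<Longrightarrow> (\<Sum>i<4. alt f i * s (side f i)) = 0"
    and nonbip: "\<nexists>b :: 'v \<Rightarrow> bool. \<forall>e\<in>E. b (src e) \<noteq> b (trg e)"
  shows "\<exists>P. \<forall>e\<in>E. s e = P (src e) + P (trg e)"
proof -
  obtain f0 where f0: "f0 \<in> F" using faces_nonempty by blast
  \<comment> \<open>The unknowns are the face coefficients with value 0 fixed at \<open>f0\<close>,
    the vertex values and one coefficient for \<open>s\<close>: in total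
    \<open>card F + card V\<close>, more than the number of edges.\<close>
  define I where "I = (F - {f0}) <+> (V <+> {()})"
  define A :: "'e \<Rightarrow> 'f + 'v + unit \<Rightarrow> rat" where "A e j = (case j of Inl f \<Rightarrow> (\<Sum>i<4. if side f i = e then alt f i else 0)
     | Inr (Inl v) \<Rightarrow> (if src e = v then 1 else 0) + (if trg e = v then 1 else 0)
     | Inr (Inr _) \<Rightarrow> s e)" for e j
  have "finite I" using finite_F finite_V by (simp add: I_def)
  moreover have "card E < card I"
  proof -
    have "card F > 0" using f0 finite_F card_gt_0_iff by blast
    have "card I = card (F - {f0}) + (card V + 1)"
      unfolding I_def using finite_F finite_V by (simp add: card_Plus)
    also have "card (F - {f0}) = card F - 1" using f0 finite_F by simp
    finally show ?thesis using card_E_less \<open>card F > 0\<close> by simp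
  qed
  ultimately obtain x where x: "\<exists>j\<in>I. x j \<noteq> 0" and xE: "\<And>e. e \<in> E \<Longrightarrow> (\<Sum>j\<in>I. A e j * x j) = 0"
    using homogeneous_system_nontrivial[OF finite_E, of I A] by blast
  define c where "c f = (if f = f0 then 0 else x (Inl f))" for f
  define P where "P v = x (Inr (Inl v))" for v
  define l where "l = x (Inr (Inr ()))"
  define y where "y e = P (src e) + P (trg e) + l * s e" for e
  have bdy: "bd alt c e = - y e" if e: "e \<in> E" for e
  proof -
    have "src e \<in> V" "trg e \<in> V" using e by (auto simp: V_def)
    have "(\<Sum>j\<in>I. A e j * x j) = (\<Sum>f\<in>F - {f0}. A e (Inl f) * x (Inl f))
        + ((\<Sum>v\<in>V. A e (Inr (Inl v)) * P v) + A e (Inr (Inr ())) * l)"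
      unfolding I_def P_def l_def using finite_F finite_V by (simp add: sum.Plus)
    also have "(\<Sum>f\<in>F - {f0}. A e (Inl f) * x (Inl f)) = (\<Sum>f\<in>F - {f0}. A e (Inl f) * c f)"
      by (intro sum.cong) (auto simp: c_def)
    also have "\<dots> = (\<Sum>f\<in>F. A e (Inl f) * c f)"
      using finite_F by (intro sum.mono_neutral_left) (auto simp: c_def)
    also have "\<dots> = bd alt c e"
      unfolding bd_def A_def by (intro sum.cong refl) (simp add: sum_distrib_right if_distrib[of "\<lambda>t. t * _"] cong: if_cong)
    also have "(\<Sum>v\<in>V. A e (Inr (Inl v)) * P v) =
        (\<Sum>v\<in>V. if src e = v then P v else 0) + (\<Sum>v\<in>V. if trg e = v then P v else 0)"
      unfolding sum.distrib[symmetric] A_def by (intro sum.cong) auto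
    also have "\<dots> = P (src e) + P (trg e)"
      using \<open>src e \<in> V\<close> \<open>trg e \<in> V\<close> finite_V by simp
    also have "A e (Inr (Inr ())) = s e" by (simp add: A_def)
    finally have "bd alt c e + (P (src e) + P (trg e) + s e * l) = 0" using xE[OF e] by simp
    then show ?thesis unfolding y_def by (simp add: algebra_simps eq_neg_iff_add_eq_0)
  qed
  \<comment> \<open>\<open>y\<close> is the negative of a twisted boundary and also has vanishing
    alternating face sums, so it is orthogonal to itself.\<close>
  have "(\<Sum>e\<in>E. y e * y e) = - (\<Sum>e\<in>E. y e * bd alt c e)"
    using bdy by (simp add: sum_negf)
  also have "\<dots> = - (\<Sum>f\<in>F. c f * (\<Sum>i<4. alt f i * y (side f i)))" unfolding sum_mult_bd ..
  also have "\<dots> = 0"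
  proof -
    have "(\<Sum>i<4. alt f i * y (side f i)) = 0" if f: "f \<in> F" for f
    proof -
      have "(\<Sum>i<4. alt f i * y (side f i)) =
         (\<Sum>i<4. alt f i * (P (src (side f i)) + P (trg (side f i)))) + l * (\<Sum>i<4. alt f i * s (side f i))"
        unfolding y_def sum_distrib_left sum.distrib[symmetric] by (intro sum.cong refl) (simp add: algebra_simps)
      then show ?thesis using sum_alt_side_sum[OF f] alt0[OF f] by simp
    qed
    then show ?thesis by simp
  qed
  finally have y0: "y e = 0" if "e \<in> E" for e using that finite_E by (simp add: sum_nonneg_eq_0_iff)
  \<comment> \<open>The absolute value of \<open>c\<close> spreads across shared edges, starting
    from the value 0 fixed at \<open>f0\<close>.\<close>
  have c0: "c f = 0" if "f \<in> F" for f
  proof -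
    have "{f \<in> F. c f = 0} = F"
    proof (rule face_connected)
      show "{f \<in> F. c f = 0} \<noteq> {}" using f0 by (auto simp: c_def)
      fix f g i j assume fg: "f \<in> {f \<in> F. c f = 0}" "g \<in> F" "i < 4" "j < 4" "side f i = side g j"
      have "side f i \<in> E" using fg side_in by simp
      then have "bd alt c (side f i) = 0" using bdy y0 by simp
      from abs_eq_if_bd_0[OF \<open>side f i \<in> E\<close> this abs_alt _ \<open>i < 4\<close> refl \<open>g \<in> F\<close> \<open>j < 4\<close> fg(5)[symmetric]]
      show "g \<in> {f \<in> F. c f = 0}" using fg by simp
    qed simp
    then show ?thesis using that by blast
  qed
  have Pl: "P (src e) + P (trg e) + l * s e = 0" if "e \<in> E" for e using y0[OF that] by (simp add: y_def)
  \<comment> \<open>Otherwise \<open>P\<close> changes sign along every edge. Its absolute value is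
    the same everywhere by connectedness and is not 0, so the sign of \<open>P\<close> would be a
    2-coloring.\<close>
  have "l \<noteq> 0"
  proof
    assume "l = 0"
    then have P: "P (trg e) = - P (src e)" if "e \<in> E" for e using Pl[OF that] by simp
    have corner: "\<bar>P (corner f j)\<bar> = \<bar>P (src (side f i))\<bar>" if f: "f \<in> F" and i: "i < 4" and j: "j < 4" for f i j
    proof -
      have step: "\<bar>P (corner f k)\<bar> = \<bar>P (src (side f k))\<bar> \<and> \<bar>P (corner f (Suc k mod 4))\<bar> = \<bar>P (src (side f k))\<bar>" if "k < 4" for k
        using side_ends[OF f that] P[OF side_in[OF f that]]
        by (metis abs_minus_cancel doubleton_eq_iff)
      have all: "\<bar>P (src (side f k))\<bar> = \<bar>P (src (side f 0))\<bar>" if "k < 4" for k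
      proof -
        have "k = 0 \<or> k = 1 \<or> k = 2 \<or> k = 3" using that by linarith
        then show ?thesis using step[of 0] step[of 1] step[of 2] step[of 3] unfolding Suc_mod_4 by force
      qed
      show ?thesis using conjunct1[OF step[OF j]] unfolding all[OF i] all[OF j] .
    qed
    define m where "m = \<bar>P (corner f0 0)\<bar>"
    have "{f \<in> F. \<bar>P (corner f 0)\<bar> = m} = F"
    proof (rule face_connected)
      show "{f \<in> F. \<bar>P (corner f 0)\<bar> = m} \<noteq> {}" using f0 by (auto simp: m_def)
      fix f g i j assume fg: "f \<in> {f \<in> F. \<bar>P (corner f 0)\<bar> = m}" "g \<in> F" "i < 4" "j < 4" "side f i = side g j"
      then show "g \<in> {f \<in> F. \<bar>P (corner f 0)\<bar> = m}"
        using corner[of f i 0] corner[of g j 0] by simp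
    qed simp
    then have m: "\<bar>P (corner f 0)\<bar> = m" if "f \<in> F" for f using that by blast
    have Pm: "\<bar>P (src e)\<bar> = m" if e: "e \<in> E" for e
    proof -
      obtain f i where "f \<in> F" "i < 4" "side f i = e" using covered[OF e] by blast
      then show ?thesis using corner[of f i 0] m[of f] by simp
    qed
    have "\<exists>v\<in>V. P v \<noteq> 0"
    proof (rule ccontr)
      assume none: "\<not> ?thesis"
      have "x (Inl f) = 0" if "f \<in> F - {f0}" for f
        using c0[of f] that by (simp add: c_def)
      moreover have "x (Inr (Inl v)) = 0" if "v \<in> V" for v using none that by (simp add: P_def)
      moreover have "x (Inr (Inr ())) = 0" using \<open>l = 0\<close> by (simp add: l_def)
      ultimately have "\<forall>j\<in>I. x j = 0" unfolding I_def by fastforce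
      then show False using x by blast
    qed
    then obtain v where "v \<in> V" "P v \<noteq> 0" by blast
    then obtain e where "e \<in> E" "P (src e) \<noteq> 0" using P unfolding V_def by force
    then have "m \<noteq> 0" using Pm by force
    have "\<forall>e\<in>E. (P (src e) > 0) \<noteq> (P (trg e) > 0)"
    proof
      fix e assume "e \<in> E"
      then show "(P (src e) > 0) \<noteq> (P (trg e) > 0)" using P[of e] Pm[of e] \<open>m \<noteq> 0\<close> by auto
    qed
    then show False by (rule notE[OF nonbip, OF exI[of _ "\<lambda>v. 0 < P v"]])
  qed
  show ?thesis
  proof (intro exI[of _ "\<lambda>v. - P v / l"] ballI)
    fix e assume "e \<in> E"
    then show "s e = - P (src e) / l + - P (trg e) / l"
      using Pl[of e] \<open>l \<noteq> 0\<close> by (simp add: field_simps)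
  qed
qed

text \<open>\<open>a u v\<close> is a weight on the edge of the bipartite double cover from the copy
  of \<open>u\<close> in one class to the copy of \<open>v\<close> in the other; \<open>even\<close>
  and \<open>odd\<close> are the sums around the two lifts of a face, and \<open>p\<close>,
  \<open>q\<close> form a potential on the two classes. The antisymmetric part of \<open>a\<close>
  has a potential \<open>M\<close>, the symmetric part a twisted potential \<open>D\<close>, and
  half the sum and half the difference of \<open>M\<close> and \<open>D\<close> recombine
  them.\<close>

lemma double_cover_potential:
  fixes a :: "'v \<Rightarrow> 'v \<Rightarrow> rat"
  assumes nonbip: "\<nexists>b :: 'v \<Rightarrow> bool. \<forall>e\<in>E. b (src e) \<noteq> b (trg e)"
    and even: "\<And>f. f \<in> F \<Longrightarrow> a (corner f 0) (corner f 1) - a (corner f 2) (corner f 1)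
        + a (corner f 2) (corner f 3) - a (corner f 0) (corner f 3) = 0"
    and odd: "\<And>f. f \<in> F \<Longrightarrow> a (corner f 1) (corner f 2) - a (corner f 3) (corner f 2)
        + a (corner f 3) (corner f 0) - a (corner f 1) (corner f 0) = 0"
  shows "\<exists>p q. \<forall>v. \<forall>u\<in>nbr v. p u - q v = a u v"
proof -
  have cases: "src (side f i) = corner f i \<and> trg (side f i) = corner f (Suc i mod 4) \<or>
     src (side f i) \<noteq> corner f i \<and> src (side f i) = corner f (Suc i mod 4) \<and> trg (side f i) = corner f i"
    if "f \<in> F" "i < 4" for f i
    using side_ends[OF that] loopless[OF side_in[OF that]] by (metis doubleton_eq_iff)
  define w where "w e = a (trg e) (src e) - a (src e) (trg e)" for e
  define s where "s e = a (trg e) (src e) + a (src e) (trg e)" for e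
  have "(\<Sum>i<4. dir f i * w (side f i)) = 0" if f: "f \<in> F" for f
  proof -
    have "dir f i * w (side f i) = a (corner f (Suc i mod 4)) (corner f i) - a (corner f i) (corner f (Suc i mod 4))"
      if "i < 4" for i
      using cases[OF f that] unfolding dir_def w_def by (elim disjE) simp_all
    from this[of 0] this[of 1] this[of 2] this[of 3] even[OF f] odd[OF f]
    show ?thesis unfolding sum_lessThan_4 Suc_mod_4 by simp
  qed
  from rat_potential[OF this] obtain M where M: "\<And>e. e \<in> E \<Longrightarrow> w e = M (trg e) - M (src e)" by blast
  have "(\<Sum>i<4. alt f i * s (side f i)) = 0" if f: "f \<in> F" for f
  proof -
    have "s (side f i) = a (corner f (Suc i mod 4)) (corner f i) + a (corner f i) (corner f (Suc i mod 4))"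
      if "i < 4" for i
      using cases[OF f that] unfolding s_def by (elim disjE) simp_all
    from this[of 0] this[of 1] this[of 2] this[of 3] even[OF f] odd[OF f]
    show ?thesis unfolding sum_alt Suc_mod_4 by simp
  qed
  from twisted_potential[OF this nonbip] obtain D where D: "\<And>e. e \<in> E \<Longrightarrow> s e = D (src e) + D (trg e)" by blast
  have "(M u + D u) / 2 - (M v - D v) / 2 = a u v" if "u \<in> nbr v" for u v
  proof -
    obtain e where e: "e \<in> E" "{src e, trg e} = {v, u}" using \<open>u \<in> nbr v\<close> by (auto simp: nbr_def)
    then consider "src e = v" "trg e = u" | "src e = u" "trg e = v" by (meson doubleton_eq_iff)
    then show ?thesis
      using M[OF e(1)] D[OF e(1)] unfolding w_def s_def by cases (simp_all add: field_simps)
  qed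
  then show ?thesis
    by (intro exI[of "\<lambda>p. \<exists>q. \<forall>v. \<forall>u\<in>nbr v. p u - q v = a u v" "\<lambda>v. (M v + D v) / 2"]
        exI[of _ "\<lambda>v. (M v - D v) / 2"]) simp
qed

end

section \<open>Palettes of a coloring with the largest number of colors\<close>

context connected_quadrangular_complex begin

lemma corner_nbr:
  assumes "f \<in> F" "i < 4"
  shows "corner f (Suc i mod 4) \<in> nbr (corner f i)" "corner f i \<in> nbr (corner f (Suc i mod 4))"
proof -
  have "side f i \<in> E" "{src (side f i), trg (side f i)} = {corner f i, corner f (Suc i mod 4)}"
    using side_in side_ends assms by blast+
  then show "corner f (Suc i mod 4) \<in> nbr (corner f i)" unfolding nbr_def by blast
  then show "corner f i \<in> nbr (corner f (Suc i mod 4))" by (rule iffD1[OF nbr_sym])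
qed

lemma corner_nbrs:
  assumes "f \<in> F"
  shows "corner f 1 \<in> nbr (corner f 0)" "corner f 0 \<in> nbr (corner f 1)"
    "corner f 2 \<in> nbr (corner f 1)" "corner f 1 \<in> nbr (corner f 2)"
    "corner f 3 \<in> nbr (corner f 2)" "corner f 2 \<in> nbr (corner f 3)"
    "corner f 0 \<in> nbr (corner f 3)" "corner f 3 \<in> nbr (corner f 0)"
  using corner_nbr[OF assms, of 0] corner_nbr[OF assms, of 1] corner_nbr[OF assms, of 2] corner_nbr[OF assms, of 3]
  unfolding Suc_mod_4 by simp_all

definition local_3_coloring :: "('v \<Rightarrow> nat) \<Rightarrow> bool" where
  "local_3_coloring c \<longleftrightarrow> (\<forall>v. \<forall>u\<in>nbr v. c u \<noteq> c v) \<and> (\<forall>v. card (c ` nbr v) \<le> 2)"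

lemma palette_eq:
  assumes "local_3_coloring c" "u \<in> nbr v" "t \<in> nbr v" "c u \<noteq> c t"
  shows "c ` nbr v = {c u, c t}"
proof (rule sym, rule card_seteq)
  show "finite (c ` nbr v)" using finite_nbr by simp
  show "{c u, c t} \<subseteq> c ` nbr v" using assms by blast
  show "card (c ` nbr v) \<le> card {c u, c t}"
    using assms unfolding local_3_coloring_def by (simp add: numeral_2_eq_2)
qed

text \<open>If a two-element palette were not a bridge, the potential counting the moves between its two
  colors would split a color class, contradicting maximality.\<close>

lemma palette_bridge:
  assumes nonbip: "\<nexists>b :: 'v \<Rightarrow> bool. \<forall>e\<in>E. b (src e) \<noteq> b (trg e)"
    and c: "local_3_coloring c"
    and max: "\<forall>d. local_3_coloring d \<longrightarrow> card (d ` V) \<le> card (c ` V)"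
  shows "\<exists>l :: nat \<Rightarrow> rat. \<forall>v. \<forall>u\<in>nbr v. \<forall>t\<in>nbr v. l (c u) - l (c t) =
    (if c ` nbr v = {y, z} \<and> c u = y then 1 else 0) - (if c ` nbr v = {y, z} \<and> c t = y then 1 else 0)"
proof -
  define a :: "'v \<Rightarrow> 'v \<Rightarrow> rat" where "a u v = (if c ` nbr v = {y, z} \<and> c u = y then 1 else 0)" for u v
  \<comment> \<open>If \<open>u\<close> and \<open>t\<close> have different colors, these two colors
    are the whole palette of both common neighbours \<open>v\<close> and \<open>w\<close>, so the
    contributions cancel.\<close>
  have opp: "a u v - a t v + a t w - a u w = 0"
    if "u \<in> nbr v" "t \<in> nbr v" "u \<in> nbr w" "t \<in> nbr w" for u t v w
  proof (cases "c u = c t")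
    case True
    then show ?thesis by (simp add: a_def)
  next
    case False
    then have "c ` nbr v = c ` nbr w" using palette_eq[OF c] that by metis
    then show ?thesis by (simp add: a_def)
  qed
  have "\<exists>p q. \<forall>v. \<forall>u\<in>nbr v. p u - q v = a u v"
  proof (rule double_cover_potential[OF nonbip])
    fix f assume f: "f \<in> F"
    note n = corner_nbrs[OF f]
    show "a (corner f 0) (corner f 1) - a (corner f 2) (corner f 1)
        + a (corner f 2) (corner f 3) - a (corner f 0) (corner f 3) = 0"
      by (rule opp[OF n(2,3,7,6)])
    show "a (corner f 1) (corner f 2) - a (corner f 3) (corner f 2)
        + a (corner f 3) (corner f 0) - a (corner f 1) (corner f 0) = 0"
      by (rule opp[OF n(4,5,1,8)])
  qed
  then obtain p q where pq: "\<forall>v. \<forall>u\<in>nbr v. p u - q v = a u v" by (elim exE)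
  \<comment> \<open>Colors are refined by \<open>p\<close>. Around \<open>v\<close> the value of
    \<open>p\<close> is \<open>q v + a u v\<close>, which depends on the color of \<open>u\<close>
    only, so no neighbourhood gains colors.\<close>
  define d where "d v = to_nat (c v, p v)" for v
  have "local_3_coloring d"
    unfolding local_3_coloring_def
  proof (intro conjI allI ballI)
    fix v u assume "u \<in> nbr v"
    then show "d u \<noteq> d v" using c unfolding local_3_coloring_def d_def by simp
  next
    fix v
    define h where "h k = to_nat (k, q v + (if c ` nbr v = {y, z} \<and> k = y then 1 else 0))" for k
    have "d u = h (c u)" if "u \<in> nbr v" for u
    proof -
      have "p u = q v + a u v" using pq that by (simp add: algebra_simps)
      then show ?thesis unfolding d_def h_def a_def by simp
    qed
    then have "d ` nbr v = h ` c ` nbr v" unfolding image_image by (rule image_cong[OF refl])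
    then have "card (d ` nbr v) \<le> card (c ` nbr v)" using finite_nbr card_image_le by (metis finite_imageI)
    also have "\<dots> \<le> 2" using c unfolding local_3_coloring_def by blast
    finally show "card (d ` nbr v) \<le> 2" .
  qed
  \<comment> \<open>By maximality the refinement splits no color class: \<open>p\<close> is a
    function of the color.\<close>
  then have le: "card (d ` V) \<le> card (c ` V)" using max by blast
  let ?g = "\<lambda>n. fst (from_nat n :: nat \<times> rat)"
  have img: "?g ` d ` V = c ` V" unfolding image_image d_def by simp
  have "inj_on ?g (d ` V)"
  proof (rule eq_card_imp_inj_on)
    show fin: "finite (d ` V)" using finite_V by simp
    show "card (?g ` d ` V) = card (d ` V)"
      using card_image_le[OF fin, of ?g] le unfolding img by simp
  qed
  then have same: "p u = p v" if "u \<in> V" "v \<in> V" "c u = c v" for u v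
  proof -
    have "?g (d u) = ?g (d v)" using that by (simp add: d_def)
    then have "d u = d v" using \<open>inj_on ?g (d ` V)\<close> that by (meson imageI inj_onD)
    then show ?thesis by (simp add: d_def)
  qed
  define l where "l k = p (SOME u. u \<in> V \<and> c u = k)" for k
  have l: "l (c u) = p u" if "u \<in> V" for u
  proof -
    have "(SOME t. t \<in> V \<and> c t = c u) \<in> V \<and> c (SOME t. t \<in> V \<and> c t = c u) = c u"
      by (rule someI[of "\<lambda>t. t \<in> V \<and> c t = c u" u]) (use that in simp)
    then show ?thesis unfolding l_def using that by (intro same) auto
  qed
  have "l (c u) - l (c t) = a u v - a t v" if "u \<in> nbr v" "t \<in> nbr v" for u t v
  proof -
    have "u \<in> V" "t \<in> V" using that nbr_subset unfolding V_def by blast+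
    moreover have "p u - q v = a u v" "p t - q v = a t v" using pq that by blast+
    ultimately show ?thesis using l by simp
  qed
  then show ?thesis unfolding a_def by (intro exI[of _ l] allI ballI)
qed

text \<open>Four cyclic signs fail to cancel only if three consecutive ones agree. The eight
  excluded chains are these cases, four starting points in two directions, and in each of them the
  pair \<open>k0\<close>, \<open>k2\<close> crosses the pair \<open>k1\<close>,
  \<open>k3\<close>.\<close>

lemma sum_sgn_cycle:
  assumes "k0 \<noteq> k1" "k1 \<noteq> k2" "k2 \<noteq> k3" "k3 \<noteq> (k0::int)"
    and "k0 = k2 \<or> k1 = k3 \<or>
      \<not> (k0 < k1 \<and> k1 < k2 \<and> k2 < k3) \<and> \<not> (k2 < k3 \<and> k3 < k0 \<and> k0 < k1) \<and>
      \<not> (k0 < k3 \<and> k3 < k2 \<and> k2 < k1) \<and> \<not> (k2 < k1 \<and> k1 < k0 \<and> k0 < k3) \<and>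
      \<not> (k1 < k2 \<and> k2 < k3 \<and> k3 < k0) \<and> \<not> (k3 < k0 \<and> k0 < k1 \<and> k1 < k2) \<and>
      \<not> (k1 < k0 \<and> k0 < k3 \<and> k3 < k2) \<and> \<not> (k3 < k2 \<and> k2 < k1 \<and> k1 < k0)"
  shows "sgn (k1 - k0) + sgn (k2 - k1) + sgn (k3 - k2) + sgn (k0 - k3) = 0"
proof -
  have "k0 < k1 \<or> k1 < k0" "k1 < k2 \<or> k2 < k1" "k2 < k3 \<or> k3 < k2" "k3 < k0 \<or> k0 < k3"
    using assms(1-4) by linarith+
  then show ?thesis
    by (elim disjE; insert assms(5); simp)
qed

theorem bipartite_if_local_3_coloring:
  assumes "local_3_coloring c0"
  shows "\<exists>b :: 'v \<Rightarrow> bool. \<forall>e\<in>E. b (src e) \<noteq> b (trg e)"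
proof (rule ccontr)
  assume nonbip: "\<not> ?thesis"
  have "\<forall>d. local_3_coloring d \<longrightarrow> card (d ` V) < Suc (card V)"
    by (intro allI impI le_imp_less_Suc card_image_le finite_V)
  from ex_has_greatest_nat[of local_3_coloring c0 "\<lambda>d. card (d ` V)", OF assms this]
  obtain c where c: "local_3_coloring c" and max: "\<forall>d. local_3_coloring d \<longrightarrow> card (d ` V) \<le> card (c ` V)"
    by blast
  define G where "G = {A. \<exists>v. A = c ` nbr v \<and> card A = 2}"
  have inG: "{c u, c t} \<in> G" if "u \<in> nbr v" "t \<in> nbr v" "c u \<noteq> c t" for u t v
  proof -
    have "{c u, c t} = c ` nbr v" using palette_eq[OF c that] by (rule sym)
    moreover have "card {c u, c t} = 2" using that(3) by simp
    ultimately show ?thesis unfolding G_def by blast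
  qed
  have GV: "A \<subseteq> c ` V \<and> card A = 2" if "A \<in> G" for A
    using that nbr_subset unfolding G_def V_def by blast
  have finS: "finite (c ` V)" using finite_V by simp
  have "G \<subseteq> Pow (c ` V)" using GV by blast
  then have finG: "finite G" using finS by (meson finite_Pow_iff finite_subset)
  have bridge: "\<exists>l :: nat \<Rightarrow> rat. (\<forall>B\<in>G - {A}. \<forall>x\<in>B. \<forall>y\<in>B. l x = l y) \<and> \<not> (\<forall>x\<in>A. \<forall>y\<in>A. l x = l y)"
    if A: "A \<in> G" for A
  proof -
    obtain y z where yz: "A = {y, z}" "y \<noteq> z" using GV[OF A] by (meson card_2_iff)
    obtain l :: "nat \<Rightarrow> rat" where l: "\<forall>v. \<forall>u\<in>nbr v. \<forall>t\<in>nbr v. l (c u) - l (c t) =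
      (if c ` nbr v = {y, z} \<and> c u = y then 1 else 0) - (if c ` nbr v = {y, z} \<and> c t = y then 1 else 0)"
      using palette_bridge[OF nonbip c max, of y z] by (elim exE)
    have "l j = l k" if B: "B \<in> G" "B \<noteq> A" "j \<in> B" "k \<in> B" for B j k
    proof -
      obtain v where v: "B = c ` nbr v" using \<open>B \<in> G\<close> unfolding G_def by blast
      then obtain u t where "u \<in> nbr v" "t \<in> nbr v" "j = c u" "k = c t" using B by blast
      then show ?thesis using bspec[OF bspec[OF spec[OF l, of v], of u], of t] B v yz by simp
    qed
    moreover have "l y \<noteq> l z"
    proof -
      obtain v where v: "A = c ` nbr v" using A unfolding G_def by blast
      then obtain u t where ut: "u \<in> nbr v" "t \<in> nbr v" "y = c u" "z = c t" using yz by blast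
      have "l (c u) - l (c t) = 1 - 0"
        using bspec[OF bspec[OF spec[OF l] ut(1)] ut(2)] ut v yz by auto
      then show ?thesis using ut by simp
    qed
    ultimately show ?thesis using yz by (intro exI[of _ l] conjI ballI) auto
  qed
  obtain f0 where f0: "f0 \<in> F" using faces_nonempty by blast
  then have r: "c (corner f0 0) \<in> c ` V" using corner_in_V by simp
  have "\<exists>C :: nat \<Rightarrow> nat. inj_on C (c ` V) \<and> (\<forall>s\<in>c ` V. C (c (corner f0 0)) \<le> C s) \<and>
      (\<forall>p q u v. {p, q} \<in> G \<longrightarrow> {u, v} \<in> G \<longrightarrow> \<not> (C p < C u \<and> C u < C q \<and> C q < C v))"
    by (rule noncrossing_order_of_forest[OF finS finG GV bridge r])
  then obtain C :: "nat \<Rightarrow> nat" where C: "inj_on C (c ` V)"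
    and nc: "\<forall>p q u v. {p, q} \<in> G \<longrightarrow> {u, v} \<in> G \<longrightarrow> \<not> (C p < C u \<and> C u < C q \<and> C q < C v)"
    by (elim exE conjE) (rule that)
  define k where "k v = int (C (c v))" for v
  have kne: "k u \<noteq> k v" if "u \<in> nbr v" for u v
  proof -
    have "u \<in> V" "v \<in> V" using that iffD1[OF nbr_sym that] nbr_subset unfolding V_def by blast+
    moreover have "c u \<noteq> c v" using c that unfolding local_3_coloring_def by blast
    ultimately show ?thesis using C unfolding k_def by (auto dest: inj_onD)
  qed
  have ncr: "\<not> (k p < k u \<and> k u < k q \<and> k q < k v)" if "{c p, c q} \<in> G" "{c u, c v} \<in> G" for p q u v
    using nc that unfolding k_def by simp
  define w where "w e = sgn (k (trg e) - k (src e))" for e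
  have "\<exists>p. \<forall>e\<in>E. w e = p (trg e) - p (src e)"
  proof (rule int_potential)
    fix f assume f: "f \<in> F"
    note n = corner_nbrs[OF f]
    have w: "(if src (side f i) = corner f i then w (side f i) else - w (side f i)) =
        sgn (k (corner f (Suc i mod 4)) - k (corner f i))" if i: "i < 4" for i
    proof -
      consider "src (side f i) = corner f i" "trg (side f i) = corner f (Suc i mod 4)"
        | "src (side f i) \<noteq> corner f i" "src (side f i) = corner f (Suc i mod 4)" "trg (side f i) = corner f i"
        using side_ends[OF f i] loopless[OF side_in[OF f i]] by (metis doubleton_eq_iff)
      then show ?thesis
      proof cases
        case 1
        show ?thesis unfolding if_P[OF 1(1)] w_def unfolding 1 ..
      next
        case 2
        have "- sgn (r - t) = sgn (t - r)" for r t :: int by (simp add: sgn_if)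
        then show ?thesis unfolding if_not_P[OF 2(1)] w_def unfolding 2(2,3) .
      qed
    qed
    let ?v = "corner f"
    \<comment> \<open>Opposite corners share a neighbour, so they have the same color or their
      colors form a pair in \<open>G\<close>.\<close>
    have "k (?v 0) = k (?v 2) \<or> k (?v 1) = k (?v 3) \<or> {c (?v 0), c (?v 2)} \<in> G \<and> {c (?v 1), c (?v 3)} \<in> G"
    proof -
      have "{c (?v 0), c (?v 2)} \<in> G" if "c (?v 0) \<noteq> c (?v 2)" using n(2,3) that by (rule inG)
      moreover have "{c (?v 1), c (?v 3)} \<in> G" if "c (?v 1) \<noteq> c (?v 3)" using n(4,5) that by (rule inG)
      ultimately show ?thesis unfolding k_def by metis
    qed
    then have "sgn (k (?v 1) - k (?v 0)) + sgn (k (?v 2) - k (?v 1)) + sgn (k (?v 3) - k (?v 2)) + sgn (k (?v 0) - k (?v 3)) = 0"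
    proof (elim disjE conjE)
      assume "{c (?v 0), c (?v 2)} \<in> G" "{c (?v 1), c (?v 3)} \<in> G"
      moreover from this have "{c (?v 2), c (?v 0)} \<in> G" "{c (?v 3), c (?v 1)} \<in> G"
        by (simp_all add: insert_commute)
      ultimately show ?thesis
        by (intro sum_sgn_cycle disjI2 conjI ncr) (use kne n in auto)
    qed (intro sum_sgn_cycle; use kne n in auto)+
    then show "(\<Sum>i<4. if src (side f i) = corner f i then w (side f i) else - w (side f i)) = 0"
      unfolding sum_lessThan_4 using w[of 0] w[of 1] w[of 2] w[of 3] unfolding Suc_mod_4 by simp
  qed
  then obtain p where p: "\<forall>e\<in>E. w e = p (trg e) - p (src e)" by blast
  have "\<forall>e\<in>E. even (p (src e)) \<noteq> even (p (trg e))"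
  proof
    fix e assume e: "e \<in> E"
    then have "trg e \<in> nbr (src e)" unfolding nbr_def by blast
    then have "w e = 1 \<or> w e = - 1" using kne[of "trg e" "src e"] unfolding w_def by (simp add: sgn_if)
    moreover have "p (trg e) = p (src e) + w e" using p e by simp
    ultimately show "even (p (src e)) \<noteq> even (p (trg e))" by (elim disjE) simp_all
  qed
  then show False by (rule notE[OF nonbip, OF exI[of _ "\<lambda>v. even (p v)"]])
qed

end

section \<open>Topology of the projective plane\<close>

lemma antipodal_pair_eq_iff: "antipodal_pair x = antipodal_pair y \<longleftrightarrow> y = x \<or> y = - x"
  unfolding antipodal_pair_def by (auto simp: doubleton_eq_iff)

text \<open>The choice of a representative is arbitrary; it is used only inside expressions that do
  not change under a change of sign, and these descend continuously.\<close>

definition rep :: "(real ^ 3) set \<Rightarrow> real ^ 3" where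
  "rep A = (SOME x. x \<in> A)"

lemma rep_antipodal_pair: "rep (antipodal_pair x) = x \<or> rep (antipodal_pair x) = - x"
proof -
  have "rep (antipodal_pair x) \<in> antipodal_pair x"
    unfolding rep_def by (rule someI[of _ x]) (simp add: antipodal_pair_def)
  then show ?thesis by (simp add: antipodal_pair_def)
qed

lemma continuous_map_from_projective_plane:
  assumes "continuous_on (sphere 0 1) h" "\<And>x. x \<in> sphere 0 1 \<Longrightarrow> g (antipodal_pair x) = h x"
  shows "continuous_map projective_plane euclidean g"
proof (rule continuous_compose_quotient_map[OF quotient_map_antipodal_pair])
  have "continuous_on (sphere 0 1) (g \<circ> antipodal_pair)"
    by (rule continuous_on_eq[OF assms(1)]) (simp add: assms(2))
  then show "continuous_map (top_of_set (sphere 0 1)) euclidean (g \<circ> antipodal_pair)" by simp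
qed

text \<open>The Veronese map, which sends \<open>x\<close> to the matrix of products of its
  coordinates, is continuous and determines \<open>x\<close> up to sign.\<close>

lemma Hausdorff_projective_plane: "Hausdorff_space projective_plane"
proof (rule Hausdorff_space_injective_preimage)
  define h :: "(real ^ 3) set \<Rightarrow> real ^ 3 ^ 3" where "h A = (\<chi> i j. rep A $ i * rep A $ j)" for A
  have h: "h (antipodal_pair x) = (\<chi> i j. x $ i * x $ j)" for x
    using rep_antipodal_pair[of x] unfolding h_def by auto
  show "continuous_map projective_plane euclidean h"
    by (rule continuous_map_from_projective_plane[where h = "\<lambda>x. \<chi> i j. x $ i * x $ j"])
      (auto simp: h intro!: continuous_intros)
  show "inj_on h (topspace projective_plane)"
  proof (rule inj_onI)
    fix A B assume A: "A \<in> topspace projective_plane" and B: "B \<in> topspace projective_plane" and eq: "h A = h B"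
    obtain x where x: "A = antipodal_pair x" "norm x = 1" using A by (auto simp: topspace_projective_plane)
    obtain y where y: "B = antipodal_pair y" using B by (auto simp: topspace_projective_plane)
    have xy: "x $ i * x $ j = y $ i * y $ j" for i j
      using eq unfolding x(1) y h by (simp add: vec_eq_iff)
    have "x \<noteq> 0" using x(2) by auto
    then obtain i where i: "x $ i \<noteq> 0" by (auto simp: vec_eq_iff)
    have "(x $ i)\<^sup>2 = (y $ i)\<^sup>2" using xy[of i i] by (simp add: power2_eq_square)
    then have "y $ i = x $ i \<or> y $ i = - x $ i" by (auto simp: power2_eq_iff)
    then have "y = x \<or> y = - x"
    proof
      assume "y $ i = x $ i"
      then have "y $ j = x $ j" for j using xy[of i j] i by simp
      then show ?thesis by (simp add: vec_eq_iff)
    next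
      assume "y $ i = - x $ i"
      then have "y $ j = - x $ j" for j using xy[of i j] i
        by (metis minus_mult_commute minus_minus mult_cancel_left neg_equal_0_iff_equal)
      then show ?thesis by (simp add: vec_eq_iff)
    qed
    then show "A = B" unfolding x(1) y antipodal_pair_eq_iff by blast
  qed
qed simp

text \<open>Projection from one of the removed points leads to the plane, which stays connected
  without a countable set.\<close>

lemma connected_sphere_diff_finite:
  assumes "finite T"
  shows "connected (sphere (0 :: real ^ 3) 1 - T)"
proof (cases "sphere (0 :: real ^ 3) 1 \<inter> T = {}")
  case True
  then have "sphere (0 :: real ^ 3) 1 - T = sphere 0 1" by blast
  then show ?thesis using connected_sphere[of "0 :: real ^ 3" 1] by simp
next
  case False
  then obtain b where b: "b \<in> sphere (0 :: real ^ 3) 1" "b \<in> T" by blast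
  have "(sphere (0 :: real ^ 3) 1 - {b}) homeomorphic (UNIV :: (real ^ 2) set)"
    by (rule homeomorphic_punctured_sphere_affine) (use b in auto)
  then obtain f g where fg: "homeomorphism (sphere (0 :: real ^ 3) 1 - {b}) (UNIV :: (real ^ 2) set) f g"
    by (auto simp: homeomorphic_def)
  have gf: "g (f x) = x" if "x \<in> sphere 0 1 - {b}" for x using fg that unfolding homeomorphism_def by blast
  have fg': "f (g y) = y" for y using fg unfolding homeomorphism_def by blast
  have gim: "g y \<in> sphere 0 1 - {b}" for y using fg unfolding homeomorphism_def by blast
  have "continuous_on UNIV g" using fg unfolding homeomorphism_def by blast
  define T' where "T' = T \<inter> (sphere 0 1 - {b})"
  have "countable (f ` T')" using assms unfolding T'_def by (intro countable_finite) blast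
  then have "connected (UNIV - f ` T')"
    by (intro connected_open_diff_countable open_UNIV connected_UNIV) simp
  moreover have "continuous_on (UNIV - f ` T') g"
    using \<open>continuous_on UNIV g\<close> by (rule continuous_on_subset) simp
  ultimately have "connected (g ` (UNIV - f ` T'))" by (intro connected_continuous_image)
  moreover have "g ` (UNIV - f ` T') = sphere 0 1 - T"
  proof
    show "g ` (UNIV - f ` T') \<subseteq> sphere 0 1 - T"
    proof
      fix x assume "x \<in> g ` (UNIV - f ` T')"
      then obtain y where y: "x = g y" "y \<notin> f ` T'" by blast
      have "g y \<notin> T'" using y(2) fg' by (metis imageI)
      then show "x \<in> sphere 0 1 - T" using gim[of y] unfolding y(1) T'_def by blast
    qed
    show "sphere 0 1 - T \<subseteq> g ` (UNIV - f ` T')"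
    proof
      fix x assume x: "x \<in> sphere (0 :: real ^ 3) 1 - T"
      then have x': "x \<in> sphere 0 1 - {b}" using b by blast
      have "f x \<notin> f ` T'"
      proof
        assume "f x \<in> f ` T'"
        then obtain t where t: "f x = f t" "t \<in> T'" by (rule imageE)
        then have "x = t" using gf[OF x'] gf[of t] unfolding T'_def by (metis IntD2)
        then show False using x t(2) unfolding T'_def by simp
      qed
      then have "f x \<in> UNIV - f ` T'" by simp
      from imageI[OF this, of g] show "x \<in> g ` (UNIV - f ` T')" unfolding gf[OF x'] .
    qed
  qed
  ultimately show ?thesis by simp
qed

lemma connectedin_projective_plane_diff_finite:
  assumes "finite S"
  shows "connectedin projective_plane (topspace projective_plane - S)"
proof -
  define T where "T = {x \<in> sphere (0 :: real ^ 3) 1. antipodal_pair x \<in> S}"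
  have "T \<subseteq> \<Union> {A \<in> S. finite A}"
  proof
    fix x assume "x \<in> T"
    then show "x \<in> \<Union> {A \<in> S. finite A}"
      unfolding T_def by (intro UnionI[of "antipodal_pair x"]) (auto simp: antipodal_pair_def)
  qed
  moreover have "finite (\<Union> {A \<in> S. finite A})" using assms by (intro finite_Union) auto
  ultimately have "finite T" by (rule finite_subset)
  then have "connectedin (top_of_set (sphere 0 1)) (sphere 0 1 - T)"
    by (simp add: connectedin_subtopology connected_sphere_diff_finite)
  moreover have "continuous_map (top_of_set (sphere 0 1)) projective_plane antipodal_pair"
    by (rule quotient_imp_continuous_map[OF quotient_map_antipodal_pair])
  ultimately have "connectedin projective_plane (antipodal_pair ` (sphere 0 1 - T))"
    by (metis connectedin_continuous_map_image)
  moreover have "antipodal_pair ` (sphere 0 1 - T) = topspace projective_plane - S"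
    unfolding T_def topspace_projective_plane by auto
  ultimately show ?thesis by simp
qed

section \<open>Continuous logarithms on the projective plane\<close>

lemma norm_ge_1_if_exp_eq_1:
  assumes "exp z = 1" "z \<noteq> (0 :: complex)"
  shows "norm z \<ge> 1"
proof -
  obtain n :: int where n: "Re z = 0" "Im z = of_int (2 * n) * pi" using assms(1) by (auto simp: exp_eq_1)
  have "n \<noteq> 0" using n assms(2) by (auto simp: complex_eq_iff)
  then have "\<bar>real_of_int (2 * n)\<bar> \<ge> 2" by simp
  then have "1 * 1 \<le> \<bar>real_of_int (2 * n)\<bar> * \<bar>pi\<bar>" using pi_ge_two by (intro mult_mono) auto
  also have "\<dots> = \<bar>Im z\<bar>" using n by (simp add: abs_mult)
  also have "\<dots> \<le> norm z" by (rule abs_Im_le_cmod)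
  finally show ?thesis by simp
qed

text \<open>The values of \<open>k\<close> are integral multiples of 2 pi i, a set whose points keep
  distance at least 1.\<close>

lemma constant_on_if_exp_eq_1:
  fixes k :: "'a::topological_space \<Rightarrow> complex"
  assumes "connected S" "continuous_on S k" "\<And>x. x \<in> S \<Longrightarrow> exp (k x) = 1" "x \<in> S" "y \<in> S"
  shows "k x = k y"
proof -
  have "k constant_on S"
  proof (rule continuous_discrete_range_constant[OF assms(1,2)])
    fix x assume x: "x \<in> S"
    have "1 \<le> norm (k y - k x)" if "y \<in> S" "k y \<noteq> k x" for y
      by (rule norm_ge_1_if_exp_eq_1) (use that x assms(3) in \<open>auto simp: exp_diff\<close>)
    then show "\<exists>e>0. \<forall>y. y \<in> S \<and> k y \<noteq> k x \<longrightarrow> e \<le> norm (k y - k x)"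
      by (intro exI[of _ 1]) auto
  qed
  then show ?thesis using assms(4,5) unfolding constant_on_def by metis
qed

text \<open>A logarithm \<open>h\<close> exists on the sphere. The defect
  \<open>h (- x) - h x\<close> takes discrete values, hence is constant; being odd in
  \<open>x\<close> it is zero, so \<open>h\<close> descends to antipodal pairs.\<close>

lemma continuous_logarithm_projective_plane:
  assumes g: "continuous_map projective_plane euclidean g"
    and nz: "\<And>A. A \<in> topspace projective_plane \<Longrightarrow> g A \<noteq> (0 :: complex)"
  obtains l where "continuous_map projective_plane euclidean l"
    "\<And>A. A \<in> topspace projective_plane \<Longrightarrow> g A = exp (l A)"
proof -
  let ?S = "sphere (0 :: real ^ 3) 1"
  have "continuous_map (top_of_set ?S) euclidean (g \<circ> antipodal_pair)"
    using continuous_map_compose[OF quotient_imp_continuous_map[OF quotient_map_antipodal_pair] g] .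
  then have cont: "continuous_on ?S (g \<circ> antipodal_pair)" by simp
  have "g (antipodal_pair x) \<noteq> 0" if "x \<in> ?S" for x
    using nz that by (simp add: topspace_projective_plane)
  then have "(g \<circ> antipodal_pair) \<in> ?S \<rightarrow> - {0}" by auto
  moreover have "Borsukian ?S" by (rule Borsukian_sphere) simp
  ultimately obtain h where h: "continuous_on ?S h" "\<And>x. x \<in> ?S \<Longrightarrow> g (antipodal_pair x) = exp (h x)"
    using cont unfolding Borsukian_continuous_logarithm by (metis comp_apply)
  define k where "k x = h (- x) - h x" for x
  have ck: "continuous_on ?S k"
  proof -
    have "continuous_on ?S (h \<circ> uminus)"
      by (intro continuous_on_compose continuous_intros) (use h(1) in \<open>auto intro: continuous_on_subset\<close>)
    then show ?thesis unfolding k_def using h(1) by (auto simp: o_def intro: continuous_on_diff)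
  qed
  have exp1: "exp (k x) = 1" if "x \<in> ?S" for x
  proof -
    have "exp (h (- x)) = g (antipodal_pair (- x))" using h(2)[of "- x"] that by simp
    also have "antipodal_pair (- x) = antipodal_pair x" by (simp add: antipodal_pair_eq_iff)
    also have "g (antipodal_pair x) = exp (h x)" using h(2) that by simp
    finally show ?thesis unfolding k_def exp_diff by simp
  qed
  have "connected ?S" by (rule connected_sphere) simp
  then have kc: "k x = k y" if "x \<in> ?S" "y \<in> ?S" for x y
    using ck exp1 that by (rule constant_on_if_exp_eq_1)
  have k0: "h (- x) = h x" if "x \<in> ?S" for x
  proof -
    have "k x = k (- x)" using that by (intro kc) auto
    then show ?thesis unfolding k_def by simp
  qed
  have l: "h (rep (antipodal_pair x)) = h x" if "x \<in> ?S" for x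
    using rep_antipodal_pair[of x] k0[OF that] by auto
  show ?thesis
  proof (rule that[of "\<lambda>A. h (rep A)"])
    show "continuous_map projective_plane euclidean (\<lambda>A. h (rep A))"
      by (rule continuous_map_from_projective_plane[OF h(1)]) (rule l)
    show "g A = exp (h (rep A))" if A: "A \<in> topspace projective_plane" for A
    proof -
      obtain x where x: "A = antipodal_pair x" "x \<in> ?S" using A unfolding topspace_projective_plane by blast
      show ?thesis using h(2)[OF x(2)] l[OF x(2)] x(1) by simp
    qed
  qed
qed

text \<open>The affine chart with nonvanishing coordinate \<open>k\<close>. Ratios of coordinates
  are insensitive to the sign and determine the line through \<open>x\<close>, on which only the two
  unit vectors of the pair lie.\<close>

lemma chart_projective_plane:
  fixes k i j :: 3
  assumes kij: "UNIV = {k, i, j}"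
  defines "D \<equiv> {A \<in> topspace projective_plane. rep A $ k \<noteq> 0}"
    and "h \<equiv> \<lambda>A. (rep A $ i / rep A $ k, rep A $ j / rep A $ k)"
  shows "openin projective_plane D" "continuous_map (subtopology projective_plane D) euclidean h" "inj_on h D"
proof -
  let ?S = "sphere (0 :: real ^ 3) 1"
  have D: "antipodal_pair x \<in> D \<longleftrightarrow> x $ k \<noteq> 0" if "x \<in> ?S" for x
    using rep_antipodal_pair[of x] that unfolding D_def topspace_projective_plane by auto
  have h: "h (antipodal_pair x) = (x $ i / x $ k, x $ j / x $ k)" for x
    using rep_antipodal_pair[of x] unfolding h_def by auto
  have pre: "{x \<in> ?S. antipodal_pair x \<in> D} = ?S \<inter> {x. x $ k \<noteq> 0}"
    using D by auto
  have "open {x :: real ^ 3. x $ k \<noteq> 0}"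
    by (rule open_Collect_neq) (intro continuous_intros)+
  then have "openin (top_of_set ?S) (?S \<inter> {x. x $ k \<noteq> 0})" by (rule openin_open_Int)
  then show op: "openin projective_plane D"
    unfolding openin_projective_plane pre by (auto simp: D_def topspace_projective_plane)
  have "quotient_map (subtopology (top_of_set ?S) (?S \<inter> {x. x $ k \<noteq> 0})) (subtopology projective_plane D) antipodal_pair"
    by (rule quotient_map_restriction[OF quotient_map_antipodal_pair]) (use pre op in auto)
  then have q: "quotient_map (top_of_set (?S \<inter> {x. x $ k \<noteq> 0})) (subtopology projective_plane D) antipodal_pair"
    by (simp add: subtopology_subtopology Int_assoc[symmetric])
  have "continuous_on (?S \<inter> {x. x $ k \<noteq> 0}) (h \<circ> antipodal_pair)"
    unfolding o_def h by (intro continuous_intros) auto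
  then have "continuous_map (top_of_set (?S \<inter> {x. x $ k \<noteq> 0})) euclidean (h \<circ> antipodal_pair)" by simp
  then show "continuous_map (subtopology projective_plane D) euclidean h"
    by (rule continuous_compose_quotient_map[OF q])
  show "inj_on h D"
  proof (rule inj_onI)
    fix A B assume A: "A \<in> D" and B: "B \<in> D" and eq: "h A = h B"
    obtain x where x: "A = antipodal_pair x" "x \<in> ?S" using A by (auto simp: D_def topspace_projective_plane)
    obtain y where y: "B = antipodal_pair y" "y \<in> ?S" using B by (auto simp: D_def topspace_projective_plane)
    have nz: "x $ k \<noteq> 0" "y $ k \<noteq> 0" using A B D x y by auto
    have e: "x $ i / x $ k = y $ i / y $ k" "x $ j / x $ k = y $ j / y $ k"
      using eq unfolding x(1) y(1) h by auto
    define t where "t = y $ k / x $ k"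
    have "y $ m = t * x $ m" for m
    proof -
      have "m = k \<or> m = i \<or> m = j" using kij by blast
      then show ?thesis using e nz unfolding t_def by (auto simp: field_simps)
    qed
    then have yt: "y = t *\<^sub>R x" by (simp add: vec_eq_iff)
    then have "norm y = \<bar>t\<bar> * norm x" by simp
    then have "\<bar>t\<bar> = 1" using x(2) y(2) by simp
    then have "y = x \<or> y = - x" using yt by (auto simp: abs_if split: if_splits)
    then show "A = B" unfolding x(1) y(1) antipodal_pair_eq_iff by blast
  qed
qed

text \<open>Openness is checked in the three affine charts, where invariance of domain in the plane
  applies.\<close>

lemma invariance_of_domain_projective_plane:
  fixes f :: "real \<times> real \<Rightarrow> (real ^ 3) set"
  assumes U: "open U" and f: "continuous_map (top_of_set U) projective_plane f" and inj: "inj_on f U"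
  shows "openin projective_plane (f ` U)"
proof -
  have part: "openin projective_plane (f ` U \<inter> {A \<in> topspace projective_plane. rep A $ k \<noteq> 0})"
    if kij: "UNIV = {k, i, j}" for k i j :: 3
  proof -
    define D where "D = {A \<in> topspace projective_plane. rep A $ k \<noteq> 0}"
    define h where "h = (\<lambda>A. (rep A $ i / rep A $ k, rep A $ j / rep A $ k))"
    note ch = chart_projective_plane[OF kij, folded D_def h_def]
    define U' where "U' = {u \<in> U. f u \<in> D}"
    have "openin (top_of_set U) U'"
      using openin_continuous_map_preimage[OF f ch(1)] by (simp add: U'_def)
    then have "open U'" using U by (metis openin_open_eq)
    have "continuous_map (top_of_set U') (subtopology projective_plane D) f"
      using continuous_map_from_subtopology[OF f, of U']
      by (auto simp: continuous_map_in_subtopology subtopology_subtopology U'_def Int_absorb1)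
    from continuous_map_compose[OF this ch(2)] have "continuous_on U' (h \<circ> f)" by simp
    moreover have "inj_on (h \<circ> f) U'"
      using inj ch(3) by (intro comp_inj_on) (auto simp: U'_def inj_on_def)
    ultimately have W: "open ((h \<circ> f) ` U')" using \<open>open U'\<close> by (metis invariance_of_domain)
    have "openin (subtopology projective_plane D) {A \<in> topspace (subtopology projective_plane D). h A \<in> (h \<circ> f) ` U'}"
      by (rule openin_continuous_map_preimage[OF ch(2)]) (use W in simp)
    then have "openin projective_plane {A \<in> topspace (subtopology projective_plane D). h A \<in> (h \<circ> f) ` U'}"
      by (rule openin_trans_full[OF _ ch(1)])
    moreover have "{A \<in> topspace (subtopology projective_plane D). h A \<in> (h \<circ> f) ` U'} = f ` U \<inter> D"
    proof -
      have "A \<in> f ` U" if A: "A \<in> D" "h A \<in> (h \<circ> f) ` U'" for A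
      proof -
        obtain u where "u \<in> U" "f u \<in> D" "h A = h (f u)" using A(2) by (auto simp: U'_def)
        then have "A = f u" using ch(3) A(1) by (meson inj_onD)
        then show ?thesis using \<open>u \<in> U\<close> by blast
      qed
      moreover have "D \<subseteq> topspace projective_plane" by (auto simp: D_def)
      ultimately show ?thesis by (auto simp: U'_def)
    qed
    ultimately show ?thesis unfolding D_def by simp
  qed
  have sub: "f ` U \<subseteq> topspace projective_plane"
    using continuous_map_image_subset_topspace[OF f] by simp
  have "f ` U = (f ` U \<inter> {A \<in> topspace projective_plane. rep A $ 1 \<noteq> 0})
     \<union> (f ` U \<inter> {A \<in> topspace projective_plane. rep A $ 2 \<noteq> 0})
     \<union> (f ` U \<inter> {A \<in> topspace projective_plane. rep A $ 3 \<noteq> 0})"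
  proof -
    have "rep A $ 1 \<noteq> 0 \<or> rep A $ 2 \<noteq> 0 \<or> rep A $ 3 \<noteq> 0" if A: "A \<in> topspace projective_plane" for A
    proof -
      obtain x where x: "A = antipodal_pair x" "x \<in> sphere 0 1" using A by (auto simp: topspace_projective_plane)
      then have "x \<noteq> 0" by auto
      then have "rep A \<noteq> 0" using rep_antipodal_pair[of x] x(1) by auto
      then show ?thesis by (auto simp: vec_eq_iff forall_3)
    qed
    then show ?thesis using sub by blast
  qed
  also have "openin projective_plane \<dots>"
    by (intro openin_Un; rule part) (auto simp: UNIV_3)
  finally show ?thesis .
qed

section \<open>The unit square\<close>

lemma quotient_map_from_compact:
  fixes D :: "'a::t2_space set"
  assumes "compact D" "Hausdorff_space X" "continuous_map (top_of_set D) X f"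
  shows "quotient_map (top_of_set D) (subtopology X (f ` D)) f"
proof (rule continuous_closed_quotient_map[THEN iffD2])
  show "continuous_map (top_of_set D) (subtopology X (f ` D)) f"
    using assms(3) by (simp add: continuous_map_in_subtopology)
  have "closed_map (top_of_set D) X f"
    by (rule continuous_imp_closed_map_gen)
      (use assms in \<open>auto simp: Hausdorff_imp_kc_space compact_space_subtopology\<close>)
  then show "closed_map (top_of_set D) (subtopology X (f ` D)) f"
    by (rule closed_map_into_subtopology) simp
  show "f ` topspace (top_of_set D) = topspace (subtopology X (f ` D))"
    using continuous_map_image_subset_topspace[OF assms(3)] by auto
qed

lemma closedin_image_compact:
  fixes D :: "'a::t2_space set"
  assumes "compact D" "Hausdorff_space X" "continuous_map (top_of_set D) X f"
  shows "closedin X (f ` D)"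
proof (rule compactin_imp_closedin[OF assms(2)])
  show "compactin X (f ` D)"
    by (rule image_compactin[OF _ assms(3)]) (use assms(1) in \<open>simp add: compactin_subtopology\<close>)
qed

lemma continuous_on_inverse_of_arc:
  fixes c :: "'a::t2_space \<Rightarrow> 'p" and D :: "'a set"
  assumes "compact D" "Hausdorff_space X" "continuous_map (top_of_set D) X c" "inj_on c D"
    and "continuous_map (top_of_set S) X f" "f ` S \<subseteq> c ` D"
  shows "continuous_on S (\<lambda>x. inv_into D c (f x))"
proof -
  have "continuous_map (top_of_set D) euclidean (inv_into D c \<circ> c)"
    by (simp add: assms(4) continuous_on_eq[OF continuous_on_id])
  then have "continuous_map (subtopology X (c ` D)) euclidean (inv_into D c)"
    by (rule continuous_compose_quotient_map[OF quotient_map_from_compact[OF assms(1-3)]])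
  moreover have "continuous_map (top_of_set S) (subtopology X (c ` D)) f"
    using assms(5,6) by (auto simp: continuous_map_in_subtopology)
  ultimately have "continuous_map (top_of_set S) euclidean (inv_into D c \<circ> f)"
    by (metis continuous_map_compose)
  then show ?thesis by (simp add: o_def)
qed

lemma endpoints_of_continuous_bij_unit_interval:
  fixes h :: "real \<Rightarrow> real"
  assumes "continuous_on {0..1} h" "inj_on h {0..1}" "h ` {0..1} = {0..1}"
  shows "h 0 = 0 \<and> h 1 = 1 \<or> h 0 = 1 \<and> h 1 = 0"
proof -
  have im: "0 \<in> h ` {0..1}" "1 \<in> h ` {0..1}" unfolding assms(3) by simp_all
  obtain a where a: "a \<in> {0..1}" "h a = 0" using im(1) by (metis imageE)
  obtain b where b: "b \<in> {0..1}" "h b = 1" using im(2) by (metis imageE)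
  note ab = a b
  have rng: "h t \<in> {0..1}" if "t \<in> {0..1}" for t using assms(3) that by blast
  have end_point: "t = 0 \<or> t = 1" if t: "t \<in> {0..1}" and ex: "h t = 0 \<or> h t = 1" for t
  proof (rule ccontr)
    assume "\<not> ?thesis"
    then have t': "0 < t" "t < 1" using t by auto
    have "h 0 \<in> {0..1}" "h 1 \<in> {0..1}" by (rule rng; simp)+
    then show False
      using continuous_inj_imp_mono[OF t' assms(1,2)] ex by auto
  qed
  have "a = 0 \<or> a = 1" "b = 0 \<or> b = 1" using end_point ab by blast+
  then consider "a = 0" "b = 1" | "a = 1" "b = 0" | "a = b" by metis
  then show ?thesis
  proof cases
    case 3
    then have "0 = (1 :: real)" using ab(2,4) by metis
    then show ?thesis by simp
  qed (use ab(2,4) in \<open>metis, metis\<close>)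
qed

text \<open>The sides of the unit square in counterclockwise order; \<open>collar i (s, d)\<close> is the point at
  distance \<open>d\<close> from the point \<open>s\<close> of side \<open>i\<close>.\<close>

definition collar :: "nat \<Rightarrow> real \<times> real \<Rightarrow> real \<times> real" where
  "collar i = (\<lambda>(s, d). if i = 0 then (s, d) else if i = 1 then (1 - d, s)
     else if i = 2 then (1 - s, 1 - d) else (d, 1 - s))"

definition side_path :: "nat \<Rightarrow> real \<Rightarrow> real \<times> real" where
  "side_path i s = collar i (s, 0)"

lemma collar_simps:
  "collar 0 (s, d) = (s, d)" "collar 1 (s, d) = (1 - d, s)"
  "collar 2 (s, d) = (1 - s, 1 - d)" "collar 3 (s, d) = (d, 1 - s)"
  by (simp_all add: collar_def)

lemma continuous_on_collar:
  assumes "continuous_on S f"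
  shows "continuous_on S (\<lambda>x. collar i (f x))"
proof -
  have c: "continuous_on S (\<lambda>x. fst (f x))" "continuous_on S (\<lambda>x. snd (f x))"
    using assms by (auto intro: continuous_intros)
  have c': "continuous_on S (\<lambda>x. 1 - fst (f x))" "continuous_on S (\<lambda>x. 1 - snd (f x))"
    using c by (auto intro!: continuous_intros)
  consider "i = 0" | "i = 1" | "i = 2" | "i \<noteq> 0" "i \<noteq> 1" "i \<noteq> 2" by blast
  then show ?thesis unfolding collar_def case_prod_unfold
    by cases (simp_all add: continuous_on_Pair c c' assms)
qed

lemma inj_collar: "collar i p = collar i q \<Longrightarrow> p = q"
  by (cases p; cases q) (auto simp: collar_def split: if_splits)

lemma side_path_eq_iff [simp]: "side_path i s = side_path i t \<longleftrightarrow> s = t"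
  unfolding side_path_def using inj_collar by fastforce

lemma side_path_image: "i < 4 \<Longrightarrow> side_path i ` {0..1} \<in> square_sides"
proof -
  have flip: "(\<lambda>s :: real. 1 - s) ` {0..1} = {0..1}" by (simp add: image_diff_atLeastAtMost)
  have times: "(\<lambda>s :: real. (s, 1 :: real)) ` {0..1} = {0..1} \<times> {1}" "(\<lambda>s :: real. (0 :: real, s)) ` {0..1} = {0} \<times> {0..1}"
    by auto
  assume "i < 4"
  then have "i = 0 \<or> i = 1 \<or> i = 2 \<or> i = 3" by linarith
  moreover have "side_path 0 ` {0..1} = {0..1} \<times> {0}" by (auto simp: side_path_def collar_def)
  moreover have "side_path 1 ` {0..1} = {1} \<times> {0..1}" by (auto simp: side_path_def collar_def)
  moreover have "side_path 2 ` {0..1} = {0..1} \<times> {1}"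
  proof -
    have "side_path 2 ` {0..1} = (\<lambda>s. (s, 1)) ` (\<lambda>s. 1 - s) ` {0..1}"
      unfolding image_image by (simp add: side_path_def collar_def)
    then show ?thesis unfolding flip times .
  qed
  moreover have "side_path 3 ` {0..1} = {0} \<times> {0..1}"
  proof -
    have "side_path 3 ` {0..1} = (\<lambda>s. (0, s)) ` (\<lambda>s. 1 - s) ` {0..1}"
      unfolding image_image by (simp add: side_path_def collar_def)
    then show ?thesis unfolding flip times .
  qed
  ultimately show ?thesis unfolding square_sides_def by (elim disjE) simp_all
qed

lemma side_path_in_unit_square: "s \<in> {0..1} \<Longrightarrow> side_path i s \<in> unit_square"
  by (auto simp: side_path_def collar_def unit_square_def)

lemma side_path_end: "i < 4 \<Longrightarrow> side_path i 1 = side_path (Suc i mod 4) 0"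
proof -
  assume "i < 4"
  then have "i = 0 \<or> i = 1 \<or> i = 2 \<or> i = 3" by linarith
  then show ?thesis by (auto simp: side_path_def collar_def)
qed

lemma unit_square_cases:
  assumes "x \<in> unit_square"
  obtains "x \<in> open_square" | i s where "i < 4" "s \<in> {0..1}" "x = side_path i s"
proof -
  obtain a b where x: "x = (a, b)" by (cases x)
  have ab: "a \<in> {0..1}" "b \<in> {0..1}" using assms x by (auto simp: unit_square_def)
  consider "b = 0" | "a = 1" | "b = 1" | "a = 0" | "0 < a" "a < 1" "0 < b" "b < 1" using ab by force
  then show ?thesis
  proof cases
    case 1 then show ?thesis using that(2)[of 0 a] ab x by (simp add: side_path_def collar_def)
  next
    case 2 then show ?thesis using that(2)[of 1 b] ab x by (simp add: side_path_def collar_def)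
  next
    case 3 then show ?thesis using that(2)[of 2 "1 - a"] ab x by (simp add: side_path_def collar_def)
  next
    case 4 then show ?thesis using that(2)[of 3 "1 - b"] ab x by (simp add: side_path_def collar_def)
  next
    case 5 then show ?thesis using that(1) x by (simp add: open_square_def)
  qed
qed

lemma collar_in_open_square:
  assumes "0 < s" "s < 1" "0 < d" "d < 1"
  shows "collar i (s, d) \<in> open_square"
  using assms by (auto simp: collar_def open_square_def)

text \<open>The inequalities confine each point to one of the four open triangles into which the
  diagonals cut the square.\<close>

lemma collar_disjoint:
  assumes "0 < d" "d < s" "d < 1 - s" "0 < d'" "d' < s'" "d' < 1 - s'" "i < 4" "j < 4"
    and "collar i (s, d) = collar j (s', d')"
  shows "i = j"
proof -
  have "i = 0 \<or> i = 1 \<or> i = 2 \<or> i = 3" "j = 0 \<or> j = 1 \<or> j = 2 \<or> j = 3" using assms(7,8) by linarith+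
  then show ?thesis using assms(1-6,9)
    by (elim disjE; hypsubst; simp only: collar_simps prod.inject; linarith)
qed

lemma ex_continuous_with_boundary_values:
  fixes b :: "nat \<Rightarrow> real \<Rightarrow> real"
  assumes "\<And>i. i < 4 \<Longrightarrow> continuous_on {0..1} (b i)" "\<And>i. i < 4 \<Longrightarrow> b i 1 = b (Suc i mod 4) 0"
  shows "\<exists>L. continuous_on unit_square L \<and> (\<forall>i<4. \<forall>s\<in>{0..1}. L (side_path i s) = b i s)"
proof -
  have c: "b 0 1 = b 1 0" "b 1 1 = b 2 0" "b 2 1 = b 3 0" "b 3 1 = b 0 0"
    using assms(2)[of 0] assms(2)[of 1] assms(2)[of 2] assms(2)[of 3] unfolding Suc_mod_4 by simp_all
  \<comment> \<open>bilinearly blended Coons patch\<close>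
  define L where "L p = (1 - snd p) * b 0 (fst p) + snd p * b 2 (1 - fst p)
     + (1 - fst p) * b 3 (1 - snd p) + fst p * b 1 (snd p)
     - ((1 - fst p) * (1 - snd p) * b 0 0 + fst p * (1 - snd p) * b 1 0
        + fst p * snd p * b 2 0 + (1 - fst p) * snd p * b 3 0)" for p :: "real \<times> real"
  have comp: "continuous_on unit_square (\<lambda>p. b i (h p))"
    if "i < 4" "continuous_on unit_square h" "\<And>p. p \<in> unit_square \<Longrightarrow> h p \<in> {0..1}" for i h
    by (rule continuous_on_compose2[OF assms(1)[OF that(1)] that(2)]) (use that(3) in auto)
  have "continuous_on unit_square L"
    unfolding L_def by (intro continuous_intros comp) (auto simp: unit_square_def)
  moreover have "L (side_path i s) = b i s" if "i < 4" for i s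
  proof -
    have "L (side_path 0 s) = b 0 s" "L (side_path 1 s) = b 1 s"
      "L (side_path 2 s) = b 2 s" "L (side_path 3 s) = b 3 s"
      unfolding L_def side_path_def collar_simps fst_conv snd_conv using c by (simp_all add: algebra_simps)
    moreover have "i = 0 \<or> i = 1 \<or> i = 2 \<or> i = 3" using that by linarith
    ultimately show ?thesis by metis
  qed
  ultimately show ?thesis by blast
qed

section \<open>Embedded quadrangulations\<close>

lemma embedding_mapD:
  assumes "embedding_map X Y f"
  shows "continuous_map X Y f" "inj_on f (topspace X)"
  using assms unfolding embedding_map_def
  by (auto dest: homeomorphic_imp_continuous_map homeomorphic_imp_injective_map simp: continuous_map_in_subtopology)

locale embedded_quadrangulation =
  fixes G :: "('v, 'e) multigraph" and pos :: "'v \<Rightarrow> (real ^ 3) set" and crv :: "'e \<Rightarrow> real \<Rightarrow> (real ^ 3) set"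
  assumes graph: "finite_loopless_multigraph G"
    and embedded: "embedded_in projective_plane G pos crv"
    and quadrilateral: "\<And>F. F \<in> faces projective_plane G pos crv \<Longrightarrow> quadrilateral_face projective_plane G crv F"
begin

abbreviation "P2 \<equiv> projective_plane"

definition Fs :: "(real ^ 3) set set set" where
  "Fs = faces P2 G pos crv"

lemma crv:
  assumes "e \<in> edges G"
  shows "embedding_map (top_of_set {0..1}) P2 (crv e)" and "{crv e 0, crv e 1} = pos ` ends G e"
    and "crv e ` {0<..<1} \<inter> pos ` verts G = {}"
  using embedded assms unfolding embedded_in_def by blast+

lemma crv_continuous: "e \<in> edges G \<Longrightarrow> continuous_map (top_of_set {0..1}) P2 (crv e)"
  by (rule embedding_mapD(1)[OF crv(1)])

lemma crv_inj: "e \<in> edges G \<Longrightarrow> inj_on (crv e) {0..1}"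
  using embedding_mapD(2)[OF crv(1)] by simp

lemmas crv_ends = crv(2)

lemma crv_interior: "e \<in> edges G \<Longrightarrow> s \<in> {0<..<1} \<Longrightarrow> crv e s \<notin> pos ` verts G"
  using crv(3) by blast

lemma pos_inj: "inj_on pos (verts G)"
  using embedded unfolding embedded_in_def by blast

lemma ends_subset: "e \<in> edges G \<Longrightarrow> ends G e \<subseteq> verts G"
  and card_ends: "e \<in> edges G \<Longrightarrow> card (ends G e) = 2"
  and finite_verts: "finite (verts G)" and finite_edges: "finite (edges G)"
  using graph unfolding finite_loopless_multigraph_def by blast+

lemma crv_end_in_verts: "e \<in> edges G \<Longrightarrow> s = 0 \<or> s = 1 \<Longrightarrow> crv e s \<in> pos ` verts G"
  using crv_ends[of e] ends_subset[of e] by blast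

lemma crv_eqD:
  assumes "e \<in> edges G" "e' \<in> edges G" "s \<in> {0<..<1}" "s' \<in> {0..1}" "crv e s = crv e' s'"
  shows "e = e' \<and> s = s'"
proof -
  have "s' \<noteq> 0 \<and> s' \<noteq> 1"
    using crv_interior[OF assms(1,3)] crv_end_in_verts[OF assms(2), of s'] assms(5) by auto
  then have s': "s' \<in> {0<..<1}" using assms(4) by auto
  have "e = e'"
  proof (rule ccontr)
    assume "e \<noteq> e'"
    have "\<forall>e\<in>edges G. \<forall>f\<in>edges G. e \<noteq> f \<longrightarrow> crv e ` {0<..<1} \<inter> crv f ` {0<..<1} = {}"
      using embedded unfolding embedded_in_def by (elim conjE)
    then have "crv e ` {0<..<1} \<inter> crv e' ` {0<..<1} = {}"
      using assms(1,2) \<open>e \<noteq> e'\<close> by simp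
    then show False using imageI[OF assms(3), of "crv e"] imageI[OF s', of "crv e'"] assms(5) by auto
  qed
  moreover have "s = s'"
    by (rule inj_onD[OF crv_inj[OF assms(1)]]) (use assms \<open>e = e'\<close> in auto)
  ultimately show ?thesis ..
qed

definition is_face_map :: "(real ^ 3) set set \<Rightarrow> (real \<times> real \<Rightarrow> (real ^ 3) set) \<Rightarrow> bool" where
  "is_face_map F \<phi> \<longleftrightarrow> continuous_map (top_of_set unit_square) P2 \<phi> \<and>
        homeomorphic_map (top_of_set open_square) (subtopology P2 F) \<phi> \<and>
        (\<forall>s \<in> square_sides. embedding_map (top_of_set s) P2 \<phi> \<and>
           (\<exists>e \<in> edges G. \<phi> ` s = crv e ` {0..1}))"

definition phi :: "(real ^ 3) set set \<Rightarrow> real \<times> real \<Rightarrow> (real ^ 3) set" where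
  "phi F = (SOME \<phi>. is_face_map F \<phi>)"

lemma phi:
  assumes "F \<in> Fs"
  shows "continuous_map (top_of_set unit_square) P2 (phi F)"
    "homeomorphic_map (top_of_set open_square) (subtopology P2 F) (phi F)"
    "\<And>s. s \<in> square_sides \<Longrightarrow> embedding_map (top_of_set s) P2 (phi F)"
    "\<And>s. s \<in> square_sides \<Longrightarrow> \<exists>e \<in> edges G. phi F ` s = crv e ` {0..1}"
proof -
  have "\<exists>\<phi>. is_face_map F \<phi>"
    using quadrilateral assms unfolding is_face_map_def Fs_def quadrilateral_face_def by blast
  then have "is_face_map F (phi F)" unfolding phi_def by (rule someI_ex)
  then show "continuous_map (top_of_set unit_square) P2 (phi F)"
    "homeomorphic_map (top_of_set open_square) (subtopology P2 F) (phi F)"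
    "\<And>s. s \<in> square_sides \<Longrightarrow> embedding_map (top_of_set s) P2 (phi F)"
    "\<And>s. s \<in> square_sides \<Longrightarrow> \<exists>e \<in> edges G. phi F ` s = crv e ` {0..1}"
    unfolding is_face_map_def by blast+
qed

abbreviation "Dr \<equiv> drawing G pos crv"

lemma face_subset: "F \<in> Fs \<Longrightarrow> F \<subseteq> topspace P2 - Dr"
  unfolding Fs_def faces_def by (auto dest!: connected_components_of_subset)

lemma face_nonempty: "F \<in> Fs \<Longrightarrow> F \<noteq> {}"
  unfolding Fs_def faces_def by (rule nonempty_connected_components_of)

lemma face_eqI: "F \<in> Fs \<Longrightarrow> F' \<in> Fs \<Longrightarrow> x \<in> F \<Longrightarrow> x \<in> F' \<Longrightarrow> F = F'"
  using connected_components_of_overlap[of F _ F'] unfolding Fs_def faces_def by (metis disjoint_iff)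

lemma face_cover: "x \<in> topspace P2 \<Longrightarrow> x \<notin> Dr \<Longrightarrow> \<exists>F\<in>Fs. x \<in> F"
proof -
  assume "x \<in> topspace P2" "x \<notin> Dr"
  then have "x \<in> \<Union> Fs" unfolding Fs_def faces_def Union_connected_components_of by simp
  then show ?thesis by blast
qed

lemma phi_inj: "F \<in> Fs \<Longrightarrow> inj_on (phi F) open_square"
  using homeomorphic_imp_injective_map[OF phi(2)] by simp

lemma phi_image: "F \<in> Fs \<Longrightarrow> phi F ` open_square = F"
  using homeomorphic_imp_surjective_map[OF phi(2)] face_subset by fastforce

lemma phi_side_inj:
  assumes "F \<in> Fs" "i < 4"
  shows "inj_on (\<lambda>s. phi F (side_path i s)) {0..1}"
proof (rule inj_onI)
  fix s t :: real assume st: "s \<in> {0..1}" "t \<in> {0..1}" "phi F (side_path i s) = phi F (side_path i t)"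
  have "inj_on (phi F) (side_path i ` {0..1})"
    using embedding_mapD(2)[OF phi(3)[OF assms(1) side_path_image[OF assms(2)]]] by simp
  from inj_onD[OF this st(3)] st(1,2) have "side_path i s = side_path i t" by simp
  then show "s = t" by simp
qed

lemma continuous_on_side_path: "continuous_on S (side_path i)"
  unfolding side_path_def by (intro continuous_on_collar continuous_intros)

lemma phi_side_continuous:
  assumes "F \<in> Fs"
  shows "continuous_map (top_of_set {0..1}) P2 (\<lambda>s. phi F (side_path i s))"
proof -
  have "continuous_map (top_of_set {0..1}) (top_of_set unit_square) (side_path i)"
    by (simp add: continuous_on_side_path side_path_in_unit_square)
  from continuous_map_compose[OF this phi(1)[OF assms]] show ?thesis by (simp add: o_def)
qed

definition side :: "(real ^ 3) set set \<Rightarrow> nat \<Rightarrow> 'e" where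
  "side F i = (SOME e. e \<in> edges G \<and> phi F ` side_path i ` {0..1} = crv e ` {0..1})"

lemma side:
  assumes "F \<in> Fs" "i < 4"
  shows "side F i \<in> edges G" "phi F ` side_path i ` {0..1} = crv (side F i) ` {0..1}"
proof -
  have "side F i \<in> edges G \<and> phi F ` side_path i ` {0..1} = crv (side F i) ` {0..1}"
    unfolding side_def by (rule someI_ex) (use phi(4)[OF assms(1) side_path_image[OF assms(2)]] in blast)
  then show "side F i \<in> edges G" "phi F ` side_path i ` {0..1} = crv (side F i) ` {0..1}" by blast+
qed

text \<open>The change of parameter from the side of the square to the edge; it may reverse the
  direction.\<close>

definition par :: "(real ^ 3) set set \<Rightarrow> nat \<Rightarrow> real \<Rightarrow> real" where
  "par F i s = inv_into {0..1} (crv (side F i)) (phi F (side_path i s))"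

lemma crv_par:
  assumes "F \<in> Fs" "i < 4" "s \<in> {0..1}"
  shows "par F i s \<in> {0..1}" "crv (side F i) (par F i s) = phi F (side_path i s)"
proof -
  have "phi F (side_path i s) \<in> crv (side F i) ` {0..1}"
    unfolding side(2)[OF assms(1,2), symmetric] using assms(3) by blast
  then show "par F i s \<in> {0..1}" "crv (side F i) (par F i s) = phi F (side_path i s)"
    unfolding par_def by (rule inv_into_into, rule f_inv_into_f)
qed

lemma continuous_on_par:
  assumes "F \<in> Fs" "i < 4"
  shows "continuous_on {0..1} (par F i)"
  unfolding par_def
proof (rule continuous_on_inverse_of_arc)
  show "(\<lambda>s. phi F (side_path i s)) ` {0..1} \<subseteq> crv (side F i) ` {0..1}"
    unfolding side(2)[OF assms, symmetric] by blast
qed (use assms side phi_side_continuous Hausdorff_projective_plane crv_continuous crv_inj in auto)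

lemma par_ends:
  assumes "F \<in> Fs" "i < 4"
  shows "par F i 0 = 0 \<and> par F i 1 = 1 \<or> par F i 0 = 1 \<and> par F i 1 = 0"
proof (rule endpoints_of_continuous_bij_unit_interval[OF continuous_on_par[OF assms]])
  show "inj_on (par F i) {0..1}"
  proof (rule inj_onI)
    fix s t :: real assume st: "s \<in> {0..1}" "t \<in> {0..1}" "par F i s = par F i t"
    then have "phi F (side_path i s) = phi F (side_path i t)"
      using crv_par(2)[OF assms] by metis
    from inj_onD[OF phi_side_inj[OF assms] this st(1,2)] show "s = t" .
  qed
  show "par F i ` {0..1} = {0..1}"
  proof
    show "par F i ` {0..1} \<subseteq> {0..1}" using crv_par(1)[OF assms] by blast
    show "{0..1} \<subseteq> par F i ` {0..1}"
    proof
      fix t :: real assume t: "t \<in> {0..1}"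
      have "crv (side F i) t \<in> phi F ` side_path i ` {0..1}"
        unfolding side(2)[OF assms] using t by (rule imageI)
      then obtain s where s: "s \<in> {0..1}" "crv (side F i) t = phi F (side_path i s)" by blast
      then have "par F i s = t"
        unfolding par_def s(2)[symmetric] using crv_inj[OF side(1)[OF assms]] t by (rule_tac inv_into_f_f)
      then show "t \<in> par F i ` {0..1}" using s(1) by blast
    qed
  qed
qed

definition src :: "'e \<Rightarrow> 'v" where "src e = inv_into (verts G) pos (crv e 0)"
definition trg :: "'e \<Rightarrow> 'v" where "trg e = inv_into (verts G) pos (crv e 1)"
definition corner :: "(real ^ 3) set set \<Rightarrow> nat \<Rightarrow> 'v" where
  "corner F i = inv_into (verts G) pos (phi F (side_path i 0))"

lemma pos_src: "e \<in> edges G \<Longrightarrow> pos (src e) = crv e 0" "e \<in> edges G \<Longrightarrow> src e \<in> verts G"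
  and pos_trg: "e \<in> edges G \<Longrightarrow> pos (trg e) = crv e 1" "e \<in> edges G \<Longrightarrow> trg e \<in> verts G"
  unfolding src_def trg_def using crv_end_in_verts[of e]
  by (simp_all add: f_inv_into_f inv_into_into)

lemma ends_eq:
  assumes "e \<in> edges G"
  shows "ends G e = {src e, trg e}"
proof -
  have "pos ` {src e, trg e} = pos ` ends G e" using pos_src pos_trg crv_ends assms by simp
  moreover have "{src e, trg e} \<subseteq> verts G" using pos_src pos_trg assms by simp
  ultimately show ?thesis using inj_on_image_eq_iff[OF pos_inj] ends_subset[OF assms] by metis
qed

lemma src_neq_trg: "e \<in> edges G \<Longrightarrow> src e \<noteq> trg e"
  using card_ends[of e] ends_eq[of e] by auto

lemma pos_corner:
  assumes "F \<in> Fs" "i < 4"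
  shows "corner F i \<in> verts G" "pos (corner F i) = phi F (side_path i 0)"
proof -
  have "phi F (side_path i 0) = crv (side F i) (par F i 0)" using crv_par(2)[OF assms, of 0] by simp
  then have "phi F (side_path i 0) \<in> pos ` verts G"
    using crv_end_in_verts[OF side(1)[OF assms]] par_ends[OF assms] by metis
  then show "corner F i \<in> verts G" "pos (corner F i) = phi F (side_path i 0)"
    unfolding corner_def by (rule inv_into_into, rule f_inv_into_f)
qed

lemma src_side_eq_corner_iff:
  assumes "F \<in> Fs" "i < 4"
  shows "src (side F i) = corner F i \<longleftrightarrow> par F i 0 = 0"
proof -
  have e: "side F i \<in> edges G" using side assms by blast
  have "src (side F i) = corner F i \<longleftrightarrow> pos (src (side F i)) = pos (corner F i)"
    using pos_inj pos_src(2)[OF e] pos_corner(1)[OF assms] by (metis inj_onD)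
  also have "\<dots> \<longleftrightarrow> crv (side F i) 0 = crv (side F i) (par F i 0)"
    unfolding pos_src(1)[OF e] pos_corner(2)[OF assms] using crv_par(2)[OF assms, of 0] by simp
  also have "\<dots> \<longleftrightarrow> 0 = par F i 0"
    using inj_on_eq_iff[OF crv_inj[OF e], of 0 "par F i 0"] crv_par(1)[OF assms, of 0] by simp
  finally show ?thesis by auto
qed

lemma side_corners:
  assumes "F \<in> Fs" "i < 4"
  shows "{src (side F i), trg (side F i)} = {corner F i, corner F (Suc i mod 4)}"
proof -
  have e: "side F i \<in> edges G" using side assms by blast
  have j: "Suc i mod 4 < 4" by simp
  have "pos ` {corner F i, corner F (Suc i mod 4)} = {phi F (side_path i 0), phi F (side_path i 1)}"
    unfolding side_path_end[OF assms(2)] using pos_corner(2)[OF assms] pos_corner(2)[OF assms(1) j] by simp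
  also have "\<dots> = {crv (side F i) (par F i 0), crv (side F i) (par F i 1)}"
    using crv_par(2)[OF assms, of 0] crv_par(2)[OF assms, of 1] by simp
  also have "\<dots> = {crv (side F i) 0, crv (side F i) 1}" using par_ends[OF assms] by auto
  also have "\<dots> = pos ` {src (side F i), trg (side F i)}" using pos_src(1)[OF e] pos_trg(1)[OF e] by simp
  finally have "pos ` {corner F i, corner F (Suc i mod 4)} = pos ` {src (side F i), trg (side F i)}" .
  moreover have "{corner F i, corner F (Suc i mod 4)} \<subseteq> verts G" "{src (side F i), trg (side F i)} \<subseteq> verts G"
    using pos_corner(1)[OF assms] pos_corner(1)[OF assms(1) j] pos_src(2)[OF e] pos_trg(2)[OF e] by simp_all
  ultimately show ?thesis using inj_on_image_eq_iff[OF pos_inj] by metis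
qed

lemma crv_in_Dr: "e \<in> edges G \<Longrightarrow> t \<in> {0..1} \<Longrightarrow> crv e t \<in> Dr"
  unfolding drawing_def by blast

lemma phi_side_in_Dr: "F \<in> Fs \<Longrightarrow> i < 4 \<Longrightarrow> s \<in> {0..1} \<Longrightarrow> phi F (side_path i s) \<in> Dr"
  using crv_par[of F i s] crv_in_Dr side by metis

lemma phi_open_in_face: "F \<in> Fs \<Longrightarrow> p \<in> open_square \<Longrightarrow> phi F p \<in> F"
  using phi_image by blast

lemma phi_open_notin_Dr: "F \<in> Fs \<Longrightarrow> p \<in> open_square \<Longrightarrow> phi F p \<notin> Dr"
  using phi_open_in_face face_subset by blast

end

text \<open>Finiteness is part of the conclusion because this bound is what later shows that there
  are finitely many faces.\<close>

lemma finite_card_le_2I: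
  assumes "\<And>x y z. x \<in> S \<Longrightarrow> y \<in> S \<Longrightarrow> z \<in> S \<Longrightarrow> x \<noteq> y \<Longrightarrow> x \<noteq> z \<Longrightarrow> y \<noteq> z \<Longrightarrow> False"
  shows "finite S \<and> card S \<le> 2"
proof (rule ccontr)
  assume neg: "\<not> ?thesis"
  have "\<exists>T. T \<subseteq> S \<and> card T = 3"
  proof (cases "finite S")
    case True
    then have "3 \<le> card S" using neg by simp
    then show ?thesis using obtain_subset_with_card_n by metis
  next
    case False
    then show ?thesis using infinite_arbitrarily_large by metis
  qed
  then obtain T where T: "T \<subseteq> S" "card T = 3" by blast
  then obtain x y z where "T = {x, y, z}" "x \<noteq> y" "x \<noteq> z" "y \<noteq> z" by (metis card_3_iff)
  then show False using assms[of x y z] T(1) by simp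
qed

lemma depth_bounds:
  fixes s u :: real
  assumes "0 < s" "s < 1" "0 < u" "u < 1"
  shows "0 < u * s * (1 - s)" "u * s * (1 - s) < s" "u * s * (1 - s) < 1 - s" "u * s * (1 - s) < 1"
proof -
  show "0 < u * s * (1 - s)" using assms by simp
  have "u * (1 - s) < 1 * 1" using assms by (intro mult_strict_mono) auto
  then have "s * (u * (1 - s)) < s * 1" using assms by (intro mult_strict_left_mono) auto
  then show 1: "u * s * (1 - s) < s" by (simp add: mult_ac)
  have "u * s < 1 * 1" using assms by (intro mult_strict_mono) auto
  then have "(u * s) * (1 - s) < 1 * (1 - s)" using assms by (intro mult_strict_right_mono) auto
  then show "u * s * (1 - s) < 1 - s" by simp
  show "u * s * (1 - s) < 1" using 1 assms by linarith
qed

section \<open>Half discs along the sides of an edge\<close>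

context embedded_quadrangulation begin

lemma par_interior:
  assumes "F \<in> Fs" "i < 4" "s \<in> {0<..<1}"
  shows "par F i s \<in> {0<..<1}"
proof -
  have inj: "par F i s \<noteq> par F i t" if "t \<in> {0..1}" "t \<noteq> s" for t
  proof
    assume "par F i s = par F i t"
    then have "phi F (side_path i s) = phi F (side_path i t)"
      using crv_par(2)[OF assms(1,2), of s] crv_par(2)[OF assms(1,2), of t] that(1) assms(3) by simp
    then have "s = t" using inj_onD[OF phi_side_inj[OF assms(1,2)], of s t] that assms(3) by simp
    then show False using that by simp
  qed
  have "par F i s \<noteq> par F i 0" "par F i s \<noteq> par F i 1" by (rule inj; use assms(3) in simp)+
  then have "par F i s \<noteq> 0" "par F i s \<noteq> 1" using par_ends[OF assms(1,2)] by auto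
  moreover have "par F i s \<in> {0..1}" using crv_par(1)[OF assms(1,2)] assms(3) by simp
  ultimately show ?thesis by simp
qed

lemma phi_side_in_verts_iff:
  assumes "F \<in> Fs" "i < 4" "s \<in> {0..1}"
  shows "phi F (side_path i s) \<in> pos ` verts G \<longleftrightarrow> s = 0 \<or> s = 1"
proof
  assume l: "phi F (side_path i s) \<in> pos ` verts G"
  show "s = 0 \<or> s = 1"
  proof (rule ccontr)
    assume "\<not> ?thesis"
    then have "s \<in> {0<..<1}" using assms(3) by simp
    then have "crv (side F i) (par F i s) \<notin> pos ` verts G"
      using crv_interior[OF side(1)[OF assms(1,2)] par_interior[OF assms(1,2)]] by simp
    then show False using l crv_par(2)[OF assms] by simp
  qed
next
  assume "s = 0 \<or> s = 1"
  then have "par F i s = 0 \<or> par F i s = 1" using par_ends[OF assms(1,2)] by auto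
  then show "phi F (side_path i s) \<in> pos ` verts G"
    using crv_end_in_verts[OF side(1)[OF assms(1,2)]] crv_par(2)[OF assms] by metis
qed

text \<open>A half disc in the face along side \<open>i\<close>, like a page of a book bound at the
  edge. The factor \<open>s * (1 - s)\<close> tapers it towards the corners and keeps it in the
  triangle over its side, so that pages at different sides of one face are disjoint.\<close>

definition page :: "(real ^ 3) set set \<Rightarrow> nat \<Rightarrow> real \<times> real \<Rightarrow> (real ^ 3) set" where
  "page F i = (\<lambda>(s, u). phi F (collar i (s, u * s * (1 - s))))"

lemma page_0: "page F i (s, 0) = phi F (side_path i s)"
  by (simp add: page_def side_path_def)

lemma collar_depth_in_open_square:
  assumes "s \<in> {0<..<1}" "u \<in> {0<..<1}"
  shows "collar i (s, u * s * (1 - s)) \<in> open_square"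
  using assms depth_bounds[of s u] by (intro collar_in_open_square) auto

lemma page_in_face:
  assumes "F \<in> Fs" "s \<in> {0<..<1}" "u \<in> {0<..<1}"
  shows "page F i (s, u) \<in> F"
  unfolding page_def using phi_open_in_face[OF assms(1) collar_depth_in_open_square[OF assms(2,3)]] by simp

lemma page_eqD:
  assumes "F \<in> Fs" "i < 4" "j < 4" "s \<in> {0<..<1}" "u \<in> {0<..<1}" "s' \<in> {0<..<1}" "u' \<in> {0<..<1}"
    and "page F i (s, u) = page F j (s', u')"
  shows "i = j \<and> s = s' \<and> u = u'"
proof -
  have eq: "collar i (s, u * s * (1 - s)) = collar j (s', u' * s' * (1 - s'))"
    using inj_onD[OF phi_inj[OF assms(1)], OF _ collar_depth_in_open_square[OF assms(4,5)] collar_depth_in_open_square[OF assms(6,7)]]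
      assms(8) unfolding page_def by simp
  have ij: "i = j"
    by (rule collar_disjoint[OF _ _ _ _ _ _ assms(2,3) eq])
      (use depth_bounds[of s u] depth_bounds[of s' u'] assms(4-7) in auto)
  then have "(s, u * s * (1 - s)) = (s', u' * s' * (1 - s'))" using inj_collar eq by metis
  then have "s = s'" "u * (s * (1 - s)) = u' * (s * (1 - s))" by (auto simp: mult.assoc)
  moreover have "s * (1 - s) \<noteq> 0" using assms(4) by auto
  ultimately show ?thesis using ij by simp
qed

lemma page_continuous:
  assumes "F \<in> Fs"
  shows "continuous_map (top_of_set ({0<..<1} \<times> {0..<1})) P2 (page F i)"
proof -
  have "collar i (s, u * s * (1 - s)) \<in> unit_square" if "s \<in> {0<..<1}" "u \<in> {0..<1}" for s u
  proof (cases "u = 0")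
    case True
    then show ?thesis using side_path_in_unit_square[of s i] that by (simp add: side_path_def)
  next
    case False
    then have "collar i (s, u * s * (1 - s)) \<in> open_square"
      using that by (intro collar_depth_in_open_square) auto
    then show ?thesis by (auto simp: open_square_def unit_square_def)
  qed
  moreover have "continuous_on ({0<..<1} \<times> {0..<1}) (\<lambda>x. collar i (fst x, snd x * fst x * (1 - fst x)))"
    by (intro continuous_on_collar continuous_intros)
  ultimately have "continuous_map (top_of_set ({0<..<1} \<times> {0..<1})) (top_of_set unit_square)
      (\<lambda>x. collar i (fst x, snd x * fst x * (1 - fst x)))" by auto
  from continuous_map_compose[OF this phi(1)[OF assms]] show ?thesis
    by (simp add: o_def page_def case_prod_unfold)
qed

text \<open>Two half discs glued along a part of an edge form an open set by invariance of domain, which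
  leaves no room for a third one.\<close>

lemma no_three_sides:
  assumes F: "F1 \<in> Fs" "F2 \<in> Fs" "F3 \<in> Fs" and i: "i1 < 4" "i2 < 4" "i3 < 4"
    and e: "side F1 i1 = e" "side F2 i2 = e" "side F3 i3 = e"
    and ne: "(F1, i1) \<noteq> (F2, i2)" "(F1, i1) \<noteq> (F3, i3)" "(F2, i2) \<noteq> (F3, i3)"
  shows False
proof -
  define U :: "(real \<times> real) set" where "U = {0<..<1} \<times> {-1<..<1}"
  let ?c = "\<lambda>s. phi F2 (side_path i2 s)"
  \<comment> \<open>\<sigma> matches the two parametrizations of the common edge, so that the two
    pages fit together along it.\<close>
  define \<sigma> where "\<sigma> s = inv_into {0..1} ?c (phi F1 (side_path i1 s))" for s
  have img: "phi F1 ` side_path i1 ` {0..1} = ?c ` {0..1}" "phi F3 ` side_path i3 ` {0..1} = ?c ` {0..1}"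
    using side(2)[OF F(1) i(1)] side(2)[OF F(2) i(2)] side(2)[OF F(3) i(3)] e by (simp_all add: image_image)
  have \<sigma>: "\<sigma> s \<in> {0..1}" "?c (\<sigma> s) = phi F1 (side_path i1 s)" if "s \<in> {0..1}" for s
  proof -
    have "phi F1 (side_path i1 s) \<in> ?c ` {0..1}" unfolding img(1)[symmetric] using that by blast
    then show "\<sigma> s \<in> {0..1}" "?c (\<sigma> s) = phi F1 (side_path i1 s)"
      unfolding \<sigma>_def by (rule inv_into_into, rule f_inv_into_f)
  qed
  have \<sigma>_int: "\<sigma> s \<in> {0<..<1}" if "s \<in> {0<..<1}" for s
  proof -
    have s: "s \<in> {0..1}" using that by simp
    have "phi F1 (side_path i1 s) \<notin> pos ` verts G"
      using phi_side_in_verts_iff[OF F(1) i(1) s] that by auto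
    then have "\<sigma> s \<noteq> 0 \<and> \<sigma> s \<noteq> 1"
      using phi_side_in_verts_iff[OF F(2) i(2) \<sigma>(1)[OF s]] \<sigma>(2)[OF s] by simp
    then show ?thesis using \<sigma>(1)[OF s] by auto
  qed
  have \<sigma>_inj: "s = t" if "s \<in> {0<..<1}" "t \<in> {0<..<1}" "\<sigma> s = \<sigma> t" for s t
  proof -
    have "phi F1 (side_path i1 s) = phi F1 (side_path i1 t)" using \<sigma>(2)[of s] \<sigma>(2)[of t] that by simp
    then show ?thesis using inj_onD[OF phi_side_inj[OF F(1) i(1)], of s t] that by simp
  qed
  have \<sigma>_cont: "continuous_on {0..1} \<sigma>"
    unfolding \<sigma>_def
  proof (rule continuous_on_inverse_of_arc)
    show "(\<lambda>s. phi F1 (side_path i1 s)) ` {0..1} \<subseteq> ?c ` {0..1}" using img(1) by (simp add: image_image)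
  qed (use F i phi_side_continuous Hausdorff_projective_plane phi_side_inj in auto)
  define f where "f x = (if snd x \<ge> 0 then page F1 i1 x else page F2 i2 (\<sigma> (fst x), - snd x))" for x
  have cont1: "continuous_map (top_of_set {x \<in> U. snd x \<ge> 0}) P2 (page F1 i1)"
    by (rule continuous_map_from_subtopology_mono[OF page_continuous[OF F(1)]]) (auto simp: U_def)
  have cont2: "continuous_map (top_of_set {x \<in> U. snd x \<le> 0}) P2 (\<lambda>x. page F2 i2 (\<sigma> (fst x), - snd x))"
  proof -
    have "continuous_on {x \<in> U. snd x \<le> 0} (\<lambda>x. (\<sigma> (fst x), - snd x))"
      by (intro continuous_on_Pair continuous_on_compose2[OF \<sigma>_cont] continuous_intros) (auto simp: U_def)
    then have "continuous_map (top_of_set {x \<in> U. snd x \<le> 0}) (top_of_set ({0<..<1} \<times> {0..<1})) (\<lambda>x. (\<sigma> (fst x), - snd x))"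
      using \<sigma>_int by (auto simp: U_def)
    from continuous_map_compose[OF this page_continuous[OF F(2)]] show ?thesis by (simp add: o_def)
  qed
  have glue: "page F1 i1 x = page F2 i2 (\<sigma> (fst x), - snd x)" if x: "x \<in> U" "snd x = 0" for x
  proof -
    obtain s where s: "x = (s, 0)" "s \<in> {0..1}" using x by (cases x) (auto simp: U_def)
    then show ?thesis using \<sigma>(2)[of s] by (simp add: page_0)
  qed
  have contf: "continuous_map (top_of_set U) P2 f"
  proof (rule pasting_lemma_closed[where I = "UNIV :: bool set"
      and T = "\<lambda>b. if b then {x \<in> U. snd x \<ge> 0} else {x \<in> U. snd x \<le> 0}"
      and f = "\<lambda>b x. if b then page F1 i1 x else page F2 i2 (\<sigma> (fst x), - snd x)"])
    show "closedin (top_of_set U) (if b then {x \<in> U. snd x \<ge> 0} else {x \<in> U. snd x \<le> 0})" for b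
    proof -
      have "closed {x :: real \<times> real. snd x \<ge> 0}" "closed {x :: real \<times> real. snd x \<le> 0}"
        by (intro closed_Collect_le continuous_intros)+
      then have "closedin (top_of_set U) (U \<inter> {x. snd x \<ge> 0})" "closedin (top_of_set U) (U \<inter> {x. snd x \<le> 0})"
        by (simp_all add: closedin_closed_Int)
      then show ?thesis by (simp add: Int_def)
    qed
    show "continuous_map (subtopology (top_of_set U) (if b then {x \<in> U. snd x \<ge> 0} else {x \<in> U. snd x \<le> 0})) P2
        ((\<lambda>b x. if b then page F1 i1 x else page F2 i2 (\<sigma> (fst x), - snd x)) b)" for b
      using cont1 cont2 by (cases b) (simp_all add: subtopology_subtopology Int_absorb1 Collect_conj_eq[symmetric] Int_def)
    show "(if b then page F1 i1 x else page F2 i2 (\<sigma> (fst x), - snd x)) = (if b' then page F1 i1 x else page F2 i2 (\<sigma> (fst x), - snd x))"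
      if "x \<in> topspace (top_of_set U) \<inter> (if b then {x \<in> U. snd x \<ge> 0} else {x \<in> U. snd x \<le> 0})
        \<inter> (if b' then {x \<in> U. snd x \<ge> 0} else {x \<in> U. snd x \<le> 0})" for b b' x
      using that glue[of x] by (cases b; cases b') auto
    show "\<exists>b. b \<in> UNIV \<and> x \<in> (if b then {x \<in> U. snd x \<ge> 0} else {x \<in> U. snd x \<le> 0}) \<and>
        f x = (if b then page F1 i1 x else page F2 i2 (\<sigma> (fst x), - snd x))" if "x \<in> topspace (top_of_set U)" for x
      using that by (intro exI[of _ "snd x \<ge> 0"]) (auto simp: f_def)
  qed simp
  have f_pos: "f (s, u) = page F1 i1 (s, u)" "f (s, u) \<in> F1" if "s \<in> {0<..<1}" "u \<in> {0<..<1}" for s u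
    using page_in_face[OF F(1) that] that by (simp_all add: f_def)
  have f_neg: "f (s, u) = page F2 i2 (\<sigma> s, - u)" "f (s, u) \<in> F2" if "s \<in> {0<..<1}" "u \<in> {-1<..<0}" for s u
    using page_in_face[OF F(2) \<sigma>_int[OF that(1)], of "- u" i2] that by (simp_all add: f_def)
  have f_0: "f (s, 0) = phi F1 (side_path i1 s)" for s by (simp add: f_def page_0)
  have f_0_Dr: "f (s, 0) \<in> Dr" if "s \<in> {0<..<1}" for s
    unfolding f_0 using that by (intro phi_side_in_Dr F i) simp
  have notDr: "x \<notin> Dr" if "x \<in> F" "F \<in> Fs" for x F using face_subset[OF that(2)] that(1) by blast
  have trichotomy: "u \<in> {0<..<1} \<or> u = 0 \<or> u \<in> {-1<..<0}" if "u \<in> {-1<..<1}" for u :: real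
    using that by auto
  \<comment> \<open>Different faces are disjoint; if the faces coincide, the sides differ and their
    pages are disjoint.\<close>
  have pn: "f (s, u) \<noteq> f (s', u')"
    if su: "s \<in> {0<..<1}" "u \<in> {0<..<1}" "s' \<in> {0<..<1}" "u' \<in> {-1<..<0}" for s u s' u'
  proof
    assume eq: "f (s, u) = f (s', u')"
    have "F1 = F2" using face_eqI[OF F(1,2)] f_pos(2)[OF su(1,2)] f_neg(2)[OF su(3,4)] eq by simp
    then have "page F1 i1 (s, u) = page F1 i2 (\<sigma> s', - u')" using eq f_pos(1)[OF su(1,2)] f_neg(1)[OF su(3,4)] by simp
    then have "i1 = i2" using page_eqD[OF F(1) i(1,2) su(1,2) \<sigma>_int[OF su(3)], of "- u'"] su(4) by simp
    then show False using ne \<open>F1 = F2\<close> by simp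
  qed
  have "inj_on f U"
  proof (rule inj_onI)
    fix x y assume xy: "x \<in> U" "y \<in> U" "f x = f y"
    obtain s u where x: "x = (s, u)" by (cases x)
    obtain s' u' where y: "y = (s', u')" by (cases y)
    have s: "s \<in> {0<..<1}" "s' \<in> {0<..<1}" and "u \<in> {-1<..<1}" "u' \<in> {-1<..<1}"
      using xy unfolding x y U_def by simp_all
    note tri = trichotomy[OF this(3)] trichotomy[OF this(4)]
    have eq: "f (s, u) = f (s', u')" using xy unfolding x y by simp
    from tri show "x = y"
    proof (elim disjE)
      assume u: "u \<in> {0<..<1}" "u' \<in> {0<..<1}"
      show ?thesis using page_eqD[OF F(1) i(1,1) s(1) u(1) s(2) u(2)] eq f_pos(1)[OF s(1) u(1)] f_pos(1)[OF s(2) u(2)]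
        unfolding x y by simp
    next
      assume u: "u \<in> {-1<..<0}" "u' \<in> {-1<..<0}"
      have "\<sigma> s = \<sigma> s' \<and> - u = - u'"
        using page_eqD[OF F(2) i(2,2) \<sigma>_int[OF s(1)] _ \<sigma>_int[OF s(2)], of "- u" "- u'"]
          eq f_neg(1)[OF s(1) u(1)] f_neg(1)[OF s(2) u(2)] u by simp
      then show ?thesis using \<sigma>_inj[OF s] unfolding x y by simp
    next
      assume u: "u = 0" "u' = 0"
      then have "phi F1 (side_path i1 s) = phi F1 (side_path i1 s')" using eq f_0 by simp
      then show ?thesis using inj_onD[OF phi_side_inj[OF F(1) i(1)], of s s'] s u unfolding x y by simp
    next
      assume u: "u \<in> {0<..<1}" "u' = 0"
      then show ?thesis using notDr[OF f_pos(2)[OF s(1) u(1)] F(1)] f_0_Dr[OF s(2)] eq by simp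
    next
      assume u: "u \<in> {-1<..<0}" "u' = 0"
      then show ?thesis using notDr[OF f_neg(2)[OF s(1) u(1)] F(2)] f_0_Dr[OF s(2)] eq by simp
    next
      assume u: "u = 0" "u' \<in> {0<..<1}"
      then show ?thesis using notDr[OF f_pos(2)[OF s(2) u(2)] F(1)] f_0_Dr[OF s(1)] eq by simp
    next
      assume u: "u = 0" "u' \<in> {-1<..<0}"
      then show ?thesis using notDr[OF f_neg(2)[OF s(2) u(2)] F(2)] f_0_Dr[OF s(1)] eq by simp
    next
      assume u: "u \<in> {0<..<1}" "u' \<in> {-1<..<0}"
      then show ?thesis using pn[OF s(1) u(1) s(2) u(2)] eq by simp
    next
      assume u: "u \<in> {-1<..<0}" "u' \<in> {0<..<1}"
      then show ?thesis using pn[OF s(2) u(2) s(1) u(1)] eq by simp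
    qed
  qed
  moreover have "open U" unfolding U_def by (intro open_Times) simp_all
  ultimately have W: "openin P2 (f ` U)" using invariance_of_domain_projective_plane[OF _ contf] by blast
  define \<gamma> where "\<gamma> u = page F3 i3 (1/2, u)" for u
  have \<gamma>_cont: "continuous_map (top_of_set {0..<1}) P2 \<gamma>"
  proof -
    have "continuous_map (top_of_set {0..<1}) (top_of_set ({0<..<1} \<times> {0..<1})) (\<lambda>u. (1/2 :: real, u :: real))"
      by (auto intro!: continuous_intros)
    from continuous_map_compose[OF this page_continuous[OF F(3)]] show ?thesis by (simp add: o_def \<gamma>_def[abs_def])
  qed
  have "phi F3 (side_path i3 (1/2)) \<in> phi F1 ` side_path i1 ` {0..1}"
    unfolding img(1) img(2)[symmetric] by (intro imageI) simp
  then obtain s0 where s0: "s0 \<in> {0..1}" "phi F3 (side_path i3 (1/2)) = phi F1 (side_path i1 s0)" by blast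
  have "s0 \<noteq> 0 \<and> s0 \<noteq> 1"
    using phi_side_in_verts_iff[OF F(1) i(1) s0(1)] phi_side_in_verts_iff[OF F(3) i(3), of "1/2"] s0(2) by simp
  then have "(s0, 0) \<in> U" using s0(1) by (auto simp: U_def)
  moreover have "\<gamma> 0 = f (s0, 0)" unfolding \<gamma>_def page_0 f_0 using s0(2) .
  ultimately have "\<gamma> 0 \<in> f ` U" by simp
  define A where "A = {u \<in> {0..<1}. \<gamma> u \<in> f ` U}"
  have "openin (top_of_set {0..<1}) A"
    using openin_continuous_map_preimage[OF \<gamma>_cont W] by (simp add: A_def)
  then have "\<forall>x\<in>A. \<exists>d>0. \<forall>u\<in>{0..<1}. dist u x < d \<longrightarrow> u \<in> A"
    unfolding openin_euclidean_subtopology_iff by (rule conjunct2)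
  moreover have "0 \<in> A" using \<open>\<gamma> 0 \<in> f ` U\<close> by (simp add: A_def)
  ultimately have "\<exists>d>0. \<forall>u\<in>{0..<1}. dist u 0 < d \<longrightarrow> u \<in> A" by (rule bspec)
  then obtain d where d: "d > 0" "\<forall>u\<in>{0..<1}. dist u 0 < d \<longrightarrow> u \<in> A" by blast
  define u where "u = min (d / 2) (1 / 2)"
  have u: "u \<in> {0<..<1}" "dist u 0 < d" using d(1) by (auto simp: u_def dist_real_def)
  then have "u \<in> A" using d(2) by simp
  then obtain x where x: "x \<in> U" "\<gamma> u = f x" by (auto simp: A_def)
  obtain s t where st: "x = (s, t)" by (cases x)
  have s: "s \<in> {0<..<1}" and t: "t \<in> {-1<..<1}" using x(1) unfolding st U_def by simp_all
  have half: "(1/2 :: real) \<in> {0<..<1}" by simp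
  have \<gamma>F: "\<gamma> u \<in> F3" unfolding \<gamma>_def by (rule page_in_face[OF F(3) half u(1)])
  from trichotomy[OF t] show False
  proof (elim disjE)
    assume t: "t \<in> {0<..<1}"
    have "F1 = F3" using face_eqI[OF F(1,3)] f_pos(2)[OF s t] \<gamma>F x(2) st by simp
    moreover have "page F1 i1 (s, t) = page F3 i3 (1/2, u)" using x(2) f_pos(1)[OF s t] st unfolding \<gamma>_def by simp
    ultimately have "i1 = i3" using page_eqD[OF F(1) i(1,3) s t half u(1)] by simp
    then show False using ne \<open>F1 = F3\<close> by simp
  next
    assume "t = 0"
    then show False using f_0_Dr[OF s] notDr[OF \<gamma>F F(3)] x(2) st by simp
  next
    assume t: "t \<in> {-1<..<0}"
    have "F2 = F3" using face_eqI[OF F(2,3)] f_neg(2)[OF s t] \<gamma>F x(2) st by simp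
    moreover have "page F2 i2 (\<sigma> s, - t) = page F3 i3 (1/2, u)" using x(2) f_neg(1)[OF s t] st unfolding \<gamma>_def by simp
    ultimately have "i2 = i3" using page_eqD[OF F(2) i(2,3) \<sigma>_int[OF s] _ half u(1), of "- t"] t by simp
    then show False using ne \<open>F2 = F3\<close> by simp
  qed
qed

lemma edge_sides: "finite {(F, i). F \<in> Fs \<and> i < 4 \<and> side F i = e}" "card {(F, i). F \<in> Fs \<and> i < 4 \<and> side F i = e} \<le> 2"
proof -
  have "finite {(F, i). F \<in> Fs \<and> i < 4 \<and> side F i = e} \<and> card {(F, i). F \<in> Fs \<and> i < 4 \<and> side F i = e} \<le> 2"
  proof (rule finite_card_le_2I)
    fix x y z
    assume "x \<in> {(F, i). F \<in> Fs \<and> i < 4 \<and> side F i = e}" "y \<in> {(F, i). F \<in> Fs \<and> i < 4 \<and> side F i = e}"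
      "z \<in> {(F, i). F \<in> Fs \<and> i < 4 \<and> side F i = e}" "x \<noteq> y" "x \<noteq> z" "y \<noteq> z"
    then show False
      using no_three_sides[of "fst x" "fst y" "fst z" "snd x" "snd y" "snd z" e] by (simp add: case_prod_unfold)
  qed
  then show "finite {(F, i). F \<in> Fs \<and> i < 4 \<and> side F i = e}" "card {(F, i). F \<in> Fs \<and> i < 4 \<and> side F i = e} \<le> 2" by blast+
qed

text \<open>Each face has a side at one of finitely many edges, and each edge has at most two
  sides.\<close>

lemma finite_Fs: "finite Fs"
proof -
  have "Fs \<subseteq> fst ` (\<Union>e\<in>edges G. {(F, i). F \<in> Fs \<and> i < 4 \<and> side F i = e})"
  proof
    fix F assume "F \<in> Fs"
    then have "(F, 0) \<in> (\<Union>e\<in>edges G. {(F, i). F \<in> Fs \<and> i < 4 \<and> side F i = e})" using side(1)[of F 0] by simp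
    from imageI[OF this, of fst] show "F \<in> fst ` (\<Union>e\<in>edges G. {(F, i). F \<in> Fs \<and> i < 4 \<and> side F i = e})" by simp
  qed
  then show ?thesis using finite_edges edge_sides(1) by (meson finite_UN finite_imageI finite_subset)
qed

end

section \<open>Connectedness of the faces through edges\<close>

lemma connectedin_closedinD:
  assumes "connectedin X S" "closedin X A" "closedin X B" "S \<subseteq> A \<union> B" "A \<inter> B \<inter> S = {}"
  shows "A \<inter> S = {} \<or> B \<inter> S = {}"
  using assms unfolding connectedin_closedin by blast

context embedded_quadrangulation begin

lemma compact_unit_square: "compact unit_square"
  unfolding unit_square_def by (intro compact_Times) simp_all

lemma closedin_cell: "F \<in> Fs \<Longrightarrow> closedin P2 (phi F ` unit_square)"
  by (rule closedin_image_compact[OF compact_unit_square Hausdorff_projective_plane phi(1)])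

lemma closedin_arc:
  assumes "e \<in> edges G" "0 \<le> a" "b \<le> 1"
  shows "closedin P2 (crv e ` {a..b})"
proof (rule closedin_image_compact[OF _ Hausdorff_projective_plane])
  show "continuous_map (top_of_set {a..b}) P2 (crv e)"
    by (rule continuous_map_from_subtopology_mono[OF crv_continuous[OF assms(1)]]) (use assms in auto)
qed simp

lemma cell_cases:
  assumes "F \<in> Fs" "x \<in> phi F ` unit_square"
  obtains "x \<in> F" | i t where "i < 4" "t \<in> {0..1}" "x = crv (side F i) t"
proof -
  obtain p where p: "p \<in> unit_square" "x = phi F p" using assms(2) by blast
  from p(1) show ?thesis
  proof (cases rule: unit_square_cases)
    case 1
    then show ?thesis using that(1) phi_open_in_face[OF assms(1)] p(2) by blast
  next
    case (2 i s)
    then show ?thesis using that(2)[of i "par F i s"] crv_par[OF assms(1) 2(1,2)] p(2) by simp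
  qed
qed

lemma face_subset_cell: "F \<in> Fs \<Longrightarrow> F \<subseteq> phi F ` unit_square"
  using phi_image[of F] by (metis image_mono open_square_def unit_square_def Sigma_mono greaterThanLessThan_subseteq_atLeastAtMost_iff order_refl)

lemma arc_subset_cell: "F \<in> Fs \<Longrightarrow> i < 4 \<Longrightarrow> crv (side F i) ` {0..1} \<subseteq> phi F ` unit_square"
  unfolding side(2)[symmetric] using side_path_in_unit_square by (intro image_mono) blast

lemma point_cases:
  assumes "x \<in> topspace P2" "x \<notin> pos ` verts G"
  obtains F where "F \<in> Fs" "x \<in> F" | e t where "e \<in> edges G" "t \<in> {0<..<1}" "x = crv e t"
proof (cases "x \<in> Dr")
  case True
  then obtain e t where e: "e \<in> edges G" "t \<in> {0..1}" "x = crv e t"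
    using assms(2) unfolding drawing_def by blast
  then have "t \<noteq> 0 \<and> t \<noteq> 1" using crv_end_in_verts assms(2) by blast
  then show ?thesis using that(2)[OF e(1) _ e(3)] e(2) by simp
next
  case False
  then show ?thesis using face_cover[OF assms(1)] that(1) by blast
qed

lemma topspace_P2_diff_finite_nonempty:
  assumes "finite S"
  shows "topspace P2 - S \<noteq> {}"
proof
  assume "topspace P2 - S = {}"
  then have sub: "antipodal_pair ` sphere 0 1 \<subseteq> S" unfolding topspace_projective_plane by blast
  have "sphere (0 :: real ^ 3) 1 \<subseteq> \<Union> (antipodal_pair ` sphere 0 1)"
    by (auto simp: antipodal_pair_def)
  moreover have "finite (\<Union> (antipodal_pair ` sphere (0 :: real ^ 3) 1))"
    using finite_subset[OF sub assms] by (intro finite_Union) (auto simp: antipodal_pair_def)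
  ultimately have fin: "finite (sphere (0 :: real ^ 3) 1)" by (rule finite_subset)
  have ax: "axis 1 1 \<in> sphere (0 :: real ^ 3) 1" "- axis 1 1 \<in> sphere (0 :: real ^ 3) 1"
    by (simp_all add: norm_axis_1)
  have "connected (sphere (0 :: real ^ 3) 1)" by (rule connected_sphere) simp
  then obtain a where "sphere (0 :: real ^ 3) 1 = {a}" using fin ax connected_finite_iff_sing by fastforce
  then have "axis 1 1 = - (axis 1 1 :: real ^ 3)" using ax by simp
  then have "(axis 1 1 :: real ^ 3) $ 1 = - (axis 1 1 :: real ^ 3) $ 1" by (metis vector_uminus_component)
  then show False by simp
qed

lemma crv_not_in_face: "e \<in> edges G \<Longrightarrow> t \<in> {0..1} \<Longrightarrow> F \<in> Fs \<Longrightarrow> crv e t \<notin> F"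
  using crv_in_Dr face_subset by blast

text \<open>Without faces the surface would be a graph, and removing all vertices and one interior
  point of an edge would disconnect it, contrary to the connectedness of cofinite sets.\<close>

lemma Fs_nonempty: "Fs \<noteq> {}"
proof
  assume empty: "Fs = {}"
  have fin: "finite (pos ` verts G)" using finite_verts by simp
  obtain x where x: "x \<in> topspace P2" "x \<notin> pos ` verts G"
    using topspace_P2_diff_finite_nonempty[OF fin] by blast
  from x obtain e t where e: "e \<in> edges G" "t \<in> {0<..<1}" "x = crv e t"
    using empty by (cases rule: point_cases) auto
  let ?Y = "topspace P2 - insert x (pos ` verts G)"
  let ?A = "crv e ` {0..t}" and ?B = "crv e ` {t..1} \<union> (\<Union>e'\<in>edges G - {e}. crv e' ` {0..1})"
  have conn: "connectedin P2 ?Y" by (rule connectedin_projective_plane_diff_finite) (simp add: fin)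
  have sub: "crv e' s \<in> ?Y" if "e' \<in> edges G" "s \<in> {0<..<1}" "(e', s) \<noteq> (e, t)" for e' s
  proof -
    have "crv e' s \<in> topspace P2"
      using continuous_map_image_subset_topspace[OF crv_continuous[OF that(1)]] that(2) by auto
    moreover have "crv e' s \<noteq> x"
      using crv_eqD[OF that(1) e(1) that(2), of t] e(2,3) that(3) by auto
    ultimately show ?thesis using crv_interior[OF that(1,2)] by simp
  qed
  have "closedin P2 ?A" using closedin_arc[OF e(1), of 0 t] e(2) by simp
  moreover have "closedin P2 ?B"
    using e finite_edges by (intro closedin_Un closedin_Union closedin_arc) (auto intro: closedin_arc)
  moreover have "?Y \<subseteq> ?A \<union> ?B"
  proof
    fix y assume y: "y \<in> ?Y"
    then have "y \<in> topspace P2" "y \<notin> pos ` verts G" by auto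
    then obtain e' s where s: "e' \<in> edges G" "s \<in> {0<..<1}" "y = crv e' s"
      using empty by (cases rule: point_cases) auto
    show "y \<in> ?A \<union> ?B"
    proof (cases "e' = e")
      case True
      then show ?thesis using s by (cases "s \<le> t") auto
    next
      case False
      then have "e' \<in> edges G - {e}" "y \<in> crv e' ` {0..1}" using s by auto
      then show ?thesis by blast
    qed
  qed
  moreover have "?A \<inter> ?B \<inter> ?Y = {}"
  proof (rule ccontr)
    assume "\<not> ?thesis"
    then obtain y where y: "y \<in> ?A" "y \<in> ?B" "y \<in> ?Y" by blast
    obtain s where s: "s \<in> {0..t}" "y = crv e s" using y(1) by blast
    have "s \<noteq> t" using y(3) s(2) e(3) by auto
    moreover have "s \<noteq> 0" using crv_end_in_verts[OF e(1), of 0] y(3) s(2) by auto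
    ultimately have s': "s \<in> {0<..<1}" "s < t" using s(1) e(2) by auto
    have "\<exists>e' s2. e' \<in> edges G \<and> s2 \<in> {0..1} \<and> y = crv e' s2 \<and> (e' = e \<longrightarrow> t \<le> s2)"
    proof (cases "y \<in> crv e ` {t..1}")
      case True
      then obtain s2 where "s2 \<in> {t..1}" "y = crv e s2" by blast
      then show ?thesis using e by (intro exI[of _ e] exI[of _ s2]) auto
    next
      case False
      then show ?thesis using y(2) by blast
    qed
    then obtain e' s2 where s2: "e' \<in> edges G" "s2 \<in> {0..1}" "y = crv e' s2" "e' = e \<longrightarrow> t \<le> s2"
      by blast
    have "e = e' \<and> s = s2" using crv_eqD[OF e(1) s2(1) s'(1) s2(2)] s(2) s2(3) by simp
    then show False using s'(2) s2(4) by simp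
  qed
  moreover have "?A \<inter> ?Y \<noteq> {}"
  proof -
    have "crv e (t/2) \<in> ?Y" by (rule sub) (use e in auto)
    moreover have "crv e (t/2) \<in> ?A" using e(2) by (intro imageI) auto
    ultimately have "crv e (t/2) \<in> ?A \<inter> ?Y" by (rule IntI[rotated])
    then show ?thesis by (metis emptyE)
  qed
  moreover have "?B \<inter> ?Y \<noteq> {}"
  proof -
    have "crv e ((t + 1)/2) \<in> ?Y" by (rule sub) (use e in auto)
    moreover have "crv e ((t + 1)/2) \<in> ?B" using e(2) by (intro UnI1 imageI) auto
    ultimately have "crv e ((t + 1)/2) \<in> ?B \<inter> ?Y" by (rule IntI[rotated])
    then show ?thesis by (metis emptyE)
  qed
  ultimately show False using connectedin_closedinD[OF conn] by metis
qed

text \<open>Removing finitely many points does not disconnect the projective plane, so a class of faces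
  closed under sharing an edge is everything.\<close>

lemma faces_connected:
  assumes K: "K \<subseteq> Fs" "K \<noteq> {}"
    and closed: "\<And>F F' i j. F \<in> K \<Longrightarrow> F' \<in> Fs \<Longrightarrow> i < 4 \<Longrightarrow> j < 4 \<Longrightarrow> side F i = side F' j \<Longrightarrow> F' \<in> K"
  shows "K = Fs" and "e \<in> edges G \<Longrightarrow> \<exists>F\<in>Fs. \<exists>i<4. side F i = e"
proof -
  \<comment> \<open>Edges on no face are put into \<open>?B\<close>, so that one separation argument
    also shows that there are none.\<close>
  let ?un = "{e \<in> edges G. \<forall>F\<in>Fs. \<forall>i<4. side F i \<noteq> e}"
  let ?Y = "topspace P2 - pos ` verts G"
  let ?A = "\<Union>F\<in>K. phi F ` unit_square"
  let ?B = "(\<Union>F\<in>Fs - K. phi F ` unit_square) \<union> (\<Union>e\<in>?un. crv e ` {0..1})"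
  have fin: "finite (pos ` verts G)" using finite_verts by simp
  have conn: "connectedin P2 ?Y" by (rule connectedin_projective_plane_diff_finite[OF fin])
  have faceY: "F \<subseteq> ?Y" if "F \<in> Fs" for F
    using face_subset[OF that] unfolding drawing_def by blast
  have clA: "closedin P2 ?A"
    using K(1) finite_Fs finite_subset by (intro closedin_Union) (auto intro: closedin_cell)
  have clB: "closedin P2 ?B"
    using finite_Fs finite_edges by (intro closedin_Un closedin_Union) (auto intro: closedin_cell closedin_arc)
  have cover: "?Y \<subseteq> ?A \<union> ?B"
  proof
    fix y assume "y \<in> ?Y"
    then have "y \<in> topspace P2" "y \<notin> pos ` verts G" by auto
    then show "y \<in> ?A \<union> ?B"
    proof (cases rule: point_cases)
      case (1 F)
      then show ?thesis using face_subset_cell[of F] by blast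
    next
      case (2 e t)
      then have y: "y \<in> crv e ` {0..1}" by auto
      show ?thesis
      proof (cases "e \<in> ?un")
        case True
        then show ?thesis using y by blast
      next
        case False
        then obtain F i where "F \<in> Fs" "i < 4" "side F i = e" using 2(1) by blast
        then show ?thesis using arc_subset_cell[of F i] y by blast
      qed
    qed
  qed
  have disj: "?A \<inter> ?B \<inter> ?Y = {}"
  proof (rule ccontr)
    assume "\<not> ?thesis"
    then obtain y where y: "y \<in> ?A" "y \<in> ?B" "y \<in> ?Y" by blast
    obtain F where F: "F \<in> K" "y \<in> phi F ` unit_square" using y(1) by blast
    have "F \<in> Fs" using F(1) K(1) by blast
    have yv: "y \<notin> pos ` verts G" using y(3) by blast
    have int: "t \<in> {0<..<1}" if "e \<in> edges G" "t \<in> {0..1}" "y = crv e t" for e t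
      using crv_end_in_verts[OF that(1), of t] that yv by auto
    show False
    proof (cases "y \<in> (\<Union>e\<in>?un. crv e ` {0..1})")
      case True
      then obtain e t where e: "e \<in> ?un" "t \<in> {0..1}" "y = crv e t" by blast
      then have "e \<in> edges G" by simp
      from \<open>F \<in> Fs\<close> F(2) show False
      proof (cases rule: cell_cases)
        case 1
        then show False using crv_not_in_face[OF \<open>e \<in> edges G\<close> e(2) \<open>F \<in> Fs\<close>] e(3) by simp
      next
        case (2 i s)
        have "e = side F i"
          using crv_eqD[OF \<open>e \<in> edges G\<close> side(1)[OF \<open>F \<in> Fs\<close> 2(1)] int[OF \<open>e \<in> edges G\<close> e(2,3)] 2(2)] e(3) 2(3) by simp
        then show False using e(1) \<open>F \<in> Fs\<close> 2(1) by blast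
      qed
    next
      case False
      then obtain F' where F': "F' \<in> Fs" "F' \<notin> K" "y \<in> phi F' ` unit_square" using y(2) by blast
      from \<open>F \<in> Fs\<close> F(2) show False
      proof (cases rule: cell_cases)
        case 1
        note yF = 1
        from F'(1,3) show False
        proof (cases rule: cell_cases)
          case 1
          then show False using face_eqI[OF \<open>F \<in> Fs\<close> F'(1) yF] F(1) F'(2) by simp
        next
          case (2 i s)
          then show False using crv_not_in_face[OF side(1)[OF F'(1) 2(1)] 2(2) \<open>F \<in> Fs\<close>] yF by simp
        qed
      next
        case (2 i s)
        note ii = 2
        note e = side(1)[OF \<open>F \<in> Fs\<close> ii(1)]
        from F'(1,3) show False
        proof (cases rule: cell_cases)
          case 1
          then show False using crv_not_in_face[OF e ii(2) F'(1)] ii(3) by simp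
        next
          case (2 j t)
          have "side F i = side F' j"
            using crv_eqD[OF e side(1)[OF F'(1) 2(1)] int[OF e ii(2,3)] 2(2)] ii(3) 2(3) by simp
          then show False using closed[OF F(1) F'(1) ii(1) 2(1)] F'(2) by simp
        qed
      qed
    qed
  qed
  obtain F0 where F0: "F0 \<in> K" using K(2) by blast
  then have "F0 \<in> Fs" using K(1) by blast
  then obtain x0 where "x0 \<in> F0" using face_nonempty by blast
  then have "x0 \<in> ?A" "x0 \<in> ?Y"
    using face_subset_cell[OF \<open>F0 \<in> Fs\<close>] faceY[OF \<open>F0 \<in> Fs\<close>] F0 by blast+
  then have A: "?A \<inter> ?Y \<noteq> {}" by (metis IntI emptyE)
  have B: "?B \<inter> ?Y = {}" by (rule disjE[OF connectedin_closedinD[OF conn clA clB cover disj]]) (erule notE[OF A], assumption)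
  show "K = Fs"
  proof (rule ccontr)
    assume "K \<noteq> Fs"
    then obtain F where F: "F \<in> Fs" "F \<notin> K" using K(1) by blast
    then obtain x where x: "x \<in> F" using face_nonempty by blast
    then have "x \<in> phi F ` unit_square" using face_subset_cell[OF F(1)] by blast
    then have "x \<in> ?B" by (intro UnI1 UN_I[of F]) (use F in simp_all)
    moreover have "x \<in> ?Y" using faceY[OF F(1)] x by (rule subsetD)
    ultimately have "x \<in> ?B \<inter> ?Y" by (rule IntI)
    then show False unfolding B by (rule emptyE)
  qed
  show "\<exists>F\<in>Fs. \<exists>i<4. side F i = e" if e: "e \<in> edges G"
  proof (rule ccontr)
    assume "\<not> ?thesis"
    then have "e \<in> ?un" using e by simp
    then have "crv e (1/2) \<in> ?B" by (intro UnI2 UN_I[of e] imageI) simp_all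
    moreover have "crv e (1/2) \<in> ?Y"
      using crv_interior[OF e, of "1/2"] continuous_map_image_subset_topspace[OF crv_continuous[OF e]] by auto
    ultimately have "crv e (1/2) \<in> ?B \<inter> ?Y" by (rule IntI)
    then show False unfolding B by (rule emptyE)
  qed
qed

end

section \<open>Potentials from maps to the punctured plane\<close>

definition turn :: "real \<Rightarrow> complex" where
  "turn r = exp (2 * of_real pi * \<i> * of_real r)"

lemma turn_int: "turn (of_int n) = 1"
  unfolding turn_def exp_eq_1 by simp

lemma turn_add: "turn (r + s) = turn r * turn s"
  unfolding turn_def exp_add[symmetric] by (simp add: algebra_simps)

lemma turn_nonzero: "turn r \<noteq> 0"
  by (simp add: turn_def)

lemma continuous_on_turn: "continuous_on S f \<Longrightarrow> continuous_on S (\<lambda>x. turn (f x))"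
  unfolding turn_def by (intro continuous_intros)

context embedded_quadrangulation begin

text \<open>The map \<open>g\<close> is 1 at the vertices and winds \<open>w e\<close> times along
  \<open>e\<close>. A vanishing face sum means winding number 0 around the face, so \<open>g\<close>
  extends over it through a real-valued angle. The values of a global logarithm at the vertices,
  divided by 2 pi i, form the potential.\<close>

lemma integer_potential:
  assumes w: "\<And>F. F \<in> Fs \<Longrightarrow>
      (\<Sum>i<4. if src (side F i) = corner F i then w (side F i) else - w (side F i)) = (0::int)"
  shows "\<exists>p. \<forall>e\<in>edges G. w e = p (trg e) - p (src e)"
proof -
  have "\<exists>L. continuous_on unit_square L \<and>
      (\<forall>i<4. \<forall>s\<in>{0..1}. turn (L (side_path i s)) = turn (of_int (w (side F i)) * par F i s))"
    if F: "F \<in> Fs" for F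
  proof -
    define n where "n i = (if src (side F i) = corner F i then w (side F i) else - w (side F i))" for i
    define l where "l i = (\<Sum>j<i. n j)" for i :: nat
    \<comment> \<open>\<open>b i\<close> has to run from \<open>l i\<close> to
      \<open>l (Suc i)\<close>. On an edge traversed backwards \<open>par F i\<close> starts at 1,
      which the subtracted weight compensates; integral offsets are invisible to
      \<open>turn\<close>.\<close>
    define m where "m i = l i - (if par F i 0 = 0 then 0 else w (side F i))" for i
    define b where "b i s = of_int (m i) + of_int (w (side F i)) * par F i s" for i s
    have b0: "b i 0 = of_int (l i)" and b1: "b i 1 = of_int (l (Suc i))" if "i < 4" for i
    proof -
      have n: "n i = (if par F i 0 = 0 then w (side F i) else - w (side F i))"
        unfolding n_def src_side_eq_corner_iff[OF F that] ..
      have "l (Suc i) = l i + n i" by (simp add: l_def)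
      then show "b i 0 = of_int (l i)" "b i 1 = of_int (l (Suc i))"
        using par_ends[OF F that] n unfolding b_def m_def by auto
    qed
    have "\<exists>L. continuous_on unit_square L \<and> (\<forall>i<4. \<forall>s\<in>{0..1}. L (side_path i s) = b i s)"
    proof (rule ex_continuous_with_boundary_values)
      show "continuous_on {0..1} (b i)" if "i < 4" for i
        unfolding b_def by (intro continuous_intros continuous_on_par F that)
      show "b i 1 = b (Suc i mod 4) 0" if "i < 4" for i
      proof (cases "i = 3")
        case True
        \<comment> \<open>The angle returns to its initial value after the fourth side because the
          face sum vanishes.\<close>
        have "l (Suc i) = 0" using w[OF F] True unfolding l_def n_def by simp
        then show ?thesis using b1[OF that] b0[of 0] True by (simp add: l_def)
      next
        case False
        then have "Suc i < 4" using that by simp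
        then show ?thesis using b1[OF that] b0[of "Suc i"] by simp
      qed
    qed
    then obtain L where L: "continuous_on unit_square L" "\<forall>i<4. \<forall>s\<in>{0..1}. L (side_path i s) = b i s" by blast
    have "turn (b i s) = turn (of_int (w (side F i)) * par F i s)" for i s
      unfolding b_def turn_add turn_int by simp
    then show ?thesis using L by (intro exI[of _ L]) simp
  qed
  then have "\<forall>F\<in>Fs. \<exists>L. continuous_on unit_square L \<and>
      (\<forall>i<4. \<forall>s\<in>{0..1}. turn (L (side_path i s)) = turn (of_int (w (side F i)) * par F i s))" by blast
  from bchoice[OF this] obtain L where L: "\<And>F. F \<in> Fs \<Longrightarrow> continuous_on unit_square (L F)"
    "\<And>F i s. F \<in> Fs \<Longrightarrow> i < 4 \<Longrightarrow> s \<in> {0..1} \<Longrightarrow> turn (L F (side_path i s)) = turn (of_int (w (side F i)) * par F i s)"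
    by blast
  \<comment> \<open>Values are prescribed on open faces, open edges and vertices, which are
    disjoint; \<open>g_cell\<close> then shows that they agree with the angle on each closed
    cell.\<close>
  define val where "val x z \<longleftrightarrow> (\<exists>F\<in>Fs. \<exists>p\<in>open_square. x = phi F p \<and> z = turn (L F p)) \<or>
      (\<exists>e\<in>edges G. \<exists>t\<in>{0<..<1}. x = crv e t \<and> z = turn (of_int (w e) * t)) \<or> (x \<in> pos ` verts G \<and> z = 1)" for x z
  define g where "g x = (THE z. val x z)" for x
  have g_open: "g (phi F p) = turn (L F p)" if F: "F \<in> Fs" "p \<in> open_square" for F p
    unfolding g_def
  proof (rule the_equality)
    show "val (phi F p) (turn (L F p))" unfolding val_def using F by blast
    fix z assume z: "val (phi F p) z"
    have nD: "phi F p \<notin> Dr" by (rule phi_open_notin_Dr[OF F])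
    have "phi F p \<noteq> crv e t" if "e \<in> edges G" "t \<in> {0<..<1}" for e t
      using nD crv_in_Dr[OF that(1), of t] that(2) by auto
    moreover have "phi F p \<notin> pos ` verts G" using nD unfolding drawing_def by blast
    ultimately obtain F' p' where F': "F' \<in> Fs" "p' \<in> open_square" "phi F p = phi F' p'" "z = turn (L F' p')"
      using z unfolding val_def by blast
    have "F = F'" using face_eqI[OF F(1) F'(1) phi_open_in_face[OF F]] phi_open_in_face[OF F'(1,2)] F'(3) by simp
    then have "p = p'" using inj_onD[OF phi_inj[OF F(1)]] F F' by simp
    then show "z = turn (L F p)" using F'(4) \<open>F = F'\<close> by simp
  qed
  have g_vert: "g x = 1" if x: "x \<in> pos ` verts G" for x
    unfolding g_def
  proof (rule the_equality)
    show "val x 1" unfolding val_def using x by blast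
    fix z assume z: "val x z"
    have "x \<in> Dr" using x unfolding drawing_def by blast
    then have "x \<noteq> phi F p" if "F \<in> Fs" "p \<in> open_square" for F p using phi_open_notin_Dr[OF that] by auto
    moreover have "x \<noteq> crv e t" if "e \<in> edges G" "t \<in> {0<..<1}" for e t using crv_interior[OF that] x by auto
    ultimately show "z = 1" using z unfolding val_def by blast
  qed
  have g_edge: "g (crv e t) = turn (of_int (w e) * t)" if e: "e \<in> edges G" "t \<in> {0..1}" for e t
  proof (cases "t = 0 \<or> t = 1")
    case True
    then have "g (crv e t) = 1" by (intro g_vert crv_end_in_verts e)
    moreover have "turn (of_int (w e) * t) = 1" using True turn_int[of 0] turn_int[of "w e"] by auto
    ultimately show ?thesis by simp
  next
    case False
    then have t: "t \<in> {0<..<1}" using e(2) by simp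
    show ?thesis unfolding g_def
    proof (rule the_equality)
      show "val (crv e t) (turn (of_int (w e) * t))" unfolding val_def using e(1) t by blast
      fix z assume z: "val (crv e t) z"
      have "crv e t \<noteq> phi F p" if "F \<in> Fs" "p \<in> open_square" for F p
        using phi_open_notin_Dr[OF that] crv_in_Dr[OF e] by auto
      moreover have "crv e t \<notin> pos ` verts G" by (rule crv_interior[OF e(1) t])
      ultimately obtain e' t' where e': "e' \<in> edges G" "t' \<in> {0<..<1}" "crv e t = crv e' t'" "z = turn (of_int (w e') * t')"
        using z unfolding val_def by blast
      then show "z = turn (of_int (w e) * t)" using crv_eqD[OF e(1) e'(1) t, of t'] by simp
    qed
  qed
  have g_cell: "g (phi F p) = turn (L F p)" if F: "F \<in> Fs" "p \<in> unit_square" for F p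
    using F(2)
  proof (cases rule: unit_square_cases)
    case 1 then show ?thesis by (rule g_open[OF F(1)])
  next
    case (2 i s)
    have "g (phi F p) = g (crv (side F i) (par F i s))" using crv_par(2)[OF F(1) 2(1,2)] 2(3) by simp
    also have "\<dots> = turn (of_int (w (side F i)) * par F i s)"
      by (rule g_edge[OF side(1)[OF F(1) 2(1)] crv_par(1)[OF F(1) 2(1,2)]])
    finally show ?thesis using L(2)[OF F(1) 2(1,2)] 2(3) by simp
  qed
  define T where "T = (\<lambda>F. phi F ` unit_square) ` Fs \<union> (\<lambda>e. crv e ` {0..1}) ` edges G \<union> (\<lambda>v. {pos v}) ` verts G"
  have pos_top: "pos v \<in> topspace P2" if "v \<in> verts G" for v
  proof -
    have "pos ` verts G \<subseteq> topspace P2" using embedded unfolding embedded_in_def by (elim conjE)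
    then show ?thesis using that by blast
  qed
  have glue_cont: "continuous_map (subtopology P2 (\<psi> ` D)) euclidean g"
    if "compact D" "continuous_map (top_of_set D) P2 \<psi>" "continuous_on D h" "\<And>p. p \<in> D \<Longrightarrow> g (\<psi> p) = h p"
    for \<psi> :: "'c::t2_space \<Rightarrow> (real ^ 3) set" and D h
  proof (rule continuous_compose_quotient_map[OF quotient_map_from_compact[OF that(1) Hausdorff_projective_plane that(2)]])
    have "continuous_on D (g \<circ> \<psi>)" by (rule continuous_on_eq[OF that(3)]) (simp add: that(4))
    then show "continuous_map (top_of_set D) euclidean (g \<circ> \<psi>)" by simp
  qed
  have contg: "continuous_map P2 euclidean g"
  proof (rule pasting_lemma_closed[where I = T and T = "\<lambda>S. S" and f = "\<lambda>_. g"])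
    show "finite T" unfolding T_def using finite_Fs finite_edges finite_verts by simp
    show "closedin P2 S" if S: "S \<in> T" for S
      using S unfolding T_def
      by (auto intro: closedin_cell closedin_arc closedin_Hausdorff_singleton[OF Hausdorff_projective_plane] pos_top)
    show "continuous_map (subtopology P2 S) euclidean g" if S: "S \<in> T" for S
    proof -
      consider F where "F \<in> Fs" "S = phi F ` unit_square" | e where "e \<in> edges G" "S = crv e ` {0..1}"
        | v where "v \<in> verts G" "S = {pos v}" using S unfolding T_def by blast
      then show ?thesis
      proof cases
        case 1
        show ?thesis unfolding 1(2)
          by (rule glue_cont[OF compact_unit_square phi(1)[OF 1(1)] continuous_on_turn[OF L(1)[OF 1(1)]] g_cell[OF 1(1)]])
      next
        case 2
        show ?thesis unfolding 2(2)
          by (rule glue_cont[OF compact_Icc crv_continuous[OF 2(1)] _ g_edge[OF 2(1)]])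
            (intro continuous_on_turn continuous_intros)
      next
        case 3
        have "continuous_map (subtopology P2 S) euclidean (\<lambda>_. g (pos v))" by simp
        then show ?thesis by (rule continuous_map_eq) (use 3 in auto)
      qed
    qed
    show "\<exists>S. S \<in> T \<and> x \<in> S \<and> g x = g x" if x: "x \<in> topspace P2" for x
    proof (cases "x \<in> pos ` verts G")
      case True
      then obtain v where "v \<in> verts G" "x = pos v" by blast
      then show ?thesis unfolding T_def by (intro exI[of _ "{pos v}"]) simp
    next
      case False
      from x False show ?thesis
      proof (cases rule: point_cases)
        case (1 F)
        then show ?thesis using face_subset_cell[OF 1(1)] unfolding T_def
          by (intro exI[of _ "phi F ` unit_square"]) blast
      next
        case (2 e t)
        then have "x \<in> crv e ` {0..1}" by auto
        then show ?thesis using 2(1) unfolding T_def by (intro exI[of _ "crv e ` {0..1}"]) blast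
      qed
    qed
  qed simp
  have g_nz: "g x \<noteq> 0" if x: "x \<in> topspace P2" for x
  proof (cases "x \<in> pos ` verts G")
    case True then show ?thesis using g_vert by simp
  next
    case False
    from x False show ?thesis
    proof (cases rule: point_cases)
      case (1 F)
      then obtain p where "p \<in> open_square" "x = phi F p" using phi_image[of F] by blast
      then show ?thesis using g_open[OF 1(1)] turn_nonzero by simp
    next
      case (2 e t)
      then show ?thesis using g_edge[of e t] turn_nonzero by simp
    qed
  qed
  obtain h where h: "continuous_map P2 euclidean h" "\<And>x. x \<in> topspace P2 \<Longrightarrow> g x = exp (h x)"
    using continuous_logarithm_projective_plane[OF contg g_nz] by blast
  have "\<exists>n :: int. h (pos v) = of_real (2 * pi) * \<i> * of_int n" if v: "v \<in> verts G" for v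
  proof -
    have "exp (h (pos v)) = 1" using h(2)[OF pos_top[OF v]] g_vert[of "pos v"] v by simp
    then obtain n :: int where "Re (h (pos v)) = 0" "Im (h (pos v)) = of_int (2 * n) * pi"
      unfolding exp_eq_1 by blast
    then show ?thesis by (intro exI[of _ n]) (simp add: complex_eq_iff)
  qed
  then have "\<forall>v\<in>verts G. \<exists>n :: int. h (pos v) = of_real (2 * pi) * \<i> * of_int n" by blast
  from bchoice[OF this] obtain p :: "'v \<Rightarrow> int" where p: "\<And>v. v \<in> verts G \<Longrightarrow> h (pos v) = of_real (2 * pi) * \<i> * of_int (p v)"
    by blast
  show ?thesis
  proof (intro exI[of _ p] ballI)
    fix e assume e: "e \<in> edges G"
    \<comment> \<open>The difference of two logarithms of \<open>g\<close> along the edge is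
      constant; comparing both ends gives the increment of \<open>h\<close>.\<close>
    define k where "k t = h (crv e t) - 2 * of_real pi * \<i> * of_real (of_int (w e) * t)" for t
    have ch: "continuous_on {0..1} (h \<circ> crv e)"
      using continuous_map_compose[OF crv_continuous[OF e] h(1)] by simp
    have ck: "continuous_on {0..1} k"
      unfolding k_def using ch by (intro continuous_intros) (simp add: o_def)
    have top: "crv e t \<in> topspace P2" if "t \<in> {0..1}" for t
      using continuous_map_image_subset_topspace[OF crv_continuous[OF e]] that by auto
    have "exp (k t) = 1" if "t \<in> {0..1}" for t
      using h(2)[OF top[OF that]] g_edge[OF e that] turn_nonzero unfolding k_def exp_diff turn_def by simp
    then have "k 1 = k 0" by (intro constant_on_if_exp_eq_1[OF connected_Icc ck]) auto
    then have "h (pos (trg e)) - 2 * of_real pi * \<i> * of_int (w e) = h (pos (src e))"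
      unfolding k_def pos_src(1)[OF e] pos_trg(1)[OF e] by simp
    then have "of_real (2 * pi) * \<i> * (of_int (p (trg e)) - of_int (w e) - of_int (p (src e))) = (0 :: complex)"
      unfolding p[OF pos_src(2)[OF e]] p[OF pos_trg(2)[OF e]] by (simp add: algebra_simps)
    then have "(of_int (p (trg e) - w e - p (src e)) :: complex) = 0" by simp
    then show "w e = p (trg e) - p (src e)" unfolding of_int_eq_0_iff by simp
  qed
qed

end

section \<open>The local chromatic number\<close>

context embedded_quadrangulation begin

sublocale connected_quadrangular_complex "edges G" src trg Fs side corner
proof
  show "\<exists>p. \<forall>e\<in>edges G. w e = p (trg e) - p (src e)"
    if "\<And>f. f \<in> Fs \<Longrightarrow> (\<Sum>i<4. if src (side f i) = corner f i then w (side f i) else - w (side f i)) = (0::int)"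
    for w using that by (rule integer_potential)
  show "K = Fs" if "K \<subseteq> Fs" "K \<noteq> {}"
    "\<And>f g i j. f \<in> K \<Longrightarrow> g \<in> Fs \<Longrightarrow> i < 4 \<Longrightarrow> j < 4 \<Longrightarrow> side f i = side g j \<Longrightarrow> g \<in> K" for K
    using that by (rule faces_connected(1))
  show "\<exists>f\<in>Fs. \<exists>i<4. side f i = e" if "e \<in> edges G" for e
    by (rule faces_connected(2)[OF order_refl Fs_nonempty _ that])
  show "card {(f, i). f \<in> Fs \<and> i < 4 \<and> side f i = e} \<le> 2" for e by (rule edge_sides(2))
  show "Fs \<noteq> {}" by (rule Fs_nonempty)
qed (fact finite_edges finite_Fs src_neq_trg side(1) side_corners)+

lemma neighbors_eq_nbr: "neighbors G v = nbr v"
proof -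
  have "nbr v \<subseteq> verts G" using nbr_subset pos_src(2) pos_trg(2) by fastforce
  then show ?thesis unfolding neighbors_def adjacent_def nbr_def using ends_eq by auto
qed

lemma local_coloring_iff:
  "local_coloring k G c \<longleftrightarrow> k \<ge> 1 \<and> (\<forall>v. \<forall>u\<in>nbr v. c u \<noteq> c v) \<and> (\<forall>v. card (c ` nbr v) \<le> k - 1)"
proof -
  have sub: "nbr v \<subseteq> verts G" for v using neighbors_eq_nbr[of v] unfolding neighbors_def by blast
  then have empty: "nbr v = {}" if "v \<notin> verts G" for v using that nbr_sym by blast
  have adj: "adjacent G u v \<longleftrightarrow> v \<in> nbr u" if "v \<in> verts G" for u v
    using that neighbors_eq_nbr[of u] unfolding neighbors_def by blast
  have "proper_coloring G c \<longleftrightarrow> (\<forall>v. \<forall>u\<in>nbr v. c u \<noteq> c v)"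
    unfolding proper_coloring_def using adj sub nbr_sym by (metis subsetD)
  moreover have "(\<forall>v\<in>verts G. card (c ` neighbors G v) \<le> k - 1) \<longleftrightarrow> (\<forall>v. card (c ` nbr v) \<le> k - 1)"
    unfolding neighbors_eq_nbr using empty by (metis card.empty image_empty le0)
  ultimately show ?thesis unfolding local_coloring_def by simp
qed

lemma ex_local_4_coloring: "\<exists>c :: 'v \<Rightarrow> nat. local_coloring 4 G c"
proof -
  obtain c :: "'v \<Rightarrow> nat" where c: "\<forall>v. c v < 4" "\<forall>v\<in>verts G. \<forall>u\<in>nbr v \<inter> verts G. c u \<noteq> c v"
    using four_coloring[OF finite_verts] by blast
  have sub: "nbr v \<subseteq> verts G" for v using neighbors_eq_nbr[of v] unfolding neighbors_def by blast
  have proper: "c u \<noteq> c v" if "u \<in> nbr v" for u v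
    using c(2) that sub[of v] sub[of u] iffD1[OF nbr_sym that] by blast
  have "card (c ` nbr v) \<le> 3" for v
  proof -
    have "c ` nbr v \<subseteq> {..<4} - {c v}" using c(1) proper by auto
    then have "card (c ` nbr v) \<le> card ({..<4} - {c v})" by (intro card_mono) simp_all
    also have "\<dots> = 3" using c(1) by simp
    finally show ?thesis .
  qed
  then show ?thesis unfolding local_coloring_iff using proper by (intro exI[of _ c]) simp
qed

lemma ex_local_2_coloring_if_bipartite:
  fixes b :: "'v \<Rightarrow> bool"
  assumes "\<forall>e\<in>edges G. b (src e) \<noteq> b (trg e)"
  shows "\<exists>c :: 'v \<Rightarrow> nat. local_coloring 2 G c"
proof -
  define c :: "'v \<Rightarrow> nat" where "c v = of_bool (b v)" for v
  have b: "b u \<noteq> b v" if uv: "u \<in> nbr v" for u v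
  proof -
    obtain e where e: "e \<in> edges G" "{src e, trg e} = {v, u}" using uv unfolding nbr_def by blast
    then have "b (src e) \<noteq> b (trg e)" using assms by blast
    then show ?thesis using e(2) by (auto simp: doubleton_eq_iff)
  qed
  have "card (c ` nbr v) \<le> 1" for v
  proof -
    have "c ` nbr v \<subseteq> {of_bool (\<not> b v)}" using b unfolding c_def by auto
    then have "card (c ` nbr v) \<le> card {of_bool (\<not> b v) :: nat}" by (intro card_mono) simp_all
    then show ?thesis by simp
  qed
  moreover have "c u \<noteq> c v" if "u \<in> nbr v" for u v using b[OF that] by (simp add: c_def)
  ultimately show ?thesis unfolding local_coloring_iff by (intro exI[of _ c]) simp
qed

text \<open>There is a face, so some vertex has a neighbour and hence a nonempty palette.\<close>

lemma local_coloring_ge_2: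
  assumes "local_coloring k G c"
  shows "k \<ge> 2"
proof -
  obtain F where F: "F \<in> Fs" using Fs_nonempty by blast
  have "corner F 1 \<in> nbr (corner F 0)" by (rule corner_nbrs(1)[OF F])
  then have "card (c ` nbr (corner F 0)) > 0" using finite_nbr by (auto simp: card_gt_0_iff)
  moreover have "card (c ` nbr (corner F 0)) \<le> k - 1" using assms unfolding local_coloring_iff by blast
  ultimately show ?thesis by linarith
qed

lemma local_coloring_ge_4:
  fixes c :: "'v \<Rightarrow> nat"
  assumes "\<nexists>b :: 'v \<Rightarrow> bool. \<forall>e\<in>edges G. b (src e) \<noteq> b (trg e)" "local_coloring k G c"
  shows "k \<ge> 4"
proof (rule ccontr)
  assume "\<not> ?thesis"
  then have "k - 1 \<le> 2" by simp
  moreover have "\<forall>v. card (c ` nbr v) \<le> k - 1" "\<forall>v. \<forall>u\<in>nbr v. c u \<noteq> c v"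
    using assms(2) unfolding local_coloring_iff by blast+
  ultimately have "local_3_coloring c" unfolding local_3_coloring_def by (meson order.trans)
  then show False by (rule notE[OF assms(1) bipartite_if_local_3_coloring])
qed

lemma local_chromatic_number_2_or_4: "local_chromatic_number G \<in> {2, 4}"
proof (cases "\<exists>b :: 'v \<Rightarrow> bool. \<forall>e\<in>edges G. b (src e) \<noteq> b (trg e)")
  case True
  then obtain b :: "'v \<Rightarrow> bool" where "\<forall>e\<in>edges G. b (src e) \<noteq> b (trg e)" by (elim exE)
  then have "\<exists>c :: 'v \<Rightarrow> nat. local_coloring 2 G c" by (rule ex_local_2_coloring_if_bipartite)
  then have "local_chromatic_number G = 2"
    unfolding local_chromatic_number_def by (rule Least_equality) (elim exE local_coloring_ge_2)
  then show ?thesis by simp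
next
  case False
  have "local_chromatic_number G = 4"
    unfolding local_chromatic_number_def
    by (rule Least_equality, rule ex_local_4_coloring) (elim exE local_coloring_ge_4[OF False])
  then show ?thesis by simp
qed

end

theorem theorem1p3:
  fixes G :: "('v, 'e) multigraph"
  assumes "quadrangulation projective_plane G"
  shows "local_chromatic_number G \<in> {2, 4}"
proof -
  obtain pos crv where "embedded_in projective_plane G pos crv"
    "\<forall>F \<in> faces projective_plane G pos crv. quadrilateral_face projective_plane G crv F"
    using assms unfolding quadrangulation_def by blast
  moreover have "finite_loopless_multigraph G" using assms unfolding quadrangulation_def by blast
  ultimately interpret embedded_quadrangulation G pos crv by unfold_locales blast+
  show ?thesis by (rule local_chromatic_number_2_or_4)
qed

end
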